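(* Let $A$ be a unital separable $C^*$-algebra and $m$ a positive integer. Let $\{\rho_i\}_{i\in I}$ be a complete family of mutually inequivalent irreducible representations of $A$. Then $\{\Sigma_m^2(\rho_i)\}_{i\in I}\cup\{\vartheta_t^m\}_{t\in\mathbb{T}}$ is a complete list of mutually inequivalent irreducible representations of the $m$-torsioned quantum double suspension $\Sigma_m^2A$.
   Context: On $\ell^2(\mathbb{N}_0)$ with basis $(e_j)_{j\ge0}$, $S$ is the left shift $Se_j=e_{j-1}$, $Se_0=0$; $\mathscr{T}=C^*(S)$; $\mathcal{K}$ is the algebra of compact operators on $\ell^2(\mathbb{N}_0)$. For a unital $C^*$-algebra $A$ and $m\in\mathbb{N}$, the $m$-torsioned quantum double suspension $\Sigma_m^2A$ is the $C^*$-subalgebra of $A\otimes\mathscr{T}$ generated by $A\otimes\mathcal{K}$ and $1\otimes(S^* )^m$; equivalently, the middle algebra of the essential extension $0\to A\otimes\mathcal{K}\to\Sigma_m^2A\to C(\mathbb{T})\to0$ whose Busby invariant sends the coordinate function to $[1\otimes(S^* )^m]$ in the corona algebra of $A\otimes\mathcal{K}$. For an irreducible representation $\rho$ of $A$ on $\mathcal{H}$, $\Sigma_m^2(\rho)$ is the representation of $\Sigma_m^2A$ on $\mathcal{H}\otimes\ell^2(\mathbb{N}_0)$ with $\Sigma_m^2(\rho)(a\otimes k)=\rho(a)\otimes k$ for $a\in A$, $k\in\mathcal{K}$, and $\Sigma_m^2(\rho)(1\otimes(S^* )^m)=1\otimes(S^* )^m$. For $t\in\mathbb{T}$, $\vartheta_t^m:\Sigma_m^2A\to\mathbb{C}$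 is the character with $\vartheta_t^m(a\otimes k)=0$ for $a\in A,k\in\mathcal{K}$ and $\vartheta_t^m(1\otimes(S^* )^m)=t$. *)

theory Defs
  imports "HOL-Analysis.Analysis"
begin

section \<open>Complex Hilbert spaces and C*-algebras\<close>

class complex_vector = real_vector +
  fixes scaleC :: "complex \<Rightarrow> 'a \<Rightarrow> 'a" (infixr \<open>*\<^sub>C\<close> 75)
  assumes scaleC_add_right: "c *\<^sub>C (x + y) = c *\<^sub>C x + c *\<^sub>C y"
    and scaleC_add_left: "(c + d) *\<^sub>C x = c *\<^sub>C x + d *\<^sub>C x"
    and scaleC_scaleC: "c *\<^sub>C d *\<^sub>C x = (c * d) *\<^sub>C x"
    and scaleC_of_real: "complex_of_real r *\<^sub>C x = r *\<^sub>R x"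

class complex_normed_vector = complex_vector + real_normed_vector +
  assumes norm_scaleC: "norm (c *\<^sub>C x) = cmod c * norm x"

text \<open>The inner product is linear in its second argument.\<close>

class complex_inner = complex_normed_vector +
  fixes cinner :: "'a \<Rightarrow> 'a \<Rightarrow> complex"
  assumes cinner_commute: "cinner x y = cnj (cinner y x)"
    and cinner_add_right: "cinner x (y + z) = cinner x y + cinner x z"
    and cinner_scaleC_right: "cinner x (c *\<^sub>C y) = c * cinner x y"
    and cinner_self: "cinner x x = complex_of_real ((norm x)\<^sup>2)"

class chilbert_space = complex_inner + banach

class cstar_algebra = complex_normed_vector + real_normed_algebra + banach +
  fixes star :: "'a \<Rightarrow> 'a"
  assumes mult_scaleC_left: "(c *\<^sub>C x) * y = c *\<^sub>C (x * y)"
    and mult_scaleC_right: "x * (c *\<^sub>C y) = c *\<^sub>C (x * y)"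
    and star_star: "star (star x) = x"
    and star_add: "star (x + y) = star x + star y"
    and star_scaleC: "star (c *\<^sub>C x) = cnj c *\<^sub>C star x"
    and star_mult: "star (x * y) = star y * star x"
    and cstar_identity: "norm (star x * x) = (norm x)\<^sup>2"

text \<open>Through \<open>real_normed_algebra_1\<close> a unital C*-algebra is nonzero.\<close>

class unital_cstar_algebra = cstar_algebra + real_normed_algebra_1

subsection \<open>Elementary facts\<close>

lemma scaleC_one [simp]: "1 *\<^sub>C x = x"
  using scaleC_of_real[of 1 x] by simp

lemma scaleC_zero_left [simp]: "0 *\<^sub>C x = 0"
  using scaleC_of_real[of 0 x] by simp

lemma scaleC_zero_right [simp]: "c *\<^sub>C 0 = 0"
  using scaleC_add_right[of c 0 0] by simp

lemma scaleC_minus_one: "(- 1) *\<^sub>C x = - x"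
  using scaleC_of_real[of "- 1" x] by simp

lemma scaleC_minus_right: "c *\<^sub>C (- x) = - (c *\<^sub>C x)"
  using scaleC_add_right[of c x "- x"] by (simp add: eq_neg_iff_add_eq_0 add.commute)

lemma scaleC_diff_right: "c *\<^sub>C (x - y) = c *\<^sub>C x - c *\<^sub>C y"
  using scaleC_add_right[of c x "- y"] by (simp add: scaleC_minus_right)

lemma scaleC_scaleR: "c *\<^sub>C (r *\<^sub>R x) = r *\<^sub>R (c *\<^sub>C x)"
  by (simp add: scaleC_of_real[symmetric] scaleC_scaleC mult.commute)

lemma bounded_linear_scaleC: "bounded_linear (\<lambda>x::'a::complex_normed_vector. c *\<^sub>C x)"
  by (rule bounded_linear_intro[where K = "cmod c"])
    (simp_all add: scaleC_add_right scaleC_scaleR norm_scaleC mult.commute)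

lemma cinner_add_left: "cinner (x + y) z = cinner x z + cinner y z"
  by (metis cinner_add_right cinner_commute complex_cnj_add)

lemma cinner_scaleC_left: "cinner (c *\<^sub>C x) y = cnj c * cinner x y"
  by (metis cinner_scaleC_right cinner_commute complex_cnj_mult)

lemma cinner_scaleR_left: "cinner (r *\<^sub>R x) y = complex_of_real r * cinner x y"
  by (metis cinner_scaleC_left scaleC_of_real complex_cnj_complex_of_real)

lemma cinner_zero_right [simp]: "cinner x 0 = 0"
  using cinner_add_right[of x 0 0] by simp

lemma cinner_zero_left [simp]: "cinner 0 x = 0"
  using cinner_add_left[of 0 0 x] by simp

lemma cinner_minus_right: "cinner x (- y) = - cinner x y"
  using cinner_add_right[of x y "- y"] by (simp add: eq_neg_iff_add_eq_0 add.commute)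

lemma cinner_diff_right: "cinner x (y - z) = cinner x y - cinner x z"
  using cinner_add_right[of x y "- z"] by (simp add: cinner_minus_right)

lemma cinner_diff_left: "cinner (x - y) z = cinner x z - cinner y z"
  by (metis cinner_diff_right cinner_commute complex_cnj_diff)

lemma norm_sq_add: "(norm (x + y :: 'a::complex_inner))\<^sup>2 = (norm x)\<^sup>2 + (norm y)\<^sup>2 + 2 * Re (cinner x y)"
proof -
  have "cinner (x + y) (x + y) = cinner x x + cinner y y + (cinner x y + cinner y x)"
    by (simp add: cinner_add_left cinner_add_right)
  also have "cinner x y + cinner y x = complex_of_real (2 * Re (cinner x y))"
    using cinner_commute[of y x] by (simp add: complex_add_cnj)
  finally have "complex_of_real ((norm (x + y))\<^sup>2) =
      complex_of_real ((norm x)\<^sup>2 + (norm y)\<^sup>2 + 2 * Re (cinner x y))"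
    by (simp only: cinner_self of_real_add)
  then show ?thesis by (simp only: of_real_eq_iff)
qed

lemma parallelogram:
  "(norm (x + y :: 'a::complex_inner))\<^sup>2 + (norm (x - y))\<^sup>2 = 2 * (norm x)\<^sup>2 + 2 * (norm y)\<^sup>2"
  using norm_sq_add[of x y] norm_sq_add[of x "- y"] by (simp add: cinner_minus_right)

lemma cinner_mult_commute: "cinner x y * cinner y x = complex_of_real ((cmod (cinner x y))\<^sup>2)"
  by (metis cinner_commute complex_norm_square of_real_power)

lemma cauchy_schwarz: "cmod (cinner x y) \<le> norm x * norm y"
proof (cases "x = 0")
  case False
  define t where "t = cinner x y / complex_of_real ((norm x)\<^sup>2)"
  have nx: "(norm x)\<^sup>2 > 0" using False by simp
  have tx: "cinner x y = t * complex_of_real ((norm x)\<^sup>2)"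
    using nx by (simp add: t_def)
  have "cinner x (y - t *\<^sub>C x) = 0"
    by (simp add: cinner_diff_right cinner_scaleC_right cinner_self tx)
  then have "cinner (t *\<^sub>C x) (y - t *\<^sub>C x) = 0"
    by (simp add: cinner_scaleC_left)
  then have "(norm (t *\<^sub>C x + (y - t *\<^sub>C x)))\<^sup>2 = (norm (t *\<^sub>C x))\<^sup>2 + (norm (y - t *\<^sub>C x))\<^sup>2"
    by (subst norm_sq_add) simp
  then have "(norm (t *\<^sub>C x))\<^sup>2 \<le> (norm y)\<^sup>2"
    by simp
  then have "cmod t * norm x \<le> norm y"
    by (metis norm_scaleC norm_ge_zero power2_le_imp_le)
  moreover have "cmod (cinner x y) = cmod t * norm x * norm x"
    by (simp add: tx norm_mult power2_eq_square)
  ultimately show ?thesis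
    by (metis mult.commute mult_left_mono norm_ge_zero)
qed simp

lemma cmod_cinner_self: "cmod (cinner x x) = (norm x)\<^sup>2"
  by (simp add: cinner_self norm_power)

lemma cinner_ext: "(\<And>x. cinner y x = cinner z x) \<Longrightarrow> y = z"
  by (metis cinner_diff_left cinner_self eq_iff_diff_eq_0 norm_eq_zero of_real_eq_0_iff
      zero_eq_power2)

lemma bounded_linear_cinner_right: "bounded_linear (cinner (x::'a::complex_inner))"
proof (rule bounded_linear_intro[where K = "norm x"])
  show "cinner x (r *\<^sub>R y) = r *\<^sub>R cinner x y" for r y
    by (metis cinner_scaleC_right scaleC_of_real scaleR_conv_of_real)
  show "norm (cinner x y) \<le> norm y * norm x" for y
    using cauchy_schwarz[of x y] by (simp add: mult.commute)
qed (simp add: cinner_add_right)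

instantiation complex :: chilbert_space
begin

definition scaleC_complex :: "complex \<Rightarrow> complex \<Rightarrow> complex" where
  "scaleC_complex c x = c * x"

definition cinner_complex :: "complex \<Rightarrow> complex \<Rightarrow> complex" where
  "cinner_complex x y = cnj x * y"

instance
proof
  show "cinner x x = complex_of_real ((norm x)\<^sup>2)" for x :: complex
    using complex_norm_square[of x] by (simp add: cinner_complex_def mult.commute)
qed (simp_all add: scaleC_complex_def cinner_complex_def algebra_simps norm_mult
      scaleR_conv_of_real)

end

section \<open>The Hilbert space of square-summable sequences\<close>

text \<open>\<open>'h ell2\<close> consists of the square-summable sequences in \<open>'h\<close> and serves as the Hilbert space
  tensor product of \<open>'h\<close> with \<open>complex ell2\<close>.\<close>

typedef (overloaded) 'h ell2 =
  "{f :: nat \<Rightarrow> 'h::chilbert_space. summable (\<lambda>n. (norm (f n))\<^sup>2)}"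
  morphisms ell2_nth Abs_ell2
  by (intro exI[of _ "\<lambda>_. 0"]) simp

setup_lifting type_definition_ell2

lemma ell2_eqI: "(\<And>n. ell2_nth x n = ell2_nth y n) \<Longrightarrow> x = y"
  by transfer auto

lemma summable_ell2: "summable (\<lambda>n. (norm (ell2_nth x n))\<^sup>2)"
  using ell2_nth[of x] by simp

lemma square_summable_add:
  fixes f g :: "nat \<Rightarrow> 'a::real_normed_vector"
  assumes "summable (\<lambda>n. (norm (f n))\<^sup>2)" "summable (\<lambda>n. (norm (g n))\<^sup>2)"
  shows "summable (\<lambda>n. (norm (f n + g n))\<^sup>2)"
proof (rule summable_comparison_test')
  show "summable (\<lambda>n. 2 * (norm (f n))\<^sup>2 + 2 * (norm (g n))\<^sup>2)"
    using assms by (intro summable_add summable_mult)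
  fix n :: nat
  have "(norm (f n + g n))\<^sup>2 \<le> (norm (f n) + norm (g n))\<^sup>2"
    by (intro power_mono norm_triangle_ineq) simp
  also have "\<dots> \<le> 2 * (norm (f n))\<^sup>2 + 2 * (norm (g n))\<^sup>2"
    using sum_squares_bound[of "norm (f n)" "norm (g n)"] by (simp add: power2_sum)
  finally show "norm ((norm (f n + g n))\<^sup>2) \<le> 2 * (norm (f n))\<^sup>2 + 2 * (norm (g n))\<^sup>2"
    by simp
qed

instantiation ell2 :: (chilbert_space) complex_vector
begin

lift_definition zero_ell2 :: "'a ell2" is "\<lambda>_. 0" by simp
lift_definition plus_ell2 :: "'a ell2 \<Rightarrow> 'a ell2 \<Rightarrow> 'a ell2" is "\<lambda>f g n. f n + g n"
  by (rule square_summable_add)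
lift_definition uminus_ell2 :: "'a ell2 \<Rightarrow> 'a ell2" is "\<lambda>f n. - f n" by simp
lift_definition minus_ell2 :: "'a ell2 \<Rightarrow> 'a ell2 \<Rightarrow> 'a ell2" is "\<lambda>f g n. f n - g n"
proof -
  fix f g :: "nat \<Rightarrow> 'a"
  assume "summable (\<lambda>n. (norm (f n))\<^sup>2)" "summable (\<lambda>n. (norm (g n))\<^sup>2)"
  then show "summable (\<lambda>n. (norm (f n - g n))\<^sup>2)"
    using square_summable_add[of f "\<lambda>n. - g n"] by simp
qed
lift_definition scaleR_ell2 :: "real \<Rightarrow> 'a ell2 \<Rightarrow> 'a ell2" is "\<lambda>r f n. r *\<^sub>R f n"
  by (simp add: power_mult_distrib summable_mult)
lift_definition scaleC_ell2 :: "complex \<Rightarrow> 'a ell2 \<Rightarrow> 'a ell2" is "\<lambda>c f n. c *\<^sub>C f n"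
  by (simp add: norm_scaleC power_mult_distrib summable_mult)

instance
  by standard (transfer; simp add: algebra_simps scaleC_add_right scaleC_add_left scaleC_scaleC
      scaleC_of_real)+

end

lemma ell2_nth_simps [simp]:
  "ell2_nth 0 n = 0"
  "ell2_nth (x + y) n = ell2_nth x n + ell2_nth y n"
  "ell2_nth (- x) n = - ell2_nth x n"
  "ell2_nth (x - y) n = ell2_nth x n - ell2_nth y n"
  "ell2_nth (r *\<^sub>R x) n = r *\<^sub>R ell2_nth x n"
  "ell2_nth (c *\<^sub>C x) n = c *\<^sub>C ell2_nth x n"
  by (transfer; simp)+

instantiation ell2 :: (chilbert_space) complex_inner
begin

definition norm_ell2 :: "'a ell2 \<Rightarrow> real" where
  "norm_ell2 x = sqrt (\<Sum>n. (norm (ell2_nth x n))\<^sup>2)"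

definition sgn_ell2 :: "'a ell2 \<Rightarrow> 'a ell2" where
  "sgn_ell2 x = x /\<^sub>R norm x"

definition dist_ell2 :: "'a ell2 \<Rightarrow> 'a ell2 \<Rightarrow> real" where
  "dist_ell2 x y = norm (x - y)"

definition uniformity_ell2 :: "('a ell2 \<times> 'a ell2) filter" where
  "uniformity_ell2 = (INF e\<in>{0<..}. principal {(x, y). dist x y < e})"

definition open_ell2 :: "'a ell2 set \<Rightarrow> bool" where
  "open_ell2 U = (\<forall>x\<in>U. \<forall>\<^sub>F (x', y) in uniformity. x' = x \<longrightarrow> y \<in> U)"

definition cinner_ell2 :: "'a ell2 \<Rightarrow> 'a ell2 \<Rightarrow> complex" where
  "cinner_ell2 x y = (\<Sum>n. cinner (ell2_nth x n) (ell2_nth y n))"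

lemma norm_sq_ell2: "(norm x)\<^sup>2 = (\<Sum>n. (norm (ell2_nth x n))\<^sup>2)" for x :: "'a ell2"
  unfolding norm_ell2_def by (rule real_sqrt_pow2) (intro suminf_nonneg summable_ell2; simp)

lemma norm_nonneg_ell2: "norm x \<ge> 0" for x :: "'a ell2"
  unfolding norm_ell2_def by (intro real_sqrt_ge_zero suminf_nonneg summable_ell2; simp)

lemma L2_set_le_norm_ell2:
  "finite F \<Longrightarrow> L2_set (\<lambda>n. norm (ell2_nth x n)) F \<le> norm x" for x :: "'a ell2"
  unfolding norm_ell2_def L2_set_def
  by (intro real_sqrt_le_mono sum_le_suminf summable_ell2) auto

lemma norm_ell2_leI:
  fixes x :: "'a ell2"
  assumes "c \<ge> 0" "\<And>N. L2_set (\<lambda>n. norm (ell2_nth x n)) {..<N} \<le> c"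
  shows "norm x \<le> c"
proof -
  have "(\<Sum>n. (norm (ell2_nth x n))\<^sup>2) \<le> c\<^sup>2"
  proof (rule suminf_le_const[OF summable_ell2])
    fix N
    show "(\<Sum>n<N. (norm (ell2_nth x n))\<^sup>2) \<le> c\<^sup>2"
      using assms(2)[of N] unfolding L2_set_def by (rule sqrt_le_D)
  qed
  then show ?thesis
    unfolding norm_ell2_def using assms(1) by (rule real_le_lsqrt[rotated])
qed

lemma summable_cinner_ell2:
  "summable (\<lambda>n. cinner (ell2_nth x n) (ell2_nth y n))" for x y :: "'a ell2"
proof (rule summable_comparison_test')
  show "summable (\<lambda>n. (norm (ell2_nth x n))\<^sup>2 + (norm (ell2_nth y n))\<^sup>2)"
    by (intro summable_add summable_ell2)
  fix n :: nat
  have "cmod (cinner (ell2_nth x n) (ell2_nth y n)) \<le> norm (ell2_nth x n) * norm (ell2_nth y n)"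
    by (rule cauchy_schwarz)
  also have "\<dots> \<le> (norm (ell2_nth x n))\<^sup>2 + (norm (ell2_nth y n))\<^sup>2"
    using sum_squares_bound[of "norm (ell2_nth x n)" "norm (ell2_nth y n)"]
      mult_nonneg_nonneg[OF norm_ge_zero[of "ell2_nth x n"] norm_ge_zero[of "ell2_nth y n"]]
    by linarith
  finally show "cmod (cinner (ell2_nth x n) (ell2_nth y n))
    \<le> (norm (ell2_nth x n))\<^sup>2 + (norm (ell2_nth y n))\<^sup>2" .
qed

instance
proof
  fix x y z :: "'a ell2" and r :: real and c :: complex and U :: "'a ell2 set"
  show "dist x y = norm (x - y)" by (rule dist_ell2_def)
  show "sgn x = x /\<^sub>R norm x" by (rule sgn_ell2_def)
  show "uniformity = (INF e\<in>{0<..}. principal {(x, y :: 'a ell2). dist x y < e})"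
    by (rule uniformity_ell2_def)
  show "open U = (\<forall>x\<in>U. \<forall>\<^sub>F (x', y) in uniformity. x' = x \<longrightarrow> y \<in> U)"
    by (rule open_ell2_def)
  show "norm x = 0 \<longleftrightarrow> x = 0"
  proof
    assume "norm x = 0"
    then have "(\<Sum>n. (norm (ell2_nth x n))\<^sup>2) = 0"
      by (simp add: norm_sq_ell2[symmetric])
    then have "\<forall>n. (norm (ell2_nth x n))\<^sup>2 = 0"
      by (subst (asm) suminf_eq_zero_iff[OF summable_ell2]) auto
    then show "x = 0" by (intro ell2_eqI) simp
  qed (simp add: norm_ell2_def)
  show "norm (x + y) \<le> norm x + norm y"
  proof (rule norm_ell2_leI)
    fix N
    have "L2_set (\<lambda>n. norm (ell2_nth (x + y) n)) {..<N}
        \<le> L2_set (\<lambda>n. norm (ell2_nth x n) + norm (ell2_nth y n)) {..<N}"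
      by (rule L2_set_mono) (simp_all add: norm_triangle_ineq)
    also have "\<dots> \<le> L2_set (\<lambda>n. norm (ell2_nth x n)) {..<N} +
        L2_set (\<lambda>n. norm (ell2_nth y n)) {..<N}"
      by (rule L2_set_triangle_ineq)
    also have "\<dots> \<le> norm x + norm y"
      by (intro add_mono L2_set_le_norm_ell2) simp_all
    finally show "L2_set (\<lambda>n. norm (ell2_nth (x + y) n)) {..<N} \<le> norm x + norm y" .
  qed (simp add: norm_nonneg_ell2)
  have sc: "norm w = cmod d * norm v"
    if "\<And>n. norm (ell2_nth w n) = cmod d * norm (ell2_nth v n)" for w v :: "'a ell2" and d
  proof -
    have "(\<Sum>n. (norm (ell2_nth w n))\<^sup>2) = (cmod d)\<^sup>2 * (\<Sum>n. (norm (ell2_nth v n))\<^sup>2)"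
      by (simp add: that power_mult_distrib suminf_mult[OF summable_ell2])
    then show ?thesis by (simp add: norm_ell2_def real_sqrt_mult)
  qed
  show "norm (r *\<^sub>R x) = \<bar>r\<bar> * norm x"
    using sc[of "r *\<^sub>R x" "complex_of_real r" x] by simp
  show "norm (c *\<^sub>C x) = cmod c * norm x"
    by (rule sc) (simp add: norm_scaleC)
  have cnj_sums: "(\<lambda>n. cnj (cinner (ell2_nth y n) (ell2_nth x n))) sums cnj (cinner y x)"
    unfolding cinner_ell2_def by (subst sums_cnj) (rule summable_sums[OF summable_cinner_ell2])
  show "cinner x y = cnj (cinner y x)"
    using sums_unique[OF cnj_sums] by (simp add: cinner_ell2_def cinner_commute[symmetric])
  show "cinner x (y + z) = cinner x y + cinner x z"
    by (simp add: cinner_ell2_def cinner_add_right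
        suminf_add[OF summable_cinner_ell2 summable_cinner_ell2])
  show "cinner x (c *\<^sub>C y) = c * cinner x y"
    by (simp add: cinner_ell2_def cinner_scaleC_right suminf_mult[OF summable_cinner_ell2])
  show "cinner x x = complex_of_real ((norm x)\<^sup>2)"
    unfolding norm_sq_ell2 cinner_ell2_def
    by (simp add: cinner_self suminf_of_real[OF summable_ell2] del: of_real_power)
qed

end

lemma norm_ell2_nth_le: "norm (ell2_nth x n) \<le> norm x"
  using L2_set_le_norm_ell2[of "{n}" x] by simp

instance ell2 :: (chilbert_space) chilbert_space
proof
  fix X :: "nat \<Rightarrow> 'a ell2"
  assume X: "Cauchy X"
  have "Cauchy (\<lambda>k. ell2_nth (X k) n)" for n
  proof (rule metric_CauchyI)
    fix e :: real assume "e > 0"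
    then obtain M where M: "\<And>k l. k \<ge> M \<Longrightarrow> l \<ge> M \<Longrightarrow> dist (X k) (X l) < e"
      using metric_CauchyD[OF X] by blast
    have "dist (ell2_nth (X k) n) (ell2_nth (X l) n) \<le> dist (X k) (X l)" for k l
      using norm_ell2_nth_le[of "X k - X l" n] by (simp add: dist_norm)
    then show "\<exists>M. \<forall>k\<ge>M. \<forall>l\<ge>M. dist (ell2_nth (X k) n) (ell2_nth (X l) n) < e"
      using M by (meson le_less_trans)
  qed
  then have "\<exists>L. \<forall>n. (\<lambda>k. ell2_nth (X k) n) \<longlonglongrightarrow> L n"
    by (intro choice allI) (meson Cauchy_convergent_iff convergent_def)
  then obtain L where L: "\<And>n. (\<lambda>k. ell2_nth (X k) n) \<longlonglongrightarrow> L n" by blast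
  have part: "\<exists>M. \<forall>k\<ge>M. \<forall>N. L2_set (\<lambda>n. norm (ell2_nth (X k) n - L n)) {..<N} \<le> e"
    if "e > 0" for e
  proof -
    obtain M where M: "\<And>k l. k \<ge> M \<Longrightarrow> l \<ge> M \<Longrightarrow> dist (X k) (X l) < e"
      using metric_CauchyD[OF X \<open>e > 0\<close>] by blast
    have "L2_set (\<lambda>n. norm (ell2_nth (X k) n - L n)) {..<N} \<le> e" if "k \<ge> M" for k N
    proof (rule LIMSEQ_le_const2)
      show "(\<lambda>l. L2_set (\<lambda>n. norm (ell2_nth (X k) n - ell2_nth (X l) n)) {..<N})
          \<longlonglongrightarrow> L2_set (\<lambda>n. norm (ell2_nth (X k) n - L n)) {..<N}"
        unfolding L2_set_def by (intro tendsto_intros L)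
      have "L2_set (\<lambda>n. norm (ell2_nth (X k) n - ell2_nth (X l) n)) {..<N} \<le> e" if "l \<ge> M" for l
        using L2_set_le_norm_ell2[of "{..<N}" "X k - X l"] M[OF \<open>k \<ge> M\<close> that]
        by (simp add: dist_norm)
      then show "\<exists>N'. \<forall>l\<ge>N'. L2_set (\<lambda>n. norm (ell2_nth (X k) n - ell2_nth (X l) n)) {..<N} \<le> e"
        by blast
    qed
    then show ?thesis by blast
  qed
  obtain M where M: "\<And>N. L2_set (\<lambda>n. norm (ell2_nth (X M) n - L n)) {..<N} \<le> 1"
    using part[of 1] by auto
  have "summable (\<lambda>n. (norm (ell2_nth (X M) n - L n))\<^sup>2)"
  proof (rule summableI_nonneg_bounded)
    show "(\<Sum>n<N. (norm (ell2_nth (X M) n - L n))\<^sup>2) \<le> 1" for N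
      using sqrt_le_D[OF M[of N, unfolded L2_set_def]] by simp
  qed simp
  then have "summable (\<lambda>n. (norm (L n - ell2_nth (X M) n))\<^sup>2)"
    by (simp add: norm_minus_commute)
  from square_summable_add[OF this summable_ell2[of "X M"]]
  have "summable (\<lambda>n. (norm (L n))\<^sup>2)" by simp
  then have nth: "ell2_nth (Abs_ell2 L) n = L n" for n
    by (simp add: Abs_ell2_inverse)
  have "X \<longlonglongrightarrow> Abs_ell2 L"
  proof (rule metric_LIMSEQ_I)
    fix e :: real assume "e > 0"
    then obtain M where M: "\<And>k N. k \<ge> M \<Longrightarrow>
        L2_set (\<lambda>n. norm (ell2_nth (X k) n - L n)) {..<N} \<le> e / 2"
      using part[of "e / 2"] by auto
    have "dist (X k) (Abs_ell2 L) \<le> e / 2" if "k \<ge> M" for k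
      unfolding dist_norm by (rule norm_ell2_leI) (use \<open>e > 0\<close> M[OF that] in \<open>simp_all add: nth\<close>)
    then show "\<exists>M. \<forall>k\<ge>M. dist (X k) (Abs_ell2 L) < e"
      using \<open>e > 0\<close> by (intro exI[of _ M] allI impI) (rule le_less_trans[of _ "e / 2"]; simp)
  qed
  then show "convergent X" by (rule convergentI)
qed

section \<open>The C*-algebra of bounded operators\<close>

lemma riesz:
  fixes f :: "'h::chilbert_space \<Rightarrow> complex"
  assumes f: "bounded_linear f" and fC: "\<And>c x. f (c *\<^sub>C x) = c * f x"
  shows "\<exists>z. \<forall>x. f x = cinner z x"
proof (cases "\<forall>x. f x = 0")
  case True
  then show ?thesis by (intro exI[of _ 0]) simp
next
  case False
  interpret bounded_linear f by (rule f)
  from False obtain x0 where x0: "f x0 \<noteq> 0" by blast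
  define M where "M = {x. f x = 1}"
  have "inverse (f x0) *\<^sub>C x0 \<in> M" using x0 by (simp add: M_def fC)
  then have Mne: "M \<noteq> {}" by blast
  define d where "d = Inf (norm ` M)"
  have bdd: "bdd_below (norm ` M)" by (rule bdd_belowI[of _ 0]) auto
  have d_le: "d \<le> norm x" if "x \<in> M" for x
    unfolding d_def using that bdd by (intro cInf_lower) auto
  have d0: "d \<ge> 0" unfolding d_def using Mne by (intro cInf_greatest) auto
  have "\<exists>x\<in>M. norm x < d + inverse (real (Suc n))" for n
    using cInf_lessD[of "norm ` M" "d + inverse (real (Suc n))"] Mne by (auto simp: d_def)
  then obtain X where XM: "\<And>n. X n \<in> M"
    and Xd: "\<And>n. norm (X n) < d + inverse (real (Suc n))" by metis
  have lim: "(\<lambda>n. norm (X n)) \<longlonglongrightarrow> d"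
  proof (rule real_tendsto_sandwich)
    show "(\<lambda>n. d) \<longlonglongrightarrow> d" by simp
    show "(\<lambda>n. d + inverse (real (Suc n))) \<longlonglongrightarrow> d"
      using tendsto_add[OF tendsto_const LIMSEQ_inverse_real_of_nat, of d] by simp
  qed (use d_le XM Xd in \<open>auto intro!: always_eventually simp: less_imp_le\<close>)
  have diff_le: "(norm (x - y))\<^sup>2 \<le> 2 * (norm x)\<^sup>2 + 2 * (norm y)\<^sup>2 - 4 * d\<^sup>2"
    if "x \<in> M" "y \<in> M" for x y
  proof -
    have "f ((1 / 2) *\<^sub>R (x + y)) = (1 / 2) *\<^sub>R (f x + f y)"
      by (simp only: scaleR add)
    then have "(1 / 2) *\<^sub>R (x + y) \<in> M"
      using that by (simp add: M_def scaleR_conv_of_real)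
    from d_le[OF this] have "2 * d \<le> norm (x + y)" by simp
    then have "(2 * d)\<^sup>2 \<le> (norm (x + y))\<^sup>2" using d0 by (intro power_mono) auto
    then show ?thesis using parallelogram[of x y] by (simp add: power_mult_distrib)
  qed
  have "Cauchy X"
  proof (rule metric_CauchyI)
    fix e :: real assume "e > 0"
    have "(\<lambda>n. (norm (X n))\<^sup>2) \<longlonglongrightarrow> d\<^sup>2" by (intro tendsto_intros lim)
    moreover have "e\<^sup>2 / 4 > 0" using \<open>e > 0\<close> by simp
    ultimately obtain N where N: "\<And>n. n \<ge> N \<Longrightarrow> dist ((norm (X n))\<^sup>2) (d\<^sup>2) < e\<^sup>2 / 4"
      by (meson metric_LIMSEQ_D)
    have "dist (X k) (X l) < e" if "k \<ge> N" "l \<ge> N" for k l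
    proof -
      have "(norm (X k - X l))\<^sup>2 < e\<^sup>2"
        using diff_le[OF XM[of k] XM[of l]] N[OF that(1)] N[OF that(2)]
        unfolding dist_real_def by linarith
      then show ?thesis
        unfolding dist_norm using \<open>e > 0\<close> by (intro power_less_imp_less_base[of _ 2 e]) auto
    qed
    then show "\<exists>M. \<forall>k\<ge>M. \<forall>l\<ge>M. dist (X k) (X l) < e" by blast
  qed
  then obtain z where z: "X \<longlonglongrightarrow> z"
    using Cauchy_convergent_iff convergent_def by blast
  have fz: "f z = 1"
  proof -
    have "(\<lambda>n. f (X n)) \<longlonglongrightarrow> f z" by (intro tendsto z)
    moreover have "(\<lambda>n. f (X n)) \<longlonglongrightarrow> 1" using XM by (simp add: M_def)
    ultimately show ?thesis by (rule LIMSEQ_unique)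
  qed
  have nz: "norm z = d"
    using LIMSEQ_unique[OF tendsto_norm[OF z] lim] .
  have orth: "cinner z y = 0" if "f y = 0" for y
  proof (rule ccontr)
    assume ne: "cinner z y \<noteq> 0"
    then have y0: "(norm y)\<^sup>2 > 0" by auto
    define t where "t = - (cinner y z / complex_of_real ((norm y)\<^sup>2))"
    have "z + t *\<^sub>C y \<in> M" using fz that by (simp add: M_def add fC)
    from d_le[OF this] have "(norm z)\<^sup>2 \<le> (norm (z + t *\<^sub>C y))\<^sup>2"
      using d0 by (simp add: nz power_mono)
    also have "\<dots> = (norm z)\<^sup>2 + (cmod t * norm y)\<^sup>2 + 2 * Re (t * cinner z y)"
      by (simp add: norm_sq_add norm_scaleC cinner_scaleC_right)
    also have "t * cinner z y = - complex_of_real ((cmod (cinner z y))\<^sup>2 / (norm y)\<^sup>2)"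
      using cinner_mult_commute[of z y] by (simp add: t_def mult.commute)
    also have "cmod t = cmod (cinner z y) / (norm y)\<^sup>2"
      using cinner_commute[of y z] by (simp add: t_def norm_divide norm_power)
    finally have "(cmod (cinner z y) / (norm y)\<^sup>2 * norm y)\<^sup>2
        \<ge> 2 * ((cmod (cinner z y))\<^sup>2 / (norm y)\<^sup>2)"
      by simp
    moreover have "(cmod (cinner z y) / (norm y)\<^sup>2 * norm y)\<^sup>2 = (cmod (cinner z y))\<^sup>2 / (norm y)\<^sup>2"
      using y0 by (simp add: power_mult_distrib power_divide power2_eq_square)
    moreover have "(cmod (cinner z y))\<^sup>2 / (norm y)\<^sup>2 > 0" using ne y0 by simp
    ultimately show False by linarith
  qed
  have z0: "z \<noteq> 0" using fz zero by force
  have "f x = cinner (complex_of_real (inverse ((norm z)\<^sup>2)) *\<^sub>C z) x" for x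
  proof -
    have "f (x - f x *\<^sub>C z) = 0" by (simp add: diff fC fz)
    from orth[OF this] have "cinner z x = f x * complex_of_real ((norm z)\<^sup>2)"
      by (simp add: cinner_diff_right cinner_scaleC_right cinner_self)
    then show ?thesis using z0 by (simp add: cinner_scaleC_left)
  qed
  then show ?thesis by blast
qed

typedef (overloaded) 'h bop =
  "{T :: 'h::chilbert_space \<Rightarrow>\<^sub>L 'h. \<forall>c x. blinfun_apply T (c *\<^sub>C x) = c *\<^sub>C blinfun_apply T x}"
  morphisms blinfun_of_bop Abs_bop
  by (intro exI[of _ 0]) simp

setup_lifting type_definition_bop

lift_definition bop_apply :: "'h::chilbert_space bop \<Rightarrow> 'h \<Rightarrow> 'h" is blinfun_apply .

lemma bop_eqI: "(\<And>x. bop_apply S x = bop_apply T x) \<Longrightarrow> S = T"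
  by transfer (rule blinfun_eqI)

lemma bop_apply_scaleC: "bop_apply T (c *\<^sub>C x) = c *\<^sub>C bop_apply T x"
  by transfer simp

lemma bounded_linear_bop_apply: "bounded_linear (bop_apply T)"
  by transfer (rule blinfun.bounded_linear_right)

lemma bop_exists:
  fixes f :: "'h::chilbert_space \<Rightarrow> 'h"
  assumes "bounded_linear f" "\<And>c x. f (c *\<^sub>C x) = c *\<^sub>C f x"
  shows "\<exists>T. bop_apply T = f"
  using assms
  by (intro exI[of _ "Abs_bop (Blinfun f)"])
    (simp add: bop_apply.rep_eq Abs_bop_inverse bounded_linear_Blinfun_apply)

lemma adjoint_exists:
  fixes T :: "'h::chilbert_space bop"
  shows "\<exists>U. \<forall>x y. cinner (bop_apply U x) y = cinner x (bop_apply T y)"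
proof -
  interpret T: bounded_linear "bop_apply T" by (rule bounded_linear_bop_apply)
  have "\<exists>z. \<forall>y. cinner x (bop_apply T y) = cinner z y" for x
    by (rule riesz)
      (simp_all add: bounded_linear_compose[OF bounded_linear_cinner_right T.bounded_linear]
        bop_apply_scaleC cinner_scaleC_right)
  then obtain u where u: "\<And>x y. cinner x (bop_apply T y) = cinner (u x) y" by metis
  obtain K where K: "K > 0" "\<And>x. norm (bop_apply T x) \<le> norm x * K" using T.pos_bounded by blast
  have "bounded_linear u"
  proof (rule bounded_linear_intro[where K = K])
    show "u (x + y) = u x + u y" for x y
      by (rule cinner_ext) (simp add: u[symmetric] cinner_add_left)
    show "u (r *\<^sub>R x) = r *\<^sub>R u x" for r x
      by (rule cinner_ext) (simp add: u[symmetric] cinner_scaleR_left)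
    fix x
    have "(norm (u x))\<^sup>2 = cmod (cinner x (bop_apply T (u x)))"
      by (simp only: u cmod_cinner_self)
    also have "\<dots> \<le> norm x * norm (bop_apply T (u x))" by (rule cauchy_schwarz)
    also have "\<dots> \<le> norm x * (norm (u x) * K)" by (intro mult_left_mono K) simp
    finally have "norm (u x) * norm (u x) \<le> norm (u x) * (norm x * K)"
      by (simp add: power2_eq_square mult_ac)
    then show "norm (u x) \<le> norm x * K"
      using K(1) by (cases "u x = 0") simp_all
  qed
  moreover have "u (c *\<^sub>C x) = c *\<^sub>C u x" for c x
    by (rule cinner_ext) (simp add: u[symmetric] cinner_scaleC_left)
  ultimately obtain U where "bop_apply U = u" using bop_exists[of u] by blast
  then show ?thesis using u by metis
qed

instantiation bop :: (chilbert_space) complex_vector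
begin

lift_definition zero_bop :: "'a bop" is 0 by simp
lift_definition plus_bop :: "'a bop \<Rightarrow> 'a bop \<Rightarrow> 'a bop" is "(+)"
  by (simp add: blinfun.add_left scaleC_add_right)
lift_definition uminus_bop :: "'a bop \<Rightarrow> 'a bop" is uminus
  by (simp add: blinfun.minus_left scaleC_minus_right)
lift_definition minus_bop :: "'a bop \<Rightarrow> 'a bop \<Rightarrow> 'a bop" is "(-)"
  by (simp add: blinfun.diff_left scaleC_diff_right)
lift_definition scaleR_bop :: "real \<Rightarrow> 'a bop \<Rightarrow> 'a bop" is "scaleR"
  by (simp add: blinfun.scaleR_left scaleC_scaleR)
lift_definition scaleC_bop :: "complex \<Rightarrow> 'a bop \<Rightarrow> 'a bop" is
  "\<lambda>c T. Blinfun (\<lambda>x. c *\<^sub>C blinfun_apply T x)"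
  by (simp add: bounded_linear_Blinfun_apply bounded_linear_compose[OF bounded_linear_scaleC]
      blinfun.bounded_linear_right scaleC_scaleC mult.commute)

lemma bop_apply_simps [simp]:
  "bop_apply 0 x = 0"
  "bop_apply (S + T) x = bop_apply S x + bop_apply T x"
  "bop_apply (- T) x = - bop_apply T x"
  "bop_apply (S - T) x = bop_apply S x - bop_apply T x"
  "bop_apply (r *\<^sub>R T) x = r *\<^sub>R bop_apply T x"
  "bop_apply (c *\<^sub>C T) x = c *\<^sub>C bop_apply T x" for S T :: "'a bop"
  by (transfer; simp add: blinfun.add_left blinfun.minus_left blinfun.diff_left
      blinfun.scaleR_left bounded_linear_Blinfun_apply
      bounded_linear_compose[OF bounded_linear_scaleC] blinfun.bounded_linear_right)+

instance
  by standard (rule bop_eqI; simp add: algebra_simps scaleC_add_right scaleC_add_left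
      scaleC_scaleC scaleC_of_real)+

end

instantiation bop :: (chilbert_space) complex_normed_vector
begin

lift_definition norm_bop :: "'a bop \<Rightarrow> real" is norm .

definition sgn_bop :: "'a bop \<Rightarrow> 'a bop" where
  "sgn_bop x = x /\<^sub>R norm x"

definition dist_bop :: "'a bop \<Rightarrow> 'a bop \<Rightarrow> real" where
  "dist_bop x y = norm (x - y)"

definition uniformity_bop :: "('a bop \<times> 'a bop) filter" where
  "uniformity_bop = (INF e\<in>{0<..}. principal {(x, y). dist x y < e})"

definition open_bop :: "'a bop set \<Rightarrow> bool" where
  "open_bop U = (\<forall>x\<in>U. \<forall>\<^sub>F (x', y) in uniformity. x' = x \<longrightarrow> y \<in> U)"

lemma norm_bop_apply_le: "norm (bop_apply T x) \<le> norm T * norm x" for T :: "'a bop"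
  by transfer (rule norm_blinfun)

lemma norm_bop_leI:
  "0 \<le> b \<Longrightarrow> (\<And>x. norm (bop_apply T x) \<le> b * norm x) \<Longrightarrow> norm T \<le> b" for T :: "'a bop"
  by transfer (rule norm_blinfun_bound)

instance
proof
  fix x y z :: "'a bop" and r :: real and c :: complex and U :: "'a bop set"
  show "dist x y = norm (x - y)" by (rule dist_bop_def)
  show "sgn x = x /\<^sub>R norm x" by (rule sgn_bop_def)
  show "uniformity = (INF e\<in>{0<..}. principal {(x, y :: 'a bop). dist x y < e})"
    by (rule uniformity_bop_def)
  show "open U = (\<forall>x\<in>U. \<forall>\<^sub>F (x', y) in uniformity. x' = x \<longrightarrow> y \<in> U)"
    by (rule open_bop_def)
  show "norm x = 0 \<longleftrightarrow> x = 0" by transfer simp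
  show "norm (x + y) \<le> norm x + norm y" by transfer (rule norm_triangle_ineq)
  show "norm (r *\<^sub>R x) = \<bar>r\<bar> * norm x" by transfer simp
  have le: "norm (c *\<^sub>C x) \<le> cmod c * norm x" for c and x :: "'a bop"
  proof (rule norm_bop_leI)
    have n0: "norm x \<ge> 0" by transfer simp
    then show "0 \<le> cmod c * norm x" by simp
    show "norm (bop_apply (c *\<^sub>C x) y) \<le> cmod c * norm x * norm y" for y
      using mult_left_mono[OF norm_bop_apply_le[of x y], of "cmod c"]
      by (simp add: norm_scaleC mult.assoc)
  qed
  show "norm (c *\<^sub>C x) = cmod c * norm x"
  proof (cases "c = 0")
    case True
    have "norm (0 :: 'a bop) = 0" by transfer simp
    with True show ?thesis by simp
  next
    case False
    have "cmod c * norm x = cmod c * norm (inverse c *\<^sub>C c *\<^sub>C x)"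
      using False by (simp add: scaleC_scaleC)
    also have "\<dots> \<le> cmod c * (cmod (inverse c) * norm (c *\<^sub>C x))"
      by (intro mult_left_mono le) simp
    also have "\<dots> = norm (c *\<^sub>C x)" using False by (simp add: norm_inverse)
    finally show ?thesis using le[of c x] by simp
  qed
qed

end

instance bop :: (chilbert_space) banach
proof
  fix X :: "nat \<Rightarrow> 'a bop"
  assume "Cauchy X"
  moreover have d: "dist S T = dist (blinfun_of_bop S) (blinfun_of_bop T)" for S T :: "'a bop"
    by (simp add: dist_norm norm_bop.rep_eq minus_bop.rep_eq)
  ultimately have "Cauchy (\<lambda>n. blinfun_of_bop (X n))"
    by (simp add: Cauchy_def)
  then obtain L where L: "(\<lambda>n. blinfun_of_bop (X n)) \<longlonglongrightarrow> L"
    using Cauchy_convergent_iff convergent_def by blast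
  have ap: "(\<lambda>n. blinfun_apply (blinfun_of_bop (X n)) x) \<longlonglongrightarrow> blinfun_apply L x" for x
    by (intro tendsto_intros L)
  have "blinfun_apply L (c *\<^sub>C x) = c *\<^sub>C blinfun_apply L x" for c x
  proof (rule LIMSEQ_unique)
    show "(\<lambda>n. blinfun_apply (blinfun_of_bop (X n)) (c *\<^sub>C x)) \<longlonglongrightarrow> blinfun_apply L (c *\<^sub>C x)"
      by (rule ap)
    show "(\<lambda>n. blinfun_apply (blinfun_of_bop (X n)) (c *\<^sub>C x)) \<longlonglongrightarrow> c *\<^sub>C blinfun_apply L x"
      using bounded_linear.tendsto[OF bounded_linear_scaleC ap[of x], of c]
      by (simp add: bop_apply_scaleC flip: bop_apply.rep_eq)
  qed
  then have "blinfun_of_bop (Abs_bop L) = L" by (simp add: Abs_bop_inverse)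
  with L have "X \<longlonglongrightarrow> Abs_bop L"
    by (simp add: tendsto_iff d)
  then show "convergent X" by (rule convergentI)
qed

instantiation bop :: (chilbert_space) "{cstar_algebra, monoid_mult}"
begin

lift_definition one_bop :: "'a bop" is id_blinfun by simp

lift_definition times_bop :: "'a bop \<Rightarrow> 'a bop \<Rightarrow> 'a bop" is "blinfun_compose" by simp

definition star_bop :: "'a bop \<Rightarrow> 'a bop" where
  "star_bop T = (SOME U. \<forall>x y. cinner (bop_apply U x) y = cinner x (bop_apply T y))"

lemma cinner_star_left: "cinner (bop_apply (star T) x) y = cinner x (bop_apply T y)"
  for T :: "'a bop"
  using someI_ex[OF adjoint_exists, of T] by (simp add: star_bop_def)

lemma cinner_star_right: "cinner x (bop_apply (star T) y) = cinner (bop_apply T x) y"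
  for T :: "'a bop"
  using cinner_star_left[of T y x] cinner_commute[of x "bop_apply (star T) y"]
    cinner_commute[of "bop_apply T x" y] by simp

lemma bop_apply_one [simp]: "bop_apply (1 :: 'a bop) x = x"
  by transfer simp

lemma bop_apply_mult [simp]: "bop_apply (S * T) x = bop_apply S (bop_apply T x)"
  for S T :: "'a bop"
  by transfer simp

lemma bop_eqI_cinner:
  "(\<And>x y. cinner (bop_apply S x) y = cinner (bop_apply T x) y) \<Longrightarrow> S = T" for S T :: "'a bop"
  by (rule bop_eqI, rule cinner_ext)

lemma norm_sq_le_bop: "(norm T)\<^sup>2 \<le> norm (star T * T)" for T :: "'a bop"
proof -
  define N where "N = norm (star T * T)"
  have N: "N \<ge> 0" by (simp add: N_def)
  have "norm T \<le> sqrt N"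
  proof (rule norm_bop_leI)
    show "0 \<le> sqrt N" using N by simp
    fix v
    have "(norm (bop_apply T v))\<^sup>2 = cmod (cinner v (bop_apply (star T * T) v))"
      by (simp add: cinner_star_right cmod_cinner_self)
    moreover have "cmod (cinner v (bop_apply (star T * T) v)) \<le>
        norm v * norm (bop_apply (star T * T) v)"
      by (rule cauchy_schwarz)
    moreover have "norm v * norm (bop_apply (star T * T) v) \<le> norm v * (N * norm v)"
      unfolding N_def by (intro mult_left_mono norm_bop_apply_le norm_ge_zero)
    moreover have "(sqrt N * norm v)\<^sup>2 = norm v * (N * norm v)"
      using N by (simp add: power_mult_distrib power2_eq_square)
    ultimately have "(norm (bop_apply T v))\<^sup>2 \<le> (sqrt N * norm v)\<^sup>2"
      by linarith
    then show "norm (bop_apply T v) \<le> sqrt N * norm v"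
      by (rule power2_le_imp_le) (use N in simp)
  qed
  from power_mono[OF this norm_ge_zero, of 2] show ?thesis
    using N by (simp add: N_def)
qed

instance
proof
  fix x y z :: "'a bop" and r :: real and c :: complex
  interpret x: bounded_linear "bop_apply x" by (rule bounded_linear_bop_apply)
  show "x * y * z = x * (y * z)" by (rule bop_eqI) simp
  show "1 * x = x" by (rule bop_eqI) simp
  show "x * 1 = x" by (rule bop_eqI) simp
  show "(x + y) * z = x * z + y * z" by (rule bop_eqI) simp
  show "x * (y + z) = x * y + x * z" by (rule bop_eqI) (simp add: x.add)
  show "(r *\<^sub>R x) * y = r *\<^sub>R (x * y)" by (rule bop_eqI) simp
  show "x * (r *\<^sub>R y) = r *\<^sub>R (x * y)" by (rule bop_eqI) (simp add: x.scaleR)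
  show "(c *\<^sub>C x) * y = c *\<^sub>C (x * y)" by (rule bop_eqI) simp
  show "x * (c *\<^sub>C y) = c *\<^sub>C (x * y)" by (rule bop_eqI) (simp add: bop_apply_scaleC)
  show sub: "norm (x * y) \<le> norm x * norm y" for x y :: "'a bop"
    by transfer (rule norm_blinfun_compose)
  show ss: "star (star x) = x" for x :: "'a bop"
    by (rule bop_eqI_cinner) (simp add: cinner_star_left cinner_star_right)
  show "star (x + y) = star x + star y"
    by (rule bop_eqI_cinner) (simp add: cinner_star_left cinner_add_left cinner_add_right)
  show "star (c *\<^sub>C x) = cnj c *\<^sub>C star x"
    by (rule bop_eqI_cinner) (simp add: cinner_star_left cinner_scaleC_left cinner_scaleC_right)
  show "star (x * y) = star y * star x"
    by (rule bop_eqI_cinner) (simp add: cinner_star_left)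
  have le: "norm x \<le> norm (star x)" for x :: "'a bop"
  proof (cases "norm x = 0")
    case False
    have "norm x * norm x \<le> norm (star x) * norm x"
      using order_trans[OF norm_sq_le_bop sub[of "star x" x]] by (simp only: power2_eq_square)
    moreover have "norm x > 0" using False norm_ge_zero[of x] by linarith
    ultimately show ?thesis by (rule mult_right_le_imp_le)
  qed (simp only: norm_ge_zero)
  have eq: "norm (star x) = norm x"
    by (rule antisym[OF _ le]) (rule le[of "star x", unfolded ss])
  show "norm (star x * x) = (norm x)\<^sup>2"
  proof (rule antisym)
    show "norm (star x * x) \<le> (norm x)\<^sup>2"
      using sub[of "star x" x] by (simp only: eq power2_eq_square)
  qed (rule norm_sq_le_bop)
qed

end

section \<open>C*-subalgebras, homomorphisms and tensor products\<close>

definition csubspace :: "'a::complex_vector set \<Rightarrow> bool" where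
  "csubspace M \<longleftrightarrow> 0 \<in> M \<and> (\<forall>x\<in>M. \<forall>y\<in>M. x + y \<in> M) \<and> (\<forall>c. \<forall>x\<in>M. c *\<^sub>C x \<in> M)"

definition closed_csubspace :: "'a::complex_normed_vector set \<Rightarrow> bool" where
  "closed_csubspace M \<longleftrightarrow> csubspace M \<and> closed M"

text \<open>C*-subalgebras need not contain the unit of the ambient algebra; the C*-subalgebra generated
  by \<open>G\<close> is \<open>cstar_subalgebra hull G\<close>.\<close>

definition cstar_subalgebra :: "'a::cstar_algebra set \<Rightarrow> bool" where
  "cstar_subalgebra D \<longleftrightarrow>
     closed_csubspace D \<and> (\<forall>x\<in>D. \<forall>y\<in>D. x * y \<in> D) \<and> (\<forall>x\<in>D. star x \<in> D)"

text \<open>\<open>is_cstar_tensor D E F \<tau>\<close>: the C*-algebra \<open>F\<close>, with \<open>\<tau> a t\<close> in the role of the elementary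
  tensor of \<open>a \<in> D\<close> and \<open>t \<in> E\<close>, is the completion of the algebraic tensor product of the *-algebras
  \<open>D\<close> and \<open>E\<close> with respect to some C*-norm. The fifth clause says that the linear map from the
  algebraic tensor product to \<open>F\<close> induced by \<open>\<tau>\<close> is injective. If one of \<open>D\<close> and \<open>E\<close> is nuclear,
  there is only one C*-norm, so that these clauses determine \<open>F\<close> and \<open>\<tau>\<close> up to isomorphism.\<close>

definition is_cstar_tensor ::
  "'a::cstar_algebra set \<Rightarrow> 'c::cstar_algebra set \<Rightarrow> 'b::cstar_algebra set \<Rightarrow>
    ('a \<Rightarrow> 'c \<Rightarrow> 'b) \<Rightarrow> bool" where
  "is_cstar_tensor D E F \<tau> \<longleftrightarrow>
     (\<forall>a\<in>D. \<forall>b\<in>D. \<forall>s\<in>E. \<forall>c. \<tau> (a + b) s = \<tau> a s + \<tau> b s \<and> \<tau> (c *\<^sub>C a) s = c *\<^sub>C \<tau> a s) \<and>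
     (\<forall>a\<in>D. \<forall>s\<in>E. \<forall>t\<in>E. \<forall>c. \<tau> a (s + t) = \<tau> a s + \<tau> a t \<and> \<tau> a (c *\<^sub>C s) = c *\<^sub>C \<tau> a s) \<and>
     (\<forall>a\<in>D. \<forall>b\<in>D. \<forall>s\<in>E. \<forall>t\<in>E. \<tau> a s * \<tau> b t = \<tau> (a * b) (s * t)) \<and>
     (\<forall>a\<in>D. \<forall>s\<in>E. star (\<tau> a s) = \<tau> (star a) (star s)) \<and>
     (\<forall>n (a :: nat \<Rightarrow> 'a) t. (\<forall>i<n. a i \<in> D \<and> t i \<in> E) \<and>
        (\<forall>c :: nat \<Rightarrow> complex. (\<Sum>i<n. c i *\<^sub>C t i) = 0 \<longrightarrow> (\<forall>i<n. c i = 0)) \<and>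
        (\<Sum>i<n. \<tau> (a i) (t i)) = 0 \<longrightarrow> (\<forall>i<n. a i = 0)) \<and>
     F = closure (csubspace hull {\<tau> a t | a t. a \<in> D \<and> t \<in> E})"

section \<open>Representations\<close>

text \<open>Hilbert spaces of representations are closed subspaces \<open>H\<close> of a type of class
  \<open>chilbert_space\<close>, so that the members of a family of representations may live on Hilbert spaces of
  different dimensions. Only the values of \<open>\<pi> a x\<close> for \<open>a \<in> D\<close> and \<open>x \<in> H\<close> matter.
  An irreducible representation of a separable C*-algebra acts on a separable Hilbert space, hence
  is unitarily equivalent to one on a closed subspace of \<open>complex ell2\<close>.\<close>

definition bounded_operator_on :: "'h::chilbert_space set \<Rightarrow> ('h \<Rightarrow> 'h) \<Rightarrow> bool" where
  "bounded_operator_on H T \<longleftrightarrow>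
     (\<forall>x\<in>H. T x \<in> H) \<and>
     (\<forall>x\<in>H. \<forall>y\<in>H. T (x + y) = T x + T y) \<and> (\<forall>c. \<forall>x\<in>H. T (c *\<^sub>C x) = c *\<^sub>C T x) \<and>
     (\<exists>K. \<forall>x\<in>H. norm (T x) \<le> K * norm x)"

definition representation ::
  "'b::cstar_algebra set \<Rightarrow> 'h::chilbert_space set \<Rightarrow> ('b \<Rightarrow> 'h \<Rightarrow> 'h) \<Rightarrow> bool" where
  "representation D H \<pi> \<longleftrightarrow>
     closed_csubspace H \<and> (\<forall>a\<in>D. bounded_operator_on H (\<pi> a)) \<and>
     (\<forall>a\<in>D. \<forall>b\<in>D. \<forall>x\<in>H. \<pi> (a + b) x = \<pi> a x + \<pi> b x) \<and>
     (\<forall>c. \<forall>a\<in>D. \<forall>x\<in>H. \<pi> (c *\<^sub>C a) x = c *\<^sub>C \<pi> a x) \<and>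
     (\<forall>a\<in>D. \<forall>b\<in>D. \<forall>x\<in>H. \<pi> (a * b) x = \<pi> a (\<pi> b x)) \<and>
     (\<forall>a\<in>D. \<forall>x\<in>H. \<forall>y\<in>H. cinner (\<pi> (star a) x) y = cinner x (\<pi> a y))"

text \<open>The second clause excludes the zero representations, in particular the one on a
  one-dimensional space.\<close>

definition irreducible_representation ::
  "'b::cstar_algebra set \<Rightarrow> 'h::chilbert_space set \<Rightarrow> ('b \<Rightarrow> 'h \<Rightarrow> 'h) \<Rightarrow> bool" where
  "irreducible_representation D H \<pi> \<longleftrightarrow>
     representation D H \<pi> \<and> (\<exists>a\<in>D. \<exists>x\<in>H. \<pi> a x \<noteq> 0) \<and>
     (\<forall>M. closed_csubspace M \<and> M \<subseteq> H \<and> (\<forall>a\<in>D. \<forall>x\<in>M. \<pi> a x \<in> M) \<longrightarrow> M = {0} \<or> M = H)"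

definition unitarily_equivalent ::
  "'b::cstar_algebra set \<Rightarrow> 'h::chilbert_space set \<Rightarrow> ('b \<Rightarrow> 'h \<Rightarrow> 'h) \<Rightarrow>
    'k::chilbert_space set \<Rightarrow> ('b \<Rightarrow> 'k \<Rightarrow> 'k) \<Rightarrow> bool" where
  "unitarily_equivalent D H \<pi> K \<sigma> \<longleftrightarrow>
     (\<exists>U. (\<forall>x\<in>H. \<forall>y\<in>H. U (x + y) = U x + U y) \<and> (\<forall>c. \<forall>x\<in>H. U (c *\<^sub>C x) = c *\<^sub>C U x) \<and>
          (\<forall>x\<in>H. \<forall>y\<in>H. cinner (U x) (U y) = cinner x y) \<and> U ` H = K \<and>
          (\<forall>a\<in>D. \<forall>x\<in>H. U (\<pi> a x) = \<sigma> a (U x)))"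

section \<open>The Toeplitz algebra and the torsioned quantum double suspension\<close>

lift_definition ell2_shift :: "complex ell2 \<Rightarrow> complex ell2" is "\<lambda>\<xi> n. \<xi> (Suc n)"
  by (subst summable_Suc_iff)

lemma ell2_nth_shift [simp]: "ell2_nth (ell2_shift \<xi>) n = ell2_nth \<xi> (Suc n)"
  by transfer simp

lemma bounded_linear_ell2_shift: "bounded_linear ell2_shift"
proof (rule bounded_linear_intro[where K = 1])
  fix \<xi> :: "complex ell2"
  have "(\<Sum>n. (norm (ell2_nth \<xi> (Suc n)))\<^sup>2) \<le> (\<Sum>n. (norm (ell2_nth \<xi> n))\<^sup>2)"
    by (subst suminf_split_head[OF summable_ell2]) simp
  then show "norm (ell2_shift \<xi>) \<le> norm \<xi> * 1"
    unfolding norm_ell2_def by simp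
qed (auto intro: ell2_eqI)

lift_definition left_shift :: "complex ell2 bop" is "Blinfun ell2_shift"
  by (auto simp: bounded_linear_Blinfun_apply[OF bounded_linear_ell2_shift] intro: ell2_eqI)

lemma left_shift_nth [simp]: "ell2_nth (bop_apply left_shift \<xi>) n = ell2_nth \<xi> (Suc n)"
  by (simp add: bop_apply.rep_eq left_shift.rep_eq
      bounded_linear_Blinfun_apply[OF bounded_linear_ell2_shift])

definition toeplitz :: "complex ell2 bop set" where
  "toeplitz = cstar_subalgebra hull {left_shift}"

definition compact_operators :: "complex ell2 bop set" where
  "compact_operators = {k. compact (closure (bop_apply k ` cball 0 1))}"

text \<open>Here \<open>\<tau> a t\<close> is the elementary tensor of \<open>a\<close> and \<open>t\<close> in the tensor product of the algebra
  \<open>'a\<close> with \<open>toeplitz\<close>, which is nuclear.\<close>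

definition qds ::
  "('a::unital_cstar_algebra \<Rightarrow> complex ell2 bop \<Rightarrow> 'b::cstar_algebra) \<Rightarrow> nat \<Rightarrow> 'b set" where
  "qds \<tau> m = cstar_subalgebra hull
     ({\<tau> a k | a k. k \<in> compact_operators} \<union> {\<tau> 1 (star left_shift ^ m)})"

lift_definition vtensor :: "'h::chilbert_space \<Rightarrow> complex ell2 \<Rightarrow> 'h ell2" is
  "\<lambda>x \<xi> n. \<xi> n *\<^sub>C x"
  by (simp add: norm_scaleC power_mult_distrib summable_mult2)

definition ell2_over :: "'h::chilbert_space set \<Rightarrow> 'h ell2 set" where
  "ell2_over H = {f. \<forall>n. ell2_nth f n \<in> H}"

text \<open>The value \<open>0\<close> off the domain makes the objects defined below unique as total functions.\<close>

definition qds_representation ::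
  "('a::unital_cstar_algebra \<Rightarrow> complex ell2 bop \<Rightarrow> 'b::cstar_algebra) \<Rightarrow> nat \<Rightarrow>
    'h::chilbert_space set \<Rightarrow> ('a \<Rightarrow> 'h \<Rightarrow> 'h) \<Rightarrow> 'b \<Rightarrow> 'h ell2 \<Rightarrow> 'h ell2" where
  "qds_representation \<tau> m H \<rho> = (THE R.
     representation (qds \<tau> m) (ell2_over H) R \<and>
     (\<forall>a. \<forall>k\<in>compact_operators. \<forall>x\<in>H. \<forall>\<xi>.
        R (\<tau> a k) (vtensor x \<xi>) = vtensor (\<rho> a x) (bop_apply k \<xi>)) \<and>
     (\<forall>x\<in>H. \<forall>\<xi>. R (\<tau> 1 (star left_shift ^ m)) (vtensor x \<xi>) =
        vtensor x (bop_apply (star left_shift ^ m) \<xi>)) \<and>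
     (\<forall>b v. b \<notin> qds \<tau> m \<or> v \<notin> ell2_over H \<longrightarrow> R b v = 0))"

definition qds_character ::
  "('a::unital_cstar_algebra \<Rightarrow> complex ell2 bop \<Rightarrow> 'b::cstar_algebra) \<Rightarrow> nat \<Rightarrow>
    complex \<Rightarrow> 'b \<Rightarrow> complex" where
  "qds_character \<tau> m t = (THE \<theta>.
     (\<forall>b\<in>qds \<tau> m. \<forall>d\<in>qds \<tau> m. \<theta> (b + d) = \<theta> b + \<theta> d \<and> \<theta> (b * d) = \<theta> b * \<theta> d) \<and>
     (\<forall>c. \<forall>b\<in>qds \<tau> m. \<theta> (c *\<^sub>C b) = c * \<theta> b) \<and>
     (\<forall>b\<in>qds \<tau> m. \<theta> (star b) = cnj (\<theta> b)) \<and>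
     (\<forall>a. \<forall>k\<in>compact_operators. \<theta> (\<tau> a k) = 0) \<and>
     \<theta> (\<tau> 1 (star left_shift ^ m)) = t \<and>
     (\<forall>b. b \<notin> qds \<tau> m \<longrightarrow> \<theta> b = 0))"

text \<open>A character regarded as a representation on the Hilbert space \<open>complex\<close>.\<close>

definition character_representation :: "('b \<Rightarrow> complex) \<Rightarrow> 'b \<Rightarrow> complex \<Rightarrow> complex" where
  "character_representation \<theta> b z = \<theta> b * z"

end

theory Submission
  imports Defs "HOL-Complex_Analysis.Cauchy_Integral_Formula"
begin

text \<open>The suspension contains \<open>A \<otimes> K\<close>, with \<open>K\<close> the compact operators, as an ideal; the
  projections \<open>1 \<otimes> (e\<^sub>0\<^sub>0 + \<dots> + e\<^sub>n\<^sub>n)\<close> are an approximate unit of it, and its corner at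
  \<open>1 \<otimes> e\<^sub>0\<^sub>0\<close> is a copy of \<open>A\<close>, because an injective *-homomorphism is isometric.

  A representation of \<open>A\<close> therefore acts on \<open>H \<otimes> \<ell>\<^sup>2\<close> through the matrix entries
  \<open>(1 \<otimes> e\<^sub>0\<^sub>i) b (1 \<otimes> e\<^sub>j\<^sub>0)\<close>, and it is recovered, up to equivalence, by compressing with
  \<open>1 \<otimes> e\<^sub>0\<^sub>0\<close>. The characters are the eigenvalues of the elements of the suspension on approximate
  eigenvectors of the shift that escape to infinity.

  Conversely let \<open>\<pi>\<close> be an irreducible representation of the suspension. If \<open>\<pi>\<close> vanishes on the
  ideal, its image is commutative, as the shift becomes unitary, and irreducibility makes the
  spectrum of every self-adjoint element a point: \<open>\<pi>\<close> is a character. Otherwise the compression of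
  \<open>\<pi>\<close> to the range of \<open>\<pi> (1 \<otimes> e\<^sub>0\<^sub>0)\<close> is an irreducible representation of \<open>A\<close>, and \<open>\<pi>\<close> is its
  suspension.\<close>

section \<open>C*-algebras\<close>

text \<open>\<open>is_cstar_tensor\<close> only says that the norm on \<open>'b\<close> is some
  C*-norm on the algebraic tensor product. Hence neither the norm of an elementary tensor nor the
  amplification \<rho> \<otimes> id is at hand. The isometry of the corner stands in for both: it
  makes the range of the corner embedding closed, so that every element of \<open>'b\<close> has
  matrix entries in \<open>'a\<close>, and it carries norm-convergent sums from \<open>'b\<close>
  back to \<open>'a\<close>. Boundedness of the resulting infinite matrices comes from the
  C*-identity, by repeated squaring. In place of the spectrum there is an interval: a self-adjoint
  element of norm below \<open>c\<close> is \<open>c\<close> times the real part of a unitary, and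
  this yields the functional calculus on \<open>{- c..c}\<close>.

  The completeness hypothesis speaks of subspaces of \<open>complex ell2\<close>, whereas
  \<open>K\<close> lies in an arbitrary Hilbert space. This is where separability of
  \<open>'a\<close> enters: it makes the compressed space separable, and Fourier coefficients move
  that space into \<open>complex ell2\<close> before the hypothesis is applied.\<close>

lemma scaleC_left_diff: "(c - d) *\<^sub>C x = c *\<^sub>C x - d *\<^sub>C x"
  using scaleC_add_left[of "c - d" d x] by simp

lemma scaleC_minus_left: "(- c) *\<^sub>C x = - (c *\<^sub>C x)"
  using scaleC_left_diff[of 0 c x] by simp

lemma scaleR_scaleC_def: "r *\<^sub>R x = complex_of_real r *\<^sub>C x"
  by (simp add: scaleC_of_real)

lemma tendsto_scaleC:
  fixes x :: "'b::complex_normed_vector"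
  shows "(X \<longlongrightarrow> x) F \<Longrightarrow> ((\<lambda>n. c *\<^sub>C X n) \<longlongrightarrow> c *\<^sub>C x) F"
  by (rule bounded_linear.tendsto[OF bounded_linear_scaleC])

lemma star_zero [simp]: "star 0 = 0"
  using star_add[of 0 0] by simp

lemma star_minus: "star (- x) = - star x"
  using star_add[of x "- x"] by (simp add: eq_neg_iff_add_eq_0 add.commute)

lemma star_diff: "star (x - y) = star x - star y"
  using star_add[of x "- y"] by (simp add: star_minus)

lemma star_scaleR: "star (r *\<^sub>R x) = r *\<^sub>R star x"
  by (simp add: scaleR_scaleC_def star_scaleC)

lemma star_sum: "star (sum f A) = (\<Sum>i\<in>A. star (f i))"
  by (induction A rule: infinite_finite_induct) (simp_all add: star_add)

lemma norm_star [simp]: "norm (star x) = norm x"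
proof -
  have le: "norm y \<le> norm (star y)" for y :: 'a
  proof (cases "y = 0")
    case False
    have "norm y * norm y \<le> norm (star y) * norm y"
      using norm_mult_ineq[of "star y" y] by (simp add: cstar_identity power2_eq_square)
    with False show ?thesis by simp
  qed simp
  from le[of x] le[of "star x"] show ?thesis by (simp add: star_star)
qed

lemma bounded_linear_star: "bounded_linear star"
  by (rule bounded_linear_intro[where K = 1]) (simp_all add: star_add star_scaleR)

lemmas tendsto_star = bounded_linear.tendsto[OF bounded_linear_star]

section \<open>Closed subspaces, C*-subalgebras and bounded linear maps on them\<close>

lemma csubspaceD:
  assumes "csubspace M"
  shows "0 \<in> M" "x \<in> M \<Longrightarrow> y \<in> M \<Longrightarrow> x + y \<in> M" "x \<in> M \<Longrightarrow> c *\<^sub>C x \<in> M"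
    "x \<in> M \<Longrightarrow> - x \<in> M" "x \<in> M \<Longrightarrow> y \<in> M \<Longrightarrow> x - y \<in> M" "x \<in> M \<Longrightarrow> r *\<^sub>R x \<in> M"
proof -
  show sc: "c *\<^sub>C x \<in> M" if "x \<in> M" for c x using assms that by (simp add: csubspace_def)
  show ad: "x + y \<in> M" if "x \<in> M" "y \<in> M" for x y using assms that by (simp add: csubspace_def)
  show "0 \<in> M" using assms by (simp add: csubspace_def)
  show mi: "- x \<in> M" if "x \<in> M" for x using sc[OF that, of "- 1"] by (simp add: scaleC_minus_one)
  show "x - y \<in> M" if "x \<in> M" "y \<in> M" using ad[OF that(1) mi[OF that(2)]] by simp
  show "r *\<^sub>R x \<in> M" if "x \<in> M" using sc[OF that, of "complex_of_real r"] by (simp add: scaleC_of_real)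
qed

lemma csubspace_sum: "csubspace M \<Longrightarrow> (\<And>i. i \<in> A \<Longrightarrow> f i \<in> M) \<Longrightarrow> sum f A \<in> M"
  by (induction A rule: infinite_finite_induct) (simp_all add: csubspaceD)

lemma closed_csubspaceD:
  assumes "closed_csubspace M"
  shows "csubspace M" "closed M"
  using assms by (simp_all add: closed_csubspace_def)

lemma closed_csubspace_limit:
  "closed_csubspace M \<Longrightarrow> (\<And>n. X n \<in> M) \<Longrightarrow> X \<longlonglongrightarrow> x \<Longrightarrow> x \<in> M"
  using closed_sequentially[of M X x] by (simp add: closed_csubspace_def)

lemma closed_csubspace_UNIV: "closed_csubspace UNIV"
  by (simp add: closed_csubspace_def csubspace_def)

lemma closed_csubspace_zero: "closed_csubspace {0}"
  by (simp add: closed_csubspace_def csubspace_def)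

lemma csubspace_closure:
  assumes "csubspace M" shows "closed_csubspace (closure M)"
proof -
  have "x + y \<in> closure M" if xy: "x \<in> closure M" "y \<in> closure M" for x y
  proof -
    obtain X Y where "\<forall>n. X n \<in> M" "X \<longlonglongrightarrow> x" "\<forall>n. Y n \<in> M" "Y \<longlonglongrightarrow> y"
      using xy unfolding closure_sequential by blast
    then show ?thesis
      unfolding closure_sequential using csubspaceD(2)[OF assms]
      by (intro exI[of _ "\<lambda>n. X n + Y n"]) (auto intro: tendsto_add)
  qed
  moreover have "c *\<^sub>C x \<in> closure M" if xM: "x \<in> closure M" for c x
  proof -
    obtain X where "\<forall>n. X n \<in> M" "X \<longlonglongrightarrow> x"
      using xM unfolding closure_sequential by blast
    then show ?thesis
      unfolding closure_sequential using csubspaceD(3)[OF assms]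
      by (intro exI[of _ "\<lambda>n. c *\<^sub>C X n"]) (auto intro: tendsto_scaleC)
  qed
  ultimately show ?thesis
    using closure_subset[of M] csubspaceD(1)[OF assms] by (auto simp: closed_csubspace_def csubspace_def)
qed

lemma cstar_subalgebraD:
  assumes "cstar_subalgebra D"
  shows "csubspace D" "closed D" "closed_csubspace D"
    "x \<in> D \<Longrightarrow> y \<in> D \<Longrightarrow> x * y \<in> D" "x \<in> D \<Longrightarrow> star x \<in> D"
  using assms by (simp_all add: cstar_subalgebra_def closed_csubspace_def)

lemmas cstar_subalgebra_csubspaceD = csubspaceD[OF cstar_subalgebraD(1)]

lemma cstar_subalgebra_UNIV: "cstar_subalgebra UNIV"
  by (simp add: cstar_subalgebra_def closed_csubspace_UNIV)

lemma cstar_subalgebraI: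
  assumes "0 \<in> D" "\<And>x y. x \<in> D \<Longrightarrow> y \<in> D \<Longrightarrow> x + y \<in> D" "\<And>c x. x \<in> D \<Longrightarrow> c *\<^sub>C x \<in> D"
    "\<And>x y. x \<in> D \<Longrightarrow> y \<in> D \<Longrightarrow> x * y \<in> D" "\<And>x. x \<in> D \<Longrightarrow> star x \<in> D"
    "\<And>X x. (\<And>n. X n \<in> D) \<Longrightarrow> X \<longlonglongrightarrow> x \<Longrightarrow> x \<in> D"
  shows "cstar_subalgebra D"
  unfolding cstar_subalgebra_def closed_csubspace_def csubspace_def closed_sequential_limits
  by (intro conjI ballI allI impI; (elim conjE)?) (blast intro: assms)+

lemma closed_csubspaceI:
  assumes "0 \<in> D" "\<And>x y. x \<in> D \<Longrightarrow> y \<in> D \<Longrightarrow> x + y \<in> D" "\<And>c x. x \<in> D \<Longrightarrow> c *\<^sub>C x \<in> D"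
    "\<And>X x. (\<And>n. X n \<in> D) \<Longrightarrow> X \<longlonglongrightarrow> x \<Longrightarrow> x \<in> D"
  shows "closed_csubspace D"
  unfolding closed_csubspace_def csubspace_def closed_sequential_limits
  by (intro conjI ballI allI impI; (elim conjE)?) (blast intro: assms)+

text \<open>The Lipschitz constant \<open>C\<close> does not depend on \<open>n\<close>, so the
  limit passes from the \<open>X k\<close> to \<open>x\<close>. This shows that sets given by
  asymptotic conditions are closed. Only differences of values occur, so \<open>F n\<close> may be
  linear on a subspace only.\<close>

lemma tendsto_zero_closed:
  fixes F :: "nat \<Rightarrow> 'a::real_normed_vector \<Rightarrow> 'b::real_normed_vector"
  assumes lim: "\<And>k. (\<lambda>n. F n (X k)) \<longlonglongrightarrow> 0" and X: "X \<longlonglongrightarrow> x"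
    and le: "\<And>n k. norm (F n x - F n (X k)) \<le> C * norm (x - X k)"
  shows "(\<lambda>n. F n x) \<longlonglongrightarrow> 0"
proof (rule LIMSEQ_I)
  fix r :: real assume r: "r > 0"
  have "(\<lambda>k. C * norm (x - X k)) \<longlonglongrightarrow> C * norm (x - x)"
    by (intro tendsto_intros X)
  then have "(\<lambda>k. C * norm (x - X k)) \<longlonglongrightarrow> 0" by simp
  moreover have r2: "r / 2 > 0" using r by simp
  ultimately obtain k where "norm (C * norm (x - X k) - 0) < r / 2" using LIMSEQ_D by blast
  then have k: "C * norm (x - X k) < r / 2" unfolding diff_zero real_norm_def by linarith
  obtain N where N: "\<And>n. n \<ge> N \<Longrightarrow> norm (F n (X k) - 0) < r / 2" using LIMSEQ_D[OF lim[of k] r2] by blast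
  have "norm (F n x - 0) < r" if "n \<ge> N" for n
    using norm_triangle_ineq[of "F n x - F n (X k)" "F n (X k)"] le[of n k] k N[OF that]
    unfolding diff_zero diff_add_cancel by linarith
  then show "\<exists>N. \<forall>n\<ge>N. norm (F n x - 0) < r" by blast
qed

text \<open>Representations are specified only on their Hilbert space and their algebra, so
  linearity and boundedness are restricted to \<open>H\<close>. The closedness of \<open>H\<close>
  is included because limits must not leave the domain.\<close>

definition bounded_clinear_on :: "'h::complex_normed_vector set \<Rightarrow> ('h \<Rightarrow> 'k::complex_normed_vector) \<Rightarrow> bool" where
  "bounded_clinear_on H f \<longleftrightarrow> closed_csubspace H \<and> (\<forall>x\<in>H. \<forall>y\<in>H. f (x + y) = f x + f y) \<and>
     (\<forall>c. \<forall>x\<in>H. f (c *\<^sub>C x) = c *\<^sub>C f x) \<and> (\<exists>K. \<forall>x\<in>H. norm (f x) \<le> K * norm x)"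

lemma bounded_clinear_onD:
  assumes "bounded_clinear_on H f"
  shows "closed_csubspace H" "x \<in> H \<Longrightarrow> y \<in> H \<Longrightarrow> f (x + y) = f x + f y"
    "x \<in> H \<Longrightarrow> f (c *\<^sub>C x) = c *\<^sub>C f x" "x \<in> H \<Longrightarrow> y \<in> H \<Longrightarrow> f (x - y) = f x - f y" "f 0 = 0"
    "\<exists>K. \<forall>x\<in>H. norm (f x) \<le> K * norm x"
proof -
  show H: "closed_csubspace H" and add: "x \<in> H \<Longrightarrow> y \<in> H \<Longrightarrow> f (x + y) = f x + f y"
    and sc: "x \<in> H \<Longrightarrow> f (c *\<^sub>C x) = c *\<^sub>C f x"
    and "\<exists>K. \<forall>x\<in>H. norm (f x) \<le> K * norm x" for x y c
    using assms by (simp_all add: bounded_clinear_on_def)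
  note HH = csubspaceD[OF closed_csubspaceD(1)[OF H]]
  show "f (x - y) = f x - f y" if "x \<in> H" "y \<in> H"
    using add[of "x - y" y] that HH by simp
  show "f 0 = 0" using sc[of 0 0] HH by simp
qed

lemma bounded_clinear_on_tendsto:
  assumes f: "bounded_clinear_on H f" and X: "\<And>n. X n \<in> H" "X \<longlonglongrightarrow> x"
  shows "x \<in> H" "(\<lambda>n. f (X n)) \<longlonglongrightarrow> f x"
proof -
  note F = bounded_clinear_onD[OF f]
  show x: "x \<in> H" by (rule closed_csubspace_limit[OF F(1) X])
  obtain K where K: "\<And>x. x \<in> H \<Longrightarrow> norm (f x) \<le> K * norm x"
    using F(6) by blast
  show "(\<lambda>n. f (X n)) \<longlonglongrightarrow> f x"
  proof (rule LIM_zero_cancel, rule Lim_null_comparison)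
    show "\<forall>\<^sub>F n in sequentially. norm (f (X n) - f x) \<le> K * norm (X n - x)"
      using K X(1) x csubspaceD(5)[OF closed_csubspaceD(1)[OF F(1)]]
      by (intro always_eventually allI) (simp flip: F(4))
    have "(\<lambda>n. K * norm (X n - x)) \<longlonglongrightarrow> K * norm (x - x)" by (intro tendsto_intros X)
    then show "(\<lambda>n. K * norm (X n - x)) \<longlonglongrightarrow> 0" by simp
  qed
qed

text \<open>The main device for extending a property from generators to a closed span, and for
  producing the closed invariant subspaces to which irreducibility is applied.\<close>

lemma closed_csubspace_preimage:
  assumes f: "bounded_clinear_on H f" and M: "closed_csubspace M"
  shows "closed_csubspace {x \<in> H. f x \<in> M}"
proof (rule closed_csubspaceI)
  note F = bounded_clinear_onD[OF f]
  note HH = csubspaceD[OF closed_csubspaceD(1)[OF F(1)]] and MM = csubspaceD[OF closed_csubspaceD(1)[OF M]]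
  show "0 \<in> {x \<in> H. f x \<in> M}" using HH MM F(5) by simp
  show "x + y \<in> {x \<in> H. f x \<in> M}" if "x \<in> {x \<in> H. f x \<in> M}" "y \<in> {x \<in> H. f x \<in> M}" for x y
    using that HH MM by (simp add: F(2))
  show "c *\<^sub>C x \<in> {x \<in> H. f x \<in> M}" if "x \<in> {x \<in> H. f x \<in> M}" for x c
    using that HH MM by (simp add: F(3))
  fix X x assume X: "\<And>n. X n \<in> {x \<in> H. f x \<in> M}" "X \<longlonglongrightarrow> x"
  then have XH: "\<And>n. X n \<in> H" by simp
  note lim = bounded_clinear_on_tendsto[OF f XH X(2)]
  show "x \<in> {x \<in> H. f x \<in> M}"
    using lim(1) closed_csubspace_limit[OF M _ lim(2)] X(1) by simp
qed

lemma closed_csubspace_equalizer: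
  assumes f: "bounded_clinear_on H f" and g: "bounded_clinear_on H g"
  shows "closed_csubspace {x \<in> H. f x = g x}"
proof -
  note F = bounded_clinear_onD[OF f] and G = bounded_clinear_onD[OF g]
  obtain K L where K: "\<And>x. x \<in> H \<Longrightarrow> norm (f x) \<le> K * norm x" and L: "\<And>x. x \<in> H \<Longrightarrow> norm (g x) \<le> L * norm x"
    using F(6) G(6) by blast
  have "norm (f x - g x) \<le> (K + L) * norm x" if "x \<in> H" for x
    using norm_triangle_ineq4[of "f x" "g x"] K[OF that] L[OF that] by (simp add: distrib_right)
  then have "bounded_clinear_on H (\<lambda>x. f x - g x)"
    unfolding bounded_clinear_on_def using F(1) by (auto simp: F(2,3) G(2,3) scaleC_diff_right)
  from closed_csubspace_preimage[OF this closed_csubspace_zero] show ?thesis by simp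
qed

lemma bounded_clinear_on_id: "closed_csubspace H \<Longrightarrow> bounded_clinear_on H (\<lambda>x. x)"
  unfolding bounded_clinear_on_def by (auto intro!: exI[of _ 1])

lemma bounded_clinear_on_approximation:
  fixes f :: "nat \<Rightarrow> 'h::complex_normed_vector \<Rightarrow> 'h"
  assumes f: "\<And>n. bounded_clinear_on H (f n)" and le: "\<And>n x. x \<in> H \<Longrightarrow> norm (f n x) \<le> norm x"
  shows "closed_csubspace {x \<in> H. (\<lambda>n. f n x) \<longlonglongrightarrow> x}"
proof (rule closed_csubspaceI)
  note F = bounded_clinear_onD[OF f]
  note H = csubspaceD[OF closed_csubspaceD(1)[OF F(1)]]
  fix X x assume X: "\<And>n. X n \<in> {x \<in> H. (\<lambda>n. f n x) \<longlonglongrightarrow> x}" "X \<longlonglongrightarrow> x"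
  then have XH: "\<And>n. X n \<in> H" by simp
  have xH: "x \<in> H" by (rule closed_csubspace_limit[OF F(1) XH X(2)])
  have "(\<lambda>n. f n x - x) \<longlonglongrightarrow> 0"
  \<comment> \<open>The constant 2 is one for the contraction \<open>f n\<close> and one for the
    identity.\<close>
  proof (rule tendsto_zero_closed[OF _ X(2), where C = 2])
    show "(\<lambda>n. f n (X k) - X k) \<longlonglongrightarrow> 0" for k using X(1)[of k] by (simp add: LIM_zero)
    fix n k
    have eq: "f n x - x - (f n (X k) - X k) = f n (x - X k) - (x - X k)"
      by (simp add: F(4)[OF xH XH])
    show "norm (f n x - x - (f n (X k) - X k)) \<le> 2 * norm (x - X k)"
      unfolding eq
      using norm_triangle_ineq4[of "f n (x - X k)" "x - X k"] le[OF H(5)[OF xH XH], of n k] by linarith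
  qed
  then show "x \<in> {x \<in> H. (\<lambda>n. f n x) \<longlonglongrightarrow> x}" using xH by (simp add: LIM_zero_iff)
next
  note F = bounded_clinear_onD[OF f]
  note H = csubspaceD[OF closed_csubspaceD(1)[OF F(1)]]
  show "0 \<in> {x \<in> H. (\<lambda>n. f n x) \<longlonglongrightarrow> x}" by (simp add: H(1) F(5))
  show "x + y \<in> {x \<in> H. (\<lambda>n. f n x) \<longlonglongrightarrow> x}"
    if "x \<in> {x \<in> H. (\<lambda>n. f n x) \<longlonglongrightarrow> x}" "y \<in> {x \<in> H. (\<lambda>n. f n x) \<longlonglongrightarrow> x}" for x y
    using that by (simp add: H(2) F(2) tendsto_add)
  show "c *\<^sub>C x \<in> {x \<in> H. (\<lambda>n. f n x) \<longlonglongrightarrow> x}" if "x \<in> {x \<in> H. (\<lambda>n. f n x) \<longlonglongrightarrow> x}" for c x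
    using that by (simp add: H(3) F(3) tendsto_scaleC)
qed

lemma bounded_clinear_on_mult:
  fixes a b :: "'b::cstar_algebra"
  shows "bounded_clinear_on UNIV (\<lambda>x. a * x)" "bounded_clinear_on UNIV (\<lambda>x. x * a)"
    "bounded_clinear_on UNIV (\<lambda>x. a * x * b)"
proof -
  have "norm (a * x * b) \<le> norm a * norm b * norm x" for x
    using norm_mult_ineq[of "a * x" b] mult_right_mono[OF norm_mult_ineq[of a x] norm_ge_zero[of b]]
    by (simp add: mult_ac)
  then show "bounded_clinear_on UNIV (\<lambda>x. a * x)" "bounded_clinear_on UNIV (\<lambda>x. x * a)"
    "bounded_clinear_on UNIV (\<lambda>x. a * x * b)"
    unfolding bounded_clinear_on_def using norm_mult_ineq[of a] norm_mult_ineq[of _ a]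
    by (simp_all add: closed_csubspace_UNIV distrib_left distrib_right mult_scaleC_left mult_scaleC_right)
      (metis mult.commute)+
qed

lemma cstar_subalgebra_hull: "cstar_subalgebra (cstar_subalgebra hull G)"
proof (rule hull_in)
  fix T :: "'a set set"
  assume "Ball T cstar_subalgebra"
  then show "cstar_subalgebra (\<Inter>T)"
    by (auto simp: cstar_subalgebra_def closed_csubspace_def csubspace_def)
qed

lemma closed_csubspace_hull: "closed_csubspace (closed_csubspace hull G)"
proof (rule hull_in)
  fix T :: "'a set set"
  assume "Ball T closed_csubspace"
  then show "closed_csubspace (\<Inter>T)"
    by (auto simp: closed_csubspace_def csubspace_def)
qed

text \<open>The fixed point \<open>w\<close> is \<open>1 - sqrt (1 - h * h)\<close>; it exists without a unit.\<close>

lemma sqrt_complement: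
  fixes h :: "'a::cstar_algebra"
  assumes D: "cstar_subalgebra D" "h \<in> D" and h: "star h = h" "norm h < 1"
  shows "\<exists>w\<in>D. star w = w \<and> w * h = h * w \<and> w + w = h * h + w * w"
proof -
  define r where "r = norm h * norm h"
  have r: "0 \<le> r" "r < 1"
    using h(2) mult_strict_mono[of "norm h" 1 "norm h" 1] by (auto simp: r_def)
  \<comment> \<open>Self-adjointness and commutation with \<open>h\<close> are closed conditions
    preserved by the iteration, so the fixed point inherits them. The radius \<open>r\<close> makes
    the iteration a contraction.\<close>
  define S where "S = {w \<in> D. star w = w \<and> w * h = h * w \<and> norm w \<le> r}"
  define f where "f w = (1 / 2) *\<^sub>R (h * h + w * w)" for w
  have "\<exists>!w\<in>S. f w = w"
  proof (rule Banach_fix)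
    have "closed S"
    proof (unfold closed_sequential_limits, intro allI impI, elim conjE)
      fix X w assume X: "\<forall>n. X n \<in> S" "X \<longlonglongrightarrow> w"
      have "w \<in> D" using X closed_sequentially[OF cstar_subalgebraD(2)[OF D(1)], of X w]
        by (simp add: S_def)
      moreover have "star w = w"
        using LIMSEQ_unique[OF tendsto_star[OF X(2)]] X by (simp add: S_def)
      moreover have "(\<lambda>n. h * X n) \<longlonglongrightarrow> h * w" "(\<lambda>n. X n * h) \<longlonglongrightarrow> w * h"
        by (intro tendsto_intros X)+
      then have "w * h = h * w" using X(1) LIMSEQ_unique by (fastforce simp: S_def)
      moreover have "norm w \<le> r"
        using X(1) by (intro LIMSEQ_le_const2[OF tendsto_norm[OF X(2)]]) (auto simp: S_def)
      ultimately show "w \<in> S" by (simp add: S_def)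
    qed
    then show "complete S" by (simp add: complete_eq_closed)
    have "0 \<in> S" using r cstar_subalgebra_csubspaceD(1)[OF D(1)] by (simp add: S_def)
    then show "S \<noteq> {}" by blast
    show "0 \<le> r" "r < 1" using r by auto
    show "f ` S \<subseteq> S"
    proof (safe)
      fix w assume w: "w \<in> S"
      have "norm (f w) \<le> (1 / 2) * (norm h * norm h + norm w * norm w)"
        unfolding f_def using norm_triangle_ineq[of "h * h" "w * w"] norm_mult_ineq[of h h] norm_mult_ineq[of w w]
        by simp
      also have "norm w * norm w \<le> r * 1"
        using w r by (intro mult_mono) (auto simp: S_def)
      finally have "norm (f w) \<le> r" by (simp add: r_def)
      moreover have "w * w * h = h * (w * w)"
      proof -
        have "w * w * h = w * (h * w)" using w by (simp add: S_def mult.assoc)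
        also have "\<dots> = h * w * w" using w by (simp add: S_def flip: mult.assoc)
        finally show ?thesis by (simp add: mult.assoc)
      qed
      ultimately show "f w \<in> S"
        using w h D by (simp add: S_def f_def cstar_subalgebra_csubspaceD cstar_subalgebraD(4) star_scaleR
            star_add star_mult ring_distribs mult.assoc)
    qed
    show "\<And>x y. x \<in> S \<Longrightarrow> y \<in> S \<Longrightarrow> dist (f x) (f y) \<le> r * dist x y"
    proof -
      fix x y assume xy: "x \<in> S" "y \<in> S"
      \<comment> \<open>This factorization of \<open>x * x - y * y\<close> is valid for noncommuting
        \<open>x\<close> and \<open>y\<close>. As both have norm at most \<open>r\<close>, the
        contraction constant is \<open>r\<close>.\<close>
      have "f x - f y = (1 / 2) *\<^sub>R (x * (x - y) + (x - y) * y)"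
        by (simp add: f_def algebra_simps)
      also have "norm \<dots> \<le> (1 / 2) * (norm x * norm (x - y) + norm (x - y) * norm y)"
        using norm_triangle_ineq[of "x * (x - y)" "(x - y) * y"] norm_mult_ineq[of x "x - y"]
          norm_mult_ineq[of "x - y" y] by simp
      also have "\<dots> \<le> (1 / 2) * (r * norm (x - y) + norm (x - y) * r)"
        using xy by (intro mult_left_mono add_mono mult_right_mono) (auto simp: S_def)
      finally show "dist (f x) (f y) \<le> r * dist x y" by (simp add: dist_norm)
    qed
  qed
  then obtain w where w: "w \<in> S" "f w = w" by blast
  have "w + w = 2 *\<^sub>R f w" using w(2) by (simp add: scaleR_2)
  then have "w + w = h * h + w * w" by (simp add: f_def)
  then show ?thesis using w(1) by (auto simp: S_def)
qed

subsection \<open>Representations and homomorphisms are contractive\<close>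

lemma representationD:
  assumes "representation D H \<pi>"
  shows "closed_csubspace H" "a \<in> D \<Longrightarrow> x \<in> H \<Longrightarrow> \<pi> a x \<in> H"
    "a \<in> D \<Longrightarrow> x \<in> H \<Longrightarrow> y \<in> H \<Longrightarrow> \<pi> a (x + y) = \<pi> a x + \<pi> a y"
    "a \<in> D \<Longrightarrow> x \<in> H \<Longrightarrow> \<pi> a (c *\<^sub>C x) = c *\<^sub>C \<pi> a x"
    "a \<in> D \<Longrightarrow> b \<in> D \<Longrightarrow> x \<in> H \<Longrightarrow> \<pi> (a + b) x = \<pi> a x + \<pi> b x"
    "a \<in> D \<Longrightarrow> x \<in> H \<Longrightarrow> \<pi> (c *\<^sub>C a) x = c *\<^sub>C \<pi> a x"
    "a \<in> D \<Longrightarrow> b \<in> D \<Longrightarrow> x \<in> H \<Longrightarrow> \<pi> (a * b) x = \<pi> a (\<pi> b x)"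
    "a \<in> D \<Longrightarrow> x \<in> H \<Longrightarrow> y \<in> H \<Longrightarrow> cinner (\<pi> (star a) x) y = cinner x (\<pi> a y)"
  using assms by (simp_all add: representation_def bounded_operator_on_def)

lemma norm_sq_cinner: "(norm x)\<^sup>2 = Re (cinner x x)"
  by (simp add: cinner_self flip: of_real_power)

lemma norm_sq_diff: "(norm (x - y))\<^sup>2 = (norm x)\<^sup>2 + (norm y)\<^sup>2 - 2 * Re (cinner x y)"
  using norm_sq_add[of x "- y"] by (simp add: cinner_minus_right)

text \<open>The definition of a representation provides a bound for each \<open>a\<close>
  separately; this one is uniform. For self-adjoint \<open>h\<close> of norm below 1 take
  \<open>w\<close> from \<open>sqrt_complement\<close>. Formally
  \<open>(1 - w)\<^sup>2 = 1 - h\<^sup>2\<close>, and \<open>x - \<pi> w x\<close> replaces the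
  action of \<open>1 - w\<close>, so that \<open>(norm (\<pi> h x))\<^sup>2 + (norm (x - \<pi> w
  x))\<^sup>2 = (norm x)\<^sup>2\<close>. Scaling and the C*-identity give the general case.\<close>

lemma representation_contractive:
  fixes D :: "'b::cstar_algebra set"
  assumes D: "cstar_subalgebra D" and \<pi>: "representation D H \<pi>" and a: "a \<in> D" and x: "x \<in> H"
  shows "norm (\<pi> a x) \<le> norm a * norm x"
proof -
  note R = representationD[OF \<pi>]
  note H = csubspaceD[OF closed_csubspaceD(1)[OF R(1)]]
  note DD = cstar_subalgebra_csubspaceD[OF D] cstar_subalgebraD(4,5)[OF D]
  have sa: "norm (\<pi> h x) \<le> norm x" if h: "h \<in> D" "star h = h" "norm h < 1" for h
  proof -
    obtain w where w: "w \<in> D" "star w = w" "w + w = h * h + w * w"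
      using sqrt_complement[OF D h] by blast
    have eq: "(norm (\<pi> k x))\<^sup>2 = Re (cinner x (\<pi> (k * k) x))" if "k \<in> D" "star k = k" for k
      using R(8)[OF that(1) x R(2)[OF that(1) x]] that x by (simp add: norm_sq_cinner R(7))
    have "Re (cinner x (\<pi> w x)) + Re (cinner x (\<pi> w x)) = Re (cinner x (\<pi> (w + w) x))"
      using R(5)[OF w(1) w(1) x] by (simp add: cinner_add_right)
    also have "\<dots> = (norm (\<pi> h x))\<^sup>2 + (norm (\<pi> w x))\<^sup>2"
      unfolding w(3) using w(1,2) h x by (simp add: R(5) cinner_add_right DD eq)
    finally have "(norm (\<pi> h x))\<^sup>2 + (norm (x - \<pi> w x))\<^sup>2 = (norm x)\<^sup>2"
      by (simp add: norm_sq_diff)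
    then have "(norm (\<pi> h x))\<^sup>2 \<le> (norm x)\<^sup>2" using zero_le_power2[of "norm (x - \<pi> w x)"] by linarith
    then show ?thesis by (rule power2_le_imp_le) simp
  qed
  have sa': "norm (\<pi> h x) \<le> norm h * norm x" if h: "h \<in> D" "star h = h" for h
  proof (rule field_le_mult_one_interval)
    fix z :: real assume z: "0 < z" "z < 1"
    show "z * norm (\<pi> h x) \<le> norm h * norm x"
    proof (cases "h = 0")
      case True
      then have "\<pi> h x = 0" using R(6)[OF h(1) x, of 0] by simp
      then show ?thesis by simp
    next
      case False
      have "norm (\<pi> ((z / norm h) *\<^sub>R h) x) \<le> norm x"
        using False z h by (intro sa) (simp_all add: DD star_scaleR)
      then show ?thesis using False z h x
        by (simp add: scaleR_scaleC_def R(6) norm_scaleC norm_divide divide_simps mult.commute)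
    qed
  qed
  have "(norm (\<pi> a x))\<^sup>2 = Re (cinner x (\<pi> (star a * a) x))"
    using R(8)[of "star a", OF DD(8)[OF a] x R(2)[OF a x]] a x by (simp add: norm_sq_cinner R(7) DD star_star)
  also have "\<dots> \<le> norm x * norm (\<pi> (star a * a) x)"
    using complex_Re_le_cmod cauchy_schwarz order_trans by blast
  also have "\<dots> \<le> norm x * (norm (star a * a) * norm x)"
    using a by (intro mult_left_mono sa') (simp_all add: DD star_mult star_star)
  finally have "(norm (\<pi> a x))\<^sup>2 \<le> (norm a * norm x)\<^sup>2"
    by (simp add: cstar_identity power_mult_distrib power2_eq_square mult_ac)
  then show ?thesis by (rule power2_le_imp_le) simp
qed

lemma bounded_clinear_on_representation:
  assumes "representation D H \<pi>" "a \<in> D" shows "bounded_clinear_on H (\<pi> a)"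
  using assms by (auto simp: bounded_clinear_on_def representation_def bounded_operator_on_def)

lemma bounded_clinear_on_representation_left:
  assumes D: "cstar_subalgebra D" and \<pi>: "representation D H \<pi>" and x: "x \<in> H"
  shows "bounded_clinear_on D (\<lambda>a. \<pi> a x)"
  unfolding bounded_clinear_on_def
  using cstar_subalgebraD(3)[OF D] representationD(5,6)[OF \<pi>] representation_contractive[OF D \<pi> _ x] x
  by (auto simp: mult.commute intro!: exI[of _ "norm x"])

lemmas representation_tendsto = bounded_clinear_on_tendsto(2)[OF bounded_clinear_on_representation]
  and representation_tendsto_left = bounded_clinear_on_tendsto(2)[OF bounded_clinear_on_representation_left]

section \<open>Star homomorphisms, corners and unitaries\<close>

definition star_hom :: "'a::cstar_algebra set \<Rightarrow> ('a \<Rightarrow> 'b::cstar_algebra) \<Rightarrow> bool" where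
  "star_hom D \<phi> \<longleftrightarrow> (\<forall>a\<in>D. \<forall>b\<in>D. \<phi> (a + b) = \<phi> a + \<phi> b \<and> \<phi> (a * b) = \<phi> a * \<phi> b) \<and>
     (\<forall>c. \<forall>a\<in>D. \<phi> (c *\<^sub>C a) = c *\<^sub>C \<phi> a) \<and> (\<forall>a\<in>D. \<phi> (star a) = star (\<phi> a))"

lemma star_homD:
  assumes "star_hom D \<phi>"
  shows "a \<in> D \<Longrightarrow> b \<in> D \<Longrightarrow> \<phi> (a + b) = \<phi> a + \<phi> b" "a \<in> D \<Longrightarrow> b \<in> D \<Longrightarrow> \<phi> (a * b) = \<phi> a * \<phi> b"
    "a \<in> D \<Longrightarrow> \<phi> (c *\<^sub>C a) = c *\<^sub>C \<phi> a" "a \<in> D \<Longrightarrow> \<phi> (star a) = star (\<phi> a)"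
  using assms by (simp_all add: star_hom_def)

text \<open>A projection \<open>e\<close> serves as the unit of its corner, since the ambient algebra need not be an
  algebra with \<open>1\<close> in the sense of type classes.\<close>

definition projection :: "'a::cstar_algebra \<Rightarrow> bool" where
  "projection e \<longleftrightarrow> star e = e \<and> e * e = e"

definition corner :: "'a::cstar_algebra \<Rightarrow> 'a set" where
  "corner e = {x. e * x = x \<and> x * e = x}"

lemma projectionD: "projection e \<Longrightarrow> star e = e" "projection e \<Longrightarrow> e * e = e"
  by (simp_all add: projection_def)

lemma cornerD: "x \<in> corner e \<Longrightarrow> e * x = x" "x \<in> corner e \<Longrightarrow> x * e = x"
  by (simp_all add: corner_def)

lemma norm_projection_le: "projection e \<Longrightarrow> norm e \<le> 1"
proof -
  assume "projection e"
  then have "(norm e)\<^sup>2 = norm e" using cstar_identity[of e] by (simp add: projection_def)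
  then show ?thesis by (auto simp: power2_eq_square)
qed

lemma projection_in_corner: "projection e \<Longrightarrow> e \<in> corner e"
  by (simp add: projection_def corner_def)

lemma cstar_subalgebra_corner: "projection e \<Longrightarrow> cstar_subalgebra (corner e)"
proof (rule cstar_subalgebraI)
  fix X x assume X: "\<And>n. X n \<in> corner e" "X \<longlonglongrightarrow> x"
  have "(\<lambda>n. e * X n) \<longlonglongrightarrow> e * x" "(\<lambda>n. X n * e) \<longlonglongrightarrow> x * e"
    by (intro tendsto_intros X)+
  then show "x \<in> corner e" using X LIMSEQ_unique by (fastforce simp: corner_def)
next
  fix x assume "projection e" "x \<in> corner e"
  then show "star x \<in> corner e"
    by (auto simp: corner_def projection_def) (metis star_mult)+
next
  fix x y assume "x \<in> corner e" "y \<in> corner e"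
  then show "x * y \<in> corner e" by (simp add: corner_def mult.assoc) (simp flip: mult.assoc)
qed (auto simp: corner_def ring_distribs mult_scaleC_left mult_scaleC_right)

definition unitary_in :: "'a::cstar_algebra \<Rightarrow> 'a \<Rightarrow> bool" where
  "unitary_in e u \<longleftrightarrow> u \<in> corner e \<and> star u * u = e \<and> u * star u = e"

lemma norm_unitary_le: "projection e \<Longrightarrow> unitary_in e u \<Longrightarrow> norm u \<le> 1"
  using cstar_identity[of u] norm_projection_le[of e]
  by (intro power2_le_imp_le[of "norm u" 1]) (simp_all add: unitary_in_def)

text \<open>\<open>e - w\<close> is a self-adjoint square root of \<open>e - h * h\<close> that
  commutes with \<open>h\<close>, so \<open>u\<close> is the operator form of cos + i sin, with real
  part \<open>h\<close>.\<close>

lemma unitary_of_selfadjoint: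
  assumes e: "projection e" "h \<in> corner e" "w \<in> corner e"
    and h: "star h = h" "star w = w" "w * h = h * w" "w + w = h * h + w * w"
  defines "u \<equiv> h + \<i> *\<^sub>C (e - w)"
  shows "unitary_in e u" "u + star u = 2 *\<^sub>R h"
proof -
  note P = projectionD[OF e(1)] cornerD[OF e(2)] cornerD[OF e(3)]
  have su: "star u = h - \<i> *\<^sub>C (e - w)"
    by (simp add: u_def h P star_add star_scaleC star_diff scaleC_minus_left scaleC_minus_one)
  show "u + star u = 2 *\<^sub>R h" unfolding su by (simp add: u_def scaleR_2)
  define k where "k = e - w"
  have k: "k * k = e - h * h" "h * k = k * h"
    using h(3,4) by (simp_all add: k_def ring_distribs P algebra_simps)
  have i2: "\<i> *\<^sub>C \<i> *\<^sub>C x = - x" for x :: 'a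
    by (simp add: scaleC_scaleC scaleC_minus_one)
  have uk: "star u = h - \<i> *\<^sub>C k" "u = h + \<i> *\<^sub>C k"
    unfolding su by (simp_all add: u_def k_def)
  have "star u * u = e" "u * star u = e"
    unfolding uk(1) unfolding uk(2)
    by (simp_all add: algebra_simps mult_scaleC_left mult_scaleC_right i2 k scaleC_add_right scaleC_diff_right)
  moreover have "u \<in> corner e"
    unfolding u_def
    by (intro cstar_subalgebra_csubspaceD[OF cstar_subalgebra_corner[OF e(1)]] e projection_in_corner)
  ultimately show "unitary_in e u" by (simp add: unitary_in_def)
qed

text \<open>For self-adjoint \<open>h\<close> of norm below 1, \<open>\<phi> h\<close> is the
  average of a unitary and its adjoint. The unit \<open>d\<close> of \<open>D\<close> goes to a
  projection that need not be a unit of the target, so the unitary lives in the corner of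
  \<open>\<phi> d\<close>.\<close>

lemma star_hom_contractive:
  assumes D: "cstar_subalgebra D" and \<phi>: "star_hom D \<phi>"
    and d: "d \<in> D" "star d = d" "\<And>x. x \<in> D \<Longrightarrow> d * x = x \<and> x * d = x" and a: "a \<in> D"
  shows "norm (\<phi> a) \<le> norm a"
proof -
  note R = star_homD[OF \<phi>]
  note DD = cstar_subalgebra_csubspaceD[OF D] cstar_subalgebraD(4,5)[OF D]
  have e: "projection (\<phi> d)"
    using d R(2)[OF d(1) d(1)] R(4)[OF d(1)] by (simp add: projection_def)
  have cor: "\<phi> x \<in> corner (\<phi> d)" if "x \<in> D" for x
    using R(2)[OF d(1) that] R(2)[OF that d(1)] d(3)[OF that] by (simp add: corner_def)
  have sa: "norm (\<phi> h) \<le> 1" if h: "h \<in> D" "star h = h" "norm h < 1" for h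
  proof -
    obtain w where w: "w \<in> D" "star w = w" "w * h = h * w" "w + w = h * h + w * w"
      using sqrt_complement[OF D h] by blast
    define u where "u = \<phi> h + \<i> *\<^sub>C (\<phi> d - \<phi> w)"
    have "star (\<phi> h) = \<phi> h" "star (\<phi> w) = \<phi> w" "\<phi> w * \<phi> h = \<phi> h * \<phi> w"
      "\<phi> w + \<phi> w = \<phi> h * \<phi> h + \<phi> w * \<phi> w"
      using h w R(4)[OF h(1)] R(4)[OF w(1)] by (simp_all add: DD flip: R(1,2))
    from unitary_of_selfadjoint[OF e cor[OF h(1)] cor[OF w(1)] this]
    have u: "unitary_in (\<phi> d) u" "u + star u = 2 *\<^sub>R \<phi> h" by (simp_all add: u_def)
    have "norm (2 *\<^sub>R \<phi> h) \<le> norm u + norm (star u)"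
      unfolding u(2)[symmetric] by (rule norm_triangle_ineq)
    then show ?thesis using norm_unitary_le[OF e u(1)] by simp
  qed
  have sa': "norm (\<phi> h) \<le> norm h" if h: "h \<in> D" "star h = h" for h
  proof (rule field_le_mult_one_interval)
    fix z :: real assume z: "0 < z" "z < 1"
    show "z * norm (\<phi> h) \<le> norm h"
    proof (cases "h = 0")
      case True
      then show ?thesis using R(3)[OF h(1), of 0] by simp
    next
      case False
      have "norm (\<phi> ((z / norm h) *\<^sub>R h)) \<le> 1"
        using False z h by (intro sa) (simp_all add: DD star_scaleR)
      then show ?thesis using False z h
        by (simp add: scaleR_scaleC_def R(3) norm_scaleC norm_divide divide_simps mult.commute)
    qed
  qed
  have "(norm (\<phi> a))\<^sup>2 = norm (\<phi> (star a * a))"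
    using a by (simp add: R DD cstar_identity)
  also have "\<dots> \<le> (norm a)\<^sup>2"
    using sa'[of "star a * a"] a by (simp add: DD star_mult star_star cstar_identity)
  finally show ?thesis by (rule power2_le_imp_le) simp
qed

section \<open>Continuous functional calculus for a self-adjoint element\<close>

text \<open>Horner's rule with \<open>e\<close> as the constant 1: by its class \<open>'b\<close>
  has no unit, and \<open>e\<close> is the unit of the corner in which \<open>u\<close> will
  lie.\<close>

definition peval :: "'b::cstar_algebra \<Rightarrow> 'b \<Rightarrow> complex poly \<Rightarrow> 'b" where
  "peval e u P = fold_coeffs (\<lambda>c x. c *\<^sub>C e + u * x) P 0"

lemma peval_0 [simp]: "peval e u 0 = 0"
  by (simp add: peval_def)

lemma peval_pCons: "peval e u (pCons a p) = a *\<^sub>C e + u * peval e u p"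
  by (cases "a = 0 \<and> p = 0") (auto simp: peval_def)

lemma peval_add: "peval e u (p + q) = peval e u p + peval e u q"
proof (induction p q rule: poly_induct2)
  case (pCons a p b q)
  then show ?case by (simp add: peval_pCons scaleC_add_left algebra_simps)
qed simp

lemma peval_smult: "peval e u (smult c p) = c *\<^sub>C peval e u p"
  by (induction p) (simp_all add: peval_pCons scaleC_add_right scaleC_scaleC mult_scaleC_right)

lemma peval_diff: "peval e u (p - q) = peval e u p - peval e u q"
  using peval_add[of e u p "smult (- 1) q"] by (simp only: peval_smult scaleC_minus_one) simp

text \<open>Normality turns \<open>star (x * x) * (x * x)\<close> into the square of the
  self-adjoint \<open>star x * x\<close>, to which the C*-identity applies again.\<close>

lemma norm_square_normal:
  fixes x :: "'c::cstar_algebra"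
  assumes "star x * x = x * star x"
  shows "norm (x * x) = (norm x)\<^sup>2"
proof -
  have "(norm (x * x))\<^sup>2 = norm (star x * (star x * x) * x)"
    by (simp add: star_mult mult.assoc flip: cstar_identity)
  also have "star x * (star x * x) * x = star x * (x * star x) * x"
    by (simp only: assms)
  also have "\<dots> = star (star x * x) * (star x * x)"
    by (simp add: star_mult star_star mult.assoc)
  also have "norm \<dots> = ((norm x)\<^sup>2)\<^sup>2"
    by (simp only: cstar_identity)
  finally show ?thesis by (rule power2_eq_imp_eq) simp_all
qed

lemma coeff_le_circle:
  assumes "\<And>z. cmod z = 1 \<Longrightarrow> cmod (poly P z) \<le> M"
  shows "cmod (coeff P i) \<le> M"
proof -
  have d: "(deriv ^^ n) (poly P) = poly ((pderiv ^^ n) P)" for n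
    by (induction n) (auto intro!: DERIV_imp_deriv poly_DERIV)
  have "cmod ((deriv ^^ i) (poly P) 0) \<le> fact i * M / 1 ^ i"
    by (rule Cauchy_inequality) (auto intro!: holomorphic_intros continuous_intros assms)
  moreover have "(deriv ^^ i) (poly P) 0 = fact i * coeff P i"
    by (simp add: d poly_0_coeff_0 coeff_higher_pderiv pochhammer_fact)
  ultimately show ?thesis by (simp add: norm_mult)
qed

text \<open>If \<open>a > M\<close>, the ratio \<open>x = M / a\<close> satisfies
  \<open>n * x ^ n \<longlonglongrightarrow> 0\<close>, against the assumed lower bound. The lemma
  removes factors that grow only linearly in the exponent, once for polynomials in a unitary and
  once for infinite matrices.\<close>

lemma exp_dominates_linear:
  fixes a M :: real
  assumes M: "0 \<le> M" and le: "\<And>k. a ^ (2 ^ k) \<le> real (2 ^ k * d + 1) * M ^ (2 ^ k)"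
  shows "a \<le> M"
proof (rule ccontr)
  assume "\<not> a \<le> M"
  then have a: "a > M" "a > 0" using M by auto
  define x where "x = M / a"
  have x: "norm x < 1" using a M by (simp add: x_def)
  have lim: "(\<lambda>n. real d * (real n * x ^ n) + x ^ n) \<longlonglongrightarrow> real d * 0 + 0"
    using x by (intro tendsto_intros powser_times_n_limit_0) (auto intro: LIMSEQ_power_zero)
  have sm: "strict_mono (\<lambda>k. 2 ^ k :: nat)" by (rule strict_monoI) simp
  have "1 \<le> real d * (real (2 ^ k) * x ^ (2 ^ k)) + x ^ (2 ^ k)" for k
  proof -
    have "1 \<le> real (2 ^ k * d + 1) * M ^ (2 ^ k) / a ^ (2 ^ k)"
      using le[of k] a by (simp add: divide_simps)
    also have "\<dots> = real (2 ^ k * d + 1) * x ^ (2 ^ k)"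
      by (simp add: x_def power_divide)
    finally show ?thesis by (simp add: algebra_simps)
  qed
  then have "(1::real) \<le> real d * 0 + 0"
    by (intro LIMSEQ_le_const[OF LIMSEQ_subseq_LIMSEQ[OF lim sm]]) (auto simp: o_def)
  then show False by simp
qed

context
  fixes e :: "'b::cstar_algebra"
  assumes e: "projection e"
begin

lemma peval_in:
  assumes "cstar_subalgebra D" "e \<in> D" "u \<in> D"
  shows "peval e u p \<in> D"
  using assms
  by (induction p) (auto simp: peval_pCons cstar_subalgebra_csubspaceD cstar_subalgebraD(4))

lemma peval_corner: "u \<in> corner e \<Longrightarrow> peval e u p \<in> corner e"
  by (intro peval_in cstar_subalgebra_corner projection_in_corner e)

lemma peval_mult: "u \<in> corner e \<Longrightarrow> peval e u (p * q) = peval e u p * peval e u q"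
proof (induction p)
  case (pCons a p)
  then show ?case
    using cornerD(1)[OF peval_corner[of u q]]
    by (simp add: peval_pCons peval_add peval_smult distrib_right mult_scaleC_left mult.assoc)
qed simp

lemma peval_commute_elem:
  assumes "y \<in> corner e" "y * u = u * y"
  shows "y * peval e u p = peval e u p * y"
proof (induction p)
  case (pCons a p)
  have "y * (u * peval e u p) = u * (y * peval e u p)" by (simp add: assms(2) flip: mult.assoc)
  then show ?case
    using assms by (simp add: peval_pCons distrib_left distrib_right mult_scaleC_left mult_scaleC_right
        cornerD mult.assoc pCons)
qed simp

lemma peval_linear: "u \<in> corner e \<Longrightarrow> peval e u [:0, 1:] = u"
  by (simp add: peval_pCons cornerD)

lemma norm_peval_le:
  assumes "norm u \<le> 1" "\<And>i. cmod (coeff p i) \<le> M"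
  shows "norm (peval e u p) \<le> real (degree p + 1) * M"
  using assms(2)
proof (induction p)
  case 0
  then show ?case using order_trans[OF norm_ge_zero 0[of 0]] by simp
next
  case (pCons a p)
  have a: "cmod a \<le> M" and M: "cmod (coeff p i) \<le> M" for i
    using pCons.prems[of 0] pCons.prems[of "Suc i"] by simp_all
  have "norm (peval e u (pCons a p)) \<le> cmod a * norm e + norm u * norm (peval e u p)"
    using norm_triangle_ineq[of "a *\<^sub>C e" "u * peval e u p"] norm_mult_ineq[of u "peval e u p"]
    by (simp add: peval_pCons norm_scaleC)
  also have "\<dots> \<le> cmod a * 1 + 1 * norm (peval e u p)"
    using assms(1) norm_projection_le[OF e] by (intro add_mono mult_mono) auto
  finally have le: "norm (peval e u (pCons a p)) \<le> M + norm (peval e u p)" using a by simp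
  show ?case
  proof (cases "p = 0")
    case False
    then show ?thesis using le pCons.IH[OF M] by (simp add: algebra_simps)
  qed (use le in simp)
qed

text \<open>For normal \<open>x\<close> the norm is multiplicative on the powers \<open>x ^ (2 ^ k)\<close>, and the norm of
  \<open>P ^ (2 ^ k)\<close> at a unitary is at most the sum of its coefficients, each of which is at most
  \<open>M ^ (2 ^ k)\<close>. The number of coefficients grows only linearly in the exponent.\<close>

lemma norm_peval_unitary_le:
  assumes u: "unitary_in e u" and M: "\<And>z. cmod z = 1 \<Longrightarrow> cmod (poly P z) \<le> M"
  shows "norm (peval e u P) \<le> M"
proof (rule exp_dominates_linear)
  show "0 \<le> M" using order_trans[OF norm_ge_zero M[of 1]] by simp
  have uc: "u \<in> corner e" "star u * u = u * star u" using u by (auto simp: unitary_in_def)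
  note cor = cstar_subalgebraD(5)[OF cstar_subalgebra_corner[OF e]]
  \<comment> \<open>Normality of \<open>peval e u Q\<close> in two rounds: \<open>star u\<close>
    commutes with polynomials in \<open>u\<close>; the adjoint of this says that
    \<open>star (peval e u Q)\<close> commutes with \<open>u\<close>, hence with polynomials in
    \<open>u\<close>.\<close>
  have "star u * peval e u Q = peval e u Q * star u" for Q
    by (intro peval_commute_elem cor uc)
  from arg_cong[where f = star, OF this]
  have "star (peval e u Q) * u = u * star (peval e u Q)" for Q
    by (simp add: star_mult star_star)
  then have "star (peval e u Q) * peval e u Q = peval e u Q * star (peval e u Q)" for Q
    by (intro peval_commute_elem cor peval_corner uc)
  then have sq: "norm (peval e u (Q * Q)) = (norm (peval e u Q))\<^sup>2" for Q
    by (simp add: peval_mult[OF uc(1)] norm_square_normal)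
  fix k
  have "norm (peval e u P) ^ (2 ^ k) = norm (peval e u (P ^ (2 ^ k)))"
  proof (induction k)
    case (Suc k)
    have "norm (peval e u P) ^ 2 ^ Suc k = (norm (peval e u P) ^ 2 ^ k)\<^sup>2"
      by (simp add: mult.commute flip: power_mult)
    also have "\<dots> = norm (peval e u (P ^ 2 ^ k * P ^ 2 ^ k))" by (simp add: Suc sq)
    finally show ?case by (simp add: mult_2 power_add)
  qed simp
  also have "\<dots> \<le> real (degree (P ^ 2 ^ k) + 1) * M ^ 2 ^ k"
    using M by (intro norm_peval_le norm_unitary_le[OF e u] coeff_le_circle)
      (auto simp: poly_power norm_power intro!: power_mono)
  also have "\<dots> \<le> real (2 ^ k * degree P + 1) * M ^ 2 ^ k"
    using degree_power_le[of P "2 ^ k"] \<open>0 \<le> M\<close>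
    by (intro mult_right_mono) (simp_all add: mult.commute flip: of_nat_add of_nat_mult of_nat_power)
  finally show "norm (peval e u P) ^ (2 ^ k) \<le> real (2 ^ k * degree P + 1) * M ^ 2 ^ k" .
qed

text \<open>On the unitary side \<open>p\<close> at \<open>h\<close> is a Laurent polynomial in
  \<open>u\<close>, as \<open>star u\<close> is the inverse of \<open>u\<close>. Multiplication by a
  high power of \<open>u\<close> clears the negative exponents. On the circle, \<open>h\<close>
  becomes the function \<open>c * Re z\<close>.\<close>

lemma laurent_of_poly:
  assumes u: "unitary_in e u" and h: "h = (c / 2) *\<^sub>R (u + star u)"
  shows "\<exists>Q n. (\<forall>z. cmod z = 1 \<longrightarrow> poly Q z = z ^ n * poly p (of_real (c * Re z))) \<and>
    peval e u Q = peval e u (monom 1 n) * peval e h p"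
proof (induction p)
  case 0
  show ?case by (intro exI[of _ 0]) simp
next
  case (pCons a p)
  then obtain Q n where Q: "\<And>z. cmod z = 1 \<Longrightarrow> poly Q z = z ^ n * poly p (of_real (c * Re z))"
    "peval e u Q = peval e u (monom 1 n) * peval e h p" by blast
  have uc: "u \<in> corner e" "u * star u = e" using u by (auto simp: unitary_in_def)
  \<comment> \<open>\<open>T\<close> represents \<open>u * h\<close>: multiplying
    \<open>(c / 2) * (z + 1 / z)\<close> by \<open>z\<close> gives its coefficients.\<close>
  define T where "T = [: complex_of_real (c / 2), 0, complex_of_real (c / 2) :]"
  define m where "m = peval e u (monom 1 n)"
  have mS: "monom a (Suc n) = smult a (monom 1 n * [:0, 1:])" for a :: complex
    by (simp add: monom_Suc smult_monom mult.commute)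
  have uh: "peval e u T = u * h"
    by (simp add: T_def peval_pCons h uc cornerD[OF uc(1)] distrib_left scaleR_scaleC_def mult_scaleC_right
        scaleC_add_right add.commute)
  have m_comm: "m * peval e u T = peval e u T * m"
    unfolding m_def by (simp add: mult.commute flip: peval_mult[OF uc(1)])
  have "peval e u (monom a (Suc n) + T * Q) = a *\<^sub>C (m * u) + peval e u T * (m * peval e h p)"
    by (simp only: mS peval_add peval_smult peval_mult[OF uc(1)] peval_linear[OF uc(1)] m_def Q(2))
  also have "\<dots> = m * u * (a *\<^sub>C e + h * peval e h p)"
    using m_comm uc by (simp add: uh distrib_left mult_scaleC_right mult.assoc cornerD)
      (simp add: uh flip: mult.assoc)
  also have "m * u = peval e u (monom 1 (Suc n))"
    by (simp only: mS peval_smult peval_mult[OF uc(1)] peval_linear[OF uc(1)] m_def scaleC_one)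
  finally have "peval e u (monom a (Suc n) + T * Q) = peval e u (monom 1 (Suc n)) * peval e h (pCons a p)"
    by (simp add: peval_pCons)
  moreover have "poly (monom a (Suc n) + T * Q) z = z ^ Suc n * poly (pCons a p) (of_real (c * Re z))"
    if z: "cmod z = 1" for z
  proof -
    have "z * cnj z = 1" using complex_norm_square[of z] z by simp
    moreover have "complex_of_real (Re z) = (z + cnj z) / 2" by (simp add: complex_add_cnj)
    ultimately have "1 + z * z = 2 * z * of_real (Re z)" by (simp add: algebra_simps)
    moreover have "poly T z = of_real (c / 2) * (1 + z * z)" by (simp add: T_def algebra_simps)
    ultimately have "poly T z = z * of_real (c * Re z)" by simp
    then show ?thesis using Q(1)[OF z] by (simp add: poly_monom algebra_simps)
  qed
  ultimately show ?case by blast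
qed

text \<open>\<open>h\<close> is \<open>c\<close> times the real part of a unitary \<open>u\<close>.
  Powers of \<open>u\<close> are isometries, so \<open>p\<close> at \<open>h\<close> has the norm of
  a polynomial in \<open>u\<close>, which is bounded by its maximum on the circle. The map
  \<open>c * Re z\<close> sends the circle into \<open>{- c..c}\<close>.\<close>

lemma norm_peval_le_interval:
  assumes h: "h \<in> corner e" "star h = h" "norm h < c"
    and M: "\<And>r. - c \<le> r \<Longrightarrow> r \<le> c \<Longrightarrow> cmod (poly p (of_real r)) \<le> M"
  shows "norm (peval e h p) \<le> M"
proof -
  have c: "c > 0" using le_less_trans[OF norm_ge_zero h(3)] .
  define h' where "h' = (1 / c) *\<^sub>R h"
  note cor = cstar_subalgebra_corner[OF e]
  have h': "h' \<in> corner e" "star h' = h'" "norm h' < 1"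
    using h c by (simp_all add: h'_def cstar_subalgebra_csubspaceD[OF cor] star_scaleR)
  obtain w where w: "w \<in> corner e" "star w = w" "w * h' = h' * w" "w + w = h' * h' + w * w"
    using sqrt_complement[OF cor h'] by blast
  define u where "u = h' + \<i> *\<^sub>C (e - w)"
  have u: "unitary_in e u" "u + star u = 2 *\<^sub>R h'"
    unfolding u_def by (rule unitary_of_selfadjoint[OF e h'(1) w(1) h'(2) w(2-4)])+
  have uc: "u \<in> corner e" "star u * u = e" using u(1) by (auto simp: unitary_in_def)
  have "h = (c / 2) *\<^sub>R (u + star u)"
    using c by (simp add: u(2) h'_def)
  from laurent_of_poly[OF u(1) this, of p] obtain Q n where
    Q: "\<And>z. cmod z = 1 \<Longrightarrow> poly Q z = z ^ n * poly p (of_real (c * Re z))"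
    "peval e u Q = peval e u (monom 1 n) * peval e h p" by blast
  have iso: "star (peval e u (monom 1 n)) * peval e u (monom 1 n) = e" for n
  proof (induction n)
    case 0
    then show ?case using projectionD[OF e] by (simp add: peval_pCons monom_0)
  next
    case (Suc n)
    let ?m = "peval e u (monom 1 n)"
    have "monom (1::complex) (Suc n) = monom 1 n * [:0, 1:]" by (simp add: monom_Suc)
    then have "peval e u (monom 1 (Suc n)) = ?m * u"
      by (simp only: peval_mult[OF uc(1)] peval_linear[OF uc(1)])
    then have "star (peval e u (monom 1 (Suc n))) * peval e u (monom 1 (Suc n)) = star u * (star ?m * ?m) * u"
      by (simp add: star_mult mult.assoc)
    also have "\<dots> = e" by (simp add: Suc uc cornerD[OF uc(1)] mult.assoc)
    finally show ?case .
  qed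
  have "norm (peval e h p) ^ 2 = norm (star (peval e h p) * (star (peval e u (monom 1 n)) * peval e u (monom 1 n)) * peval e h p)"
    using cornerD[OF peval_corner[OF h(1), of p]] by (simp add: iso cstar_identity mult.assoc)
  also have "\<dots> = norm (peval e u Q) ^ 2"
    by (simp add: Q(2) star_mult mult.assoc flip: cstar_identity)
  finally have "norm (peval e h p) = norm (peval e u Q)" by simp
  also have "\<dots> \<le> M"
  proof (rule norm_peval_unitary_le[OF u(1)])
    fix z :: complex assume z: "cmod z = 1"
    have "\<bar>Re z\<bar> \<le> 1" using abs_Re_le_cmod[of z] z by simp
    then have "- c \<le> c * Re z" "c * Re z \<le> c"
      using c mult_left_mono[of "- 1" "Re z" c] mult_left_mono[of "Re z" 1 c] by auto
    then show "cmod (poly Q z) \<le> M" using M[of "c * Re z"] z by (simp add: Q(1) norm_mult norm_power)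
  qed
  finally show ?thesis .
qed

end

section \<open>Continuous functions of a self-adjoint element\<close>

definition is_fc :: "'b::cstar_algebra \<Rightarrow> 'b \<Rightarrow> real \<Rightarrow> (real \<Rightarrow> complex) \<Rightarrow> 'b \<Rightarrow> bool" where
  "is_fc e h c f x \<longleftrightarrow> (\<exists>p. uniform_limit {- c..c} (\<lambda>n r. poly (p n) (of_real r)) f sequentially \<and>
     (\<lambda>n. peval e h (p n)) \<longlonglongrightarrow> x)"

lemma is_fc_poly: "is_fc e h c (\<lambda>r. poly p (of_real r)) (peval e h p)"
  unfolding is_fc_def by (intro exI[of _ "\<lambda>_. p"]) (auto intro: uniform_limit_const)

lemma is_fc_id: "projection e \<Longrightarrow> h \<in> corner e \<Longrightarrow> is_fc e h c complex_of_real h"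
  using is_fc_poly[of e h c "[:0, 1:]"] by (simp add: peval_linear)

lemma is_fc_const: "is_fc e h c (\<lambda>_. a) (a *\<^sub>C e)"
  using is_fc_poly[of e h c "[:a:]"] by (simp add: peval_pCons)

lemma is_fc_diff:
  assumes "is_fc e h c f x" "is_fc e h c g y"
  shows "is_fc e h c (\<lambda>r. f r - g r) (x - y)"
proof -
  obtain p q where "uniform_limit {- c..c} (\<lambda>n r. poly (p n) (of_real r)) f sequentially"
    "(\<lambda>n. peval e h (p n)) \<longlonglongrightarrow> x" "uniform_limit {- c..c} (\<lambda>n r. poly (q n) (of_real r)) g sequentially"
    "(\<lambda>n. peval e h (q n)) \<longlonglongrightarrow> y" using assms unfolding is_fc_def by blast
  then show ?thesis unfolding is_fc_def
    by (intro exI[of _ "\<lambda>n. p n - q n"]) (auto simp: peval_diff intro!: uniform_limit_intros tendsto_intros)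
qed

lemma is_fc_mult:
  assumes "is_fc e h c f x" "is_fc e h c g y" "projection e" "h \<in> corner e"
    and "bounded (f ` {- c..c})" "bounded (g ` {- c..c})"
  shows "is_fc e h c (\<lambda>r. f r * g r) (x * y)"
proof -
  obtain p q where "uniform_limit {- c..c} (\<lambda>n r. poly (p n) (of_real r)) f sequentially"
    "(\<lambda>n. peval e h (p n)) \<longlonglongrightarrow> x" "uniform_limit {- c..c} (\<lambda>n r. poly (q n) (of_real r)) g sequentially"
    "(\<lambda>n. peval e h (q n)) \<longlonglongrightarrow> y" using assms unfolding is_fc_def by blast
  then show ?thesis unfolding is_fc_def using assms(3-)
    by (intro exI[of _ "\<lambda>n. p n * q n"]) (auto simp: peval_mult intro!: uniform_lim_mult tendsto_intros)
qed

text \<open>The polynomial estimate survives uniform limits. The case \<open>M = 0\<close> transfers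
  identities between functions to the algebra; together with \<open>is_fc_diff\<close> it shows that
  \<open>f\<close> determines \<open>x\<close>.\<close>

lemma is_fc_norm_le:
  assumes "is_fc e h c f x" and h: "projection e" "h \<in> corner e" "star h = h" "norm h < c"
    and M: "\<And>r. - c \<le> r \<Longrightarrow> r \<le> c \<Longrightarrow> cmod (f r) \<le> M"
  shows "norm x \<le> M"
proof (rule field_le_epsilon)
  fix d :: real assume d: "d > 0"
  obtain p where p: "uniform_limit {- c..c} (\<lambda>n r. poly (p n) (of_real r)) f sequentially"
    "(\<lambda>n. peval e h (p n)) \<longlonglongrightarrow> x" using assms unfolding is_fc_def by blast
  have "\<forall>\<^sub>F n in sequentially. norm (peval e h (p n)) \<le> M + d"
    using uniform_limitD[OF p(1) d]
  proof eventually_elim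
    case (elim n)
    show ?case
    proof (rule norm_peval_le_interval[OF h])
      fix r assume r: "- c \<le> r" "r \<le> c"
      then have "dist (poly (p n) (of_real r)) (f r) < d" using elim by simp
      then show "cmod (poly (p n) (of_real r)) \<le> M + d"
        using M[OF r] norm_triangle_sub[of "poly (p n) (of_real r)" "f r"] by (simp add: dist_norm)
    qed
  qed
  then show "norm x \<le> M + d"
    using tendsto_upperbound[OF tendsto_norm[OF p(2)]] by simp
qed

text \<open>Weierstrass approximations of \<open>f\<close> are uniformly Cauchy on the interval, and
  \<open>norm_peval_le_interval\<close> makes their values at \<open>h\<close> Cauchy in
  norm.\<close>

lemma is_fc_exists:
  fixes f :: "real \<Rightarrow> real"
  assumes h: "projection e" "h \<in> corner e" "star h = h" "norm h < c"
    and f: "continuous_on {- c..c} f" and D: "cstar_subalgebra D" "e \<in> D" "h \<in> D"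
  shows "\<exists>x\<in>D. is_fc e h c (\<lambda>r. complex_of_real (f r)) x"
proof -
  have "\<exists>p. \<forall>r\<in>{- c..c}. cmod (poly p (of_real r) - of_real (f r)) < inverse (real (Suc n))" for n
  proof -
    obtain g where g: "real_polynomial_function g" "\<And>r. r \<in> {- c..c} \<Longrightarrow> \<bar>f r - g r\<bar> < inverse (real (Suc n))"
      using Stone_Weierstrass_real_polynomial_function[OF compact_Icc f, of "inverse (real (Suc n))"] by auto
    obtain a k where ak: "g = (\<lambda>x. \<Sum>i\<le>k. a i * x ^ i)"
      using g(1) unfolding real_polynomial_function_iff_sum by blast
    have "poly (\<Sum>i\<le>k. monom (complex_of_real (a i)) i) (of_real r) = of_real (g r)" for r
      by (simp add: poly_sum poly_monom ak)
    then show ?thesis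
      using g(2) by (intro exI[of _ "\<Sum>i\<le>k. monom (complex_of_real (a i)) i"])
        (simp add: abs_minus_commute flip: of_real_diff)
  qed
  then obtain p where p: "\<And>n r. r \<in> {- c..c} \<Longrightarrow>
      cmod (poly (p n) (of_real r) - of_real (f r)) < inverse (real (Suc n))" by metis
  have lim: "uniform_limit {- c..c} (\<lambda>n r. poly (p n) (of_real r)) (\<lambda>r. complex_of_real (f r)) sequentially"
  proof (rule uniform_limitI)
    fix d :: real assume "d > 0"
    then obtain N where N: "inverse (real (Suc N)) < d" using reals_Archimedean by blast
    show "\<forall>\<^sub>F n in sequentially. \<forall>r\<in>{- c..c}. dist (poly (p n) (of_real r)) (of_real (f r)) < d"
      using eventually_ge_at_top[of N]
    proof eventually_elim
      case (elim n)
      have "inverse (real (Suc n)) \<le> inverse (real (Suc N))" using elim by (simp add: divide_simps)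
      show ?case
      proof
        fix r assume "r \<in> {- c..c}"
        from p[OF this, of n] N \<open>inverse (real (Suc n)) \<le> inverse (real (Suc N))\<close>
        show "dist (poly (p n) (of_real r)) (complex_of_real (f r)) < d"
          unfolding dist_norm by linarith
      qed
    qed
  qed
  have "Cauchy (\<lambda>n. peval e h (p n))"
  proof (rule metric_CauchyI)
    fix d :: real assume "d > 0"
    then have "\<forall>\<^sub>F n in sequentially. \<forall>r\<in>{- c..c}. dist (poly (p n) (of_real r)) (of_real (f r)) < d / 3"
      by (intro uniform_limitD[OF lim]) simp
    then obtain N where N: "\<And>n r. n \<ge> N \<Longrightarrow> r \<in> {- c..c} \<Longrightarrow>
        dist (poly (p n) (of_real r)) (of_real (f r)) < d / 3"
      unfolding eventually_sequentially by blast
    have "dist (peval e h (p k)) (peval e h (p l)) < d" if kl: "k \<ge> N" "l \<ge> N" for k l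
    proof -
      have "norm (peval e h (p k - p l)) \<le> 2 * d / 3"
      proof (rule norm_peval_le_interval[OF h])
        fix r assume "- c \<le> r" "r \<le> c"
        then have "dist (poly (p k) (of_real r)) (of_real (f r)) < d / 3"
          "dist (poly (p l) (of_real r)) (of_real (f r)) < d / 3" using N kl by auto
        then show "cmod (poly (p k - p l) (of_real r)) \<le> 2 * d / 3"
          using dist_triangle2[of "poly (p k) (of_real r)" "poly (p l) (of_real r)" "of_real (f r)"]
          by (simp add: dist_norm)
      qed
      then show ?thesis using \<open>d > 0\<close> by (simp add: dist_norm peval_diff)
    qed
    then show "\<exists>N. \<forall>k\<ge>N. \<forall>l\<ge>N. dist (peval e h (p k)) (peval e h (p l)) < d" by blast
  qed
  then obtain x where x: "(\<lambda>n. peval e h (p n)) \<longlonglongrightarrow> x"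
    using Cauchy_convergent_iff convergent_def by blast
  moreover have "x \<in> D"
    by (rule closed_csubspace_limit[OF cstar_subalgebraD(3)[OF D(1)] _ x]) (intro peval_in h D)
  ultimately show ?thesis using lim unfolding is_fc_def by blast
qed

lemma star_hom_peval:
  assumes "star_hom UNIV \<phi>"
  shows "\<phi> (peval e h p) = peval (\<phi> e) (\<phi> h) p"
proof (induction p)
  case 0
  then show ?case using star_homD(3)[OF assms, of 0 0] by simp
qed (simp add: peval_pCons star_homD[OF assms])

lemma bounded_linear_star_hom:
  assumes "star_hom UNIV \<phi>" "\<And>a. norm (\<phi> a) \<le> norm a"
  shows "bounded_linear \<phi>"
  by (rule bounded_linear_intro[where K = 1])
    (simp_all add: scaleR_scaleC_def star_homD[OF assms(1)] assms(2))

text \<open>If \<open>\<phi> h\<close> were shorter than \<open>h\<close>, the functional calculus would produce a nonzero element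
  \<open>h - clip h\<close> of the kernel.\<close>

lemma injective_star_hom_isometric:
  fixes \<phi> :: "'a::unital_cstar_algebra \<Rightarrow> 'b::cstar_algebra"
  assumes \<phi>: "star_hom UNIV \<phi>" and inj: "\<And>a. \<phi> a = 0 \<Longrightarrow> a = 0"
  shows "norm (\<phi> a) = norm a"
proof -
  have star1: "star 1 = (1 :: 'a)"
    by (metis mult.right_neutral star_mult star_star mult_1)
  have p1: "projection (1 :: 'a)" by (simp add: projection_def star1)
  have e: "projection (\<phi> 1)"
    by (simp add: projection_def star1 flip: star_homD[OF \<phi>])
  have con: "norm (\<phi> a) \<le> norm a" for a
    by (rule star_hom_contractive[OF cstar_subalgebra_UNIV \<phi>, of 1]) (simp_all add: star1)
  have sa: "norm h \<le> norm (\<phi> h)" if h: "star h = h" for h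
  proof (rule ccontr)
    assume "\<not> norm h \<le> norm (\<phi> h)"
    then obtain c where c: "norm (\<phi> h) < c" "c < norm h" using dense not_le by blast
    then have c0: "c > 0" using norm_ge_zero le_less_trans by blast
    \<comment> \<open>Two intervals are in play: \<open>c\<close> bounds \<open>\<phi> h\<close>,
      while \<open>d\<close> only has to exceed \<open>norm h\<close>, so that functions of
      \<open>h\<close> itself exist.\<close>
    define d where "d = norm h + 1"
    define g where "g x = x - max (- c) (min c x)" for x :: real
    have hc: "h \<in> corner 1" "norm h < d" "\<phi> h \<in> corner (\<phi> 1)" "star (\<phi> h) = \<phi> h"
      using h by (simp_all add: corner_def d_def flip: star_homD[OF \<phi>])
    obtain F where F: "is_fc 1 h d (\<lambda>r. complex_of_real (g r)) F"
      using is_fc_exists[OF p1 hc(1) h hc(2) _ cstar_subalgebra_UNIV, of g]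
      unfolding g_def by (fastforce intro!: continuous_intros)
    then obtain p where p: "uniform_limit {- d..d} (\<lambda>n r. poly (p n) (of_real r)) (\<lambda>r. complex_of_real (g r)) sequentially"
      "(\<lambda>n. peval 1 h (p n)) \<longlonglongrightarrow> F" unfolding is_fc_def by blast
    have "(\<lambda>n. \<phi> (peval 1 h (p n))) \<longlonglongrightarrow> \<phi> F"
      by (rule bounded_linear.tendsto[OF bounded_linear_star_hom[OF \<phi> con] p(2)])
    \<comment> \<open>The same polynomials, restricted to the smaller interval, compute the function
      of \<open>\<phi> h\<close>; there \<open>g\<close> is 0.\<close>
    moreover have "uniform_limit {- c..c} (\<lambda>n r. poly (p n) (of_real r)) (\<lambda>r. complex_of_real (g r)) sequentially"
      using c by (intro uniform_limit_on_subset[OF p(1)]) (auto simp: d_def)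
    ultimately have "is_fc (\<phi> 1) (\<phi> h) c (\<lambda>r. complex_of_real (g r)) (\<phi> F)"
      unfolding is_fc_def star_hom_peval[OF \<phi>] by blast
    then have "norm (\<phi> F) \<le> 0"
      by (rule is_fc_norm_le[OF _ e hc(3,4) c(1)]) (simp add: g_def)
    then have "F = 0" using inj by simp
    \<comment> \<open>Hence \<open>h\<close> equals its own clipping to \<open>{- c..c}\<close>,
      whose norm is at most \<open>c\<close>.\<close>
    with is_fc_diff[OF is_fc_id[OF p1 hc(1)] F]
    have "is_fc 1 h d (\<lambda>r. complex_of_real (r - g r)) h" by simp
    then have "norm h \<le> c"
      by (rule is_fc_norm_le[OF _ p1 hc(1) h hc(2)]) (use c0 in \<open>auto simp: g_def simp del: of_real_diff\<close>)
    then show False using c by simp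
  qed
  have "(norm a)\<^sup>2 \<le> (norm (\<phi> a))\<^sup>2"
    using sa[of "star a * a"] by (simp add: star_mult star_star cstar_identity star_homD[OF \<phi>])
  then have "norm a \<le> norm (\<phi> a)" by (rule power2_le_imp_le) simp
  then show ?thesis using con[of a] by simp
qed

section \<open>Matrix units on the Hilbert space of sequences\<close>

lemma bounded_linear_scaleC_left: "bounded_linear (\<lambda>c. c *\<^sub>C (x::'a::complex_normed_vector))"
  by (rule bounded_linear_intro[where K = "norm x"])
    (simp_all add: scaleC_add_left norm_scaleC scaleR_conv_of_real scaleR_scaleC_def scaleC_scaleC)

lift_definition trunc :: "nat \<Rightarrow> 'h::chilbert_space ell2 \<Rightarrow> 'h ell2" is
  "\<lambda>n f k. if k < n then f k else 0"
  by (rule summable_finite[of "{..<n}" for n]) auto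

lemma trunc_nth [simp]: "ell2_nth (trunc n v) k = (if k < n then ell2_nth v k else 0)"
  by transfer simp

lemma norm_sq_trunc: "(norm (trunc n v))\<^sup>2 = (\<Sum>k<n. (norm (ell2_nth v k))\<^sup>2)"
  unfolding norm_sq_ell2 by (subst suminf_finite[of "{..<n}"]) auto

lemma trunc_diff_orthogonal: "(norm v)\<^sup>2 = (norm (trunc n v))\<^sup>2 + (norm (v - trunc n v))\<^sup>2"
proof -
  have "cinner (trunc n v) (v - trunc n v) = 0"
    unfolding cinner_ell2_def by (subst suminf_finite[of "{}"]) auto
  then show ?thesis using norm_sq_add[of "trunc n v" "v - trunc n v"] by simp
qed

lemma norm_trunc_le: "norm (trunc n v) \<le> norm v"
proof (rule power2_le_imp_le)
  show "(norm (trunc n v))\<^sup>2 \<le> (norm v)\<^sup>2"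
    using trunc_diff_orthogonal[of v n] zero_le_power2[of "norm (v - trunc n v)"] by linarith
qed simp

lemma trunc_tendsto: "(\<lambda>n. trunc n v) \<longlonglongrightarrow> v"
proof -
  have "(\<lambda>n. (norm v)\<^sup>2 - (\<Sum>k<n. (norm (ell2_nth v k))\<^sup>2)) \<longlonglongrightarrow> (norm v)\<^sup>2 - (norm v)\<^sup>2"
    unfolding norm_sq_ell2[of v] by (intro tendsto_intros summable_LIMSEQ summable_ell2)
  moreover have "(norm v)\<^sup>2 - (\<Sum>k<n. (norm (ell2_nth v k))\<^sup>2) = (norm (v - trunc n v))\<^sup>2" for n
    using trunc_diff_orthogonal[of v n] by (simp add: norm_sq_trunc)
  ultimately have "(\<lambda>n. (norm (v - trunc n v))\<^sup>2) \<longlonglongrightarrow> 0" by simp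
  from tendsto_real_sqrt[OF this] have "(\<lambda>n. norm (v - trunc n v)) \<longlonglongrightarrow> 0" by simp
  then show ?thesis
    by (intro LIM_zero_cancel[where l = v] tendsto_norm_zero_cancel[where f = "\<lambda>n. trunc n v - v"])
      (simp add: norm_minus_commute)
qed

lift_definition ket :: "nat \<Rightarrow> complex ell2" is "\<lambda>i n. if n = i then 1 else 0"
  by (rule summable_finite[of "{i}" for i]) auto

lemma ket_nth [simp]: "ell2_nth (ket i) n = (if n = i then 1 else 0)"
  by transfer simp

lemma vtensor_nth [simp]: "ell2_nth (vtensor x \<xi>) n = ell2_nth \<xi> n *\<^sub>C x"
  by transfer simp

lemma trunc_eq_sum: "trunc n v = (\<Sum>j<n. vtensor (ell2_nth v j) (ket j))"
proof (induction n)
  case (Suc n)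
  have "trunc (Suc n) v = trunc n v + vtensor (ell2_nth v n) (ket n)"
    by (rule ell2_eqI) (auto simp: less_Suc_eq)
  then show ?case using Suc by simp
qed (auto intro: ell2_eqI)

lemma norm_vtensor: "norm (vtensor x \<xi>) = norm x * norm \<xi>"
proof -
  have "(\<Sum>n. (norm (ell2_nth (vtensor x \<xi>) n))\<^sup>2) = (\<Sum>n. (norm (ell2_nth \<xi> n))\<^sup>2 * (norm x)\<^sup>2)"
    by (simp add: norm_scaleC power_mult_distrib)
  also have "\<dots> = (\<Sum>n. (norm (ell2_nth \<xi> n))\<^sup>2) * (norm x)\<^sup>2"
    by (rule suminf_mult2[OF summable_ell2, symmetric])
  finally show ?thesis by (simp add: norm_ell2_def real_sqrt_mult mult.commute)
qed

lemma norm_ket [simp]: "norm (ket i) = 1"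
  unfolding norm_ell2_def by (subst suminf_finite[of "{i}"]) auto

lemma vtensor_add_left: "vtensor (x + y) \<xi> = vtensor x \<xi> + vtensor y \<xi>"
  by (rule ell2_eqI) (simp add: scaleC_add_right)

lemma vtensor_scaleC_left: "vtensor (c *\<^sub>C x) \<xi> = c *\<^sub>C vtensor x \<xi>"
  by (rule ell2_eqI) (simp add: scaleC_scaleC mult.commute)

lemma cinner_vtensor_ket: "cinner (vtensor x (ket i)) v = cinner x (ell2_nth v i)"
  unfolding cinner_ell2_def by (subst suminf_finite[of "{i}"]) auto

lemma cinner_ket: "cinner (ket i) v = ell2_nth v i"
  unfolding cinner_ell2_def by (subst suminf_finite[of "{i}"]) (auto simp: cinner_complex_def)

lemma scaleC_complex_eq [simp]: "c *\<^sub>C (x::complex) = c * x"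
  by (simp add: scaleC_complex_def)

lift_definition right_shift :: "complex ell2 \<Rightarrow> complex ell2" is
  "\<lambda>\<xi> n. case n of 0 \<Rightarrow> 0 | Suc k \<Rightarrow> \<xi> k"
  by (subst summable_Suc_iff[symmetric]) simp

lemma right_shift_nth: "ell2_nth (right_shift \<xi>) n = (case n of 0 \<Rightarrow> 0 | Suc k \<Rightarrow> ell2_nth \<xi> k)"
  by transfer simp

lemma star_left_shift: "bop_apply (star left_shift) \<xi> = right_shift \<xi>"
proof (rule cinner_ext)
  fix \<eta>
  have "cinner (right_shift \<xi>) \<eta> = cinner \<xi> (bop_apply left_shift \<eta>)"
    unfolding cinner_ell2_def
    using suminf_split_head[OF summable_cinner_ell2[of "right_shift \<xi>" \<eta>]]
    by (simp add: right_shift_nth)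
  then show "cinner (bop_apply (star left_shift) \<xi>) \<eta> = cinner (right_shift \<xi>) \<eta>"
    by (simp add: cinner_star_left)
qed

lemma star_one_bop [simp]: "star (1 :: 'h::chilbert_space bop) = 1"
  by (metis mult.right_neutral mult_1 star_mult star_star)

lemma star_power_bop: "star (t ^ n) = star t ^ n" for t :: "'h::chilbert_space bop"
  by (induction n) (simp_all add: star_mult power_commutes)

lemma left_shift_power_nth [simp]: "ell2_nth (bop_apply (left_shift ^ j) \<xi>) n = ell2_nth \<xi> (n + j)"
  by (induction j arbitrary: n) simp_all

lemma right_shift_power_nth [simp]:
  "ell2_nth (bop_apply (star left_shift ^ i) \<xi>) n = (if n < i then 0 else ell2_nth \<xi> (n - i))"
  by (induction i arbitrary: n) (auto simp: star_left_shift right_shift_nth split: nat.split)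

text \<open>Written through the shift, which puts it into \<open>toeplitz\<close> at once: the
  middle factor is the projection onto the first basis vector.\<close>

definition munit :: "nat \<Rightarrow> nat \<Rightarrow> complex ell2 bop" where
  "munit i j = star left_shift ^ i * (1 - star left_shift * left_shift) * left_shift ^ j"

lemma munit_nth [simp]:
  "ell2_nth (bop_apply (munit i j) \<xi>) n = (if n = i then ell2_nth \<xi> j else 0)"
  by (cases "n - i") (auto simp: munit_def star_left_shift right_shift_nth split: nat.split)

lemma munit_apply: "bop_apply (munit i j) \<xi> = ell2_nth \<xi> j *\<^sub>C ket i"
  by (rule ell2_eqI) simp

lemma bop_eqI_nth: "(\<And>\<xi> n. ell2_nth (bop_apply s \<xi>) n = ell2_nth (bop_apply t \<xi>) n) \<Longrightarrow> s = t"
  by (intro bop_eqI ell2_eqI)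

lemma munit_mult: "munit i j * munit k l = (if j = k then munit i l else 0)"
  by (rule bop_eqI_nth) simp

lemma star_munit [simp]: "star (munit i j) = munit j i"
  by (simp add: munit_def star_mult star_power_bop star_diff star_star mult.assoc)

definition bop_entry :: "complex ell2 bop \<Rightarrow> nat \<Rightarrow> nat \<Rightarrow> complex" where
  "bop_entry t i j = ell2_nth (bop_apply t (ket j)) i"

lemma munit_compress: "munit i j * t * munit k l = bop_entry t j k *\<^sub>C munit i l"
  by (rule bop_eqI_nth) (simp add: munit_apply bop_apply_scaleC bop_entry_def mult.commute)

lemma bop_entry_munit [simp]: "bop_entry (munit i j) k l = (if k = i \<and> l = j then 1 else 0)"
  by (auto simp: bop_entry_def)

lemma bop_apply_sums:
  "(\<lambda>j. bop_entry t i j * ell2_nth \<xi> j) sums ell2_nth (bop_apply t \<xi>) i"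
proof -
  interpret t: bounded_linear "bop_apply t" by (rule bounded_linear_bop_apply)
  have "(\<lambda>n. cinner (ket i) (bop_apply t (trunc n \<xi>))) \<longlonglongrightarrow> cinner (ket i) (bop_apply t \<xi>)"
    by (intro bounded_linear.tendsto[OF bounded_linear_cinner_right] t.tendsto trunc_tendsto)
  moreover have "vtensor c (ket j) = c *\<^sub>C ket j" for c :: complex and j
    by (rule ell2_eqI) simp
  then have "bop_apply t (trunc n \<xi>) = (\<Sum>j<n. ell2_nth \<xi> j *\<^sub>C bop_apply t (ket j))" for n
    by (simp add: trunc_eq_sum t.sum bop_apply_scaleC)
  ultimately have "(\<lambda>n. \<Sum>j<n. ell2_nth \<xi> j * ell2_nth (bop_apply t (ket j)) i) \<longlonglongrightarrow> ell2_nth (bop_apply t \<xi>) i"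
    by (simp add: bounded_linear.linear linear_sum[OF bounded_linear.linear[OF bounded_linear_cinner_right]] cinner_scaleC_right cinner_ket)
  then show ?thesis by (simp add: sums_def bop_entry_def mult.commute)
qed

definition pr :: "nat \<Rightarrow> complex ell2 bop" where "pr n = (\<Sum>i<n. munit i i)"

lemma bop_apply_sum: "bop_apply (sum f A) x = (\<Sum>i\<in>A. bop_apply (f i) x)"
  by (induction A rule: infinite_finite_induct) simp_all

lemma ell2_nth_sum: "ell2_nth (sum f A) n = (\<Sum>i\<in>A. ell2_nth (f i) n)"
  by (induction A rule: infinite_finite_induct) simp_all

lemma pr_apply: "bop_apply (pr n) \<xi> = trunc n \<xi>"
proof (rule ell2_eqI)
  fix k
  have "(\<Sum>i<n. if k = i then ell2_nth \<xi> i else 0) = (if k < n then ell2_nth \<xi> k else 0)"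
    by (simp add: sum.delta')
  then show "ell2_nth (bop_apply (pr n) \<xi>) k = ell2_nth (trunc n \<xi>) k"
    by (simp add: pr_def bop_apply_sum ell2_nth_sum)
qed

lemma left_right_shift_power: "left_shift ^ m * star left_shift ^ m = 1"
  by (rule bop_eqI_nth) simp

lemma right_left_shift_power: "star left_shift ^ m * left_shift ^ m = 1 - pr m"
  by (rule bop_eqI_nth) (simp add: pr_apply)

lemma right_shift_munit: "star left_shift ^ m * munit i j = munit (i + m) j"
  by (rule bop_eqI_nth) auto

lemma toeplitz_subalgebra: "cstar_subalgebra toeplitz"
  unfolding toeplitz_def by (rule cstar_subalgebra_hull)

lemmas toeplitz_closed = cstar_subalgebra_csubspaceD[OF toeplitz_subalgebra]
  cstar_subalgebraD(4,5)[OF toeplitz_subalgebra]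

lemma left_shift_in_toeplitz: "left_shift \<in> toeplitz"
  unfolding toeplitz_def by (rule hull_inc) simp

lemma one_in_toeplitz: "1 \<in> toeplitz"
proof -
  have "left_shift * star left_shift \<in> toeplitz"
    by (rule toeplitz_closed(7)[OF left_shift_in_toeplitz toeplitz_closed(8)[OF left_shift_in_toeplitz]])
  then show ?thesis using left_right_shift_power[of 1] by simp
qed

lemma power_in_toeplitz: "t \<in> toeplitz \<Longrightarrow> t ^ n \<in> toeplitz"
  by (induction n) (auto intro: one_in_toeplitz toeplitz_closed)

lemma munit_in_toeplitz: "munit i j \<in> toeplitz"
  unfolding munit_def
  by (intro toeplitz_closed power_in_toeplitz left_shift_in_toeplitz one_in_toeplitz)

section \<open>Norm-closed subspaces that contain the matrix units\<close>

lemma munit_compact: "munit i j \<in> compact_operators"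
proof -
  let ?C = "(\<lambda>c. c *\<^sub>C ket i) ` cball (0::complex) 1"
  have "bop_apply (munit i j) ` cball 0 1 \<subseteq> ?C"
  proof
    fix y assume "y \<in> bop_apply (munit i j) ` cball 0 1"
    then obtain \<xi> where \<xi>: "norm \<xi> \<le> 1" "y = bop_apply (munit i j) \<xi>" by auto
    have "ell2_nth \<xi> j \<in> cball 0 1" using \<xi>(1) norm_ell2_nth_le[of \<xi> j] by simp
    then show "y \<in> ?C" unfolding \<xi>(2) munit_apply by (rule imageI)
  qed
  moreover have C: "compact ?C"
    by (intro compact_continuous_image compact_cball
        linear_continuous_on bounded_linear_scaleC_left)
  ultimately have "closure (bop_apply (munit i j) ` cball 0 1) \<subseteq> ?C"
    by (intro closure_minimal compact_imp_closed)
  then have "compact (?C \<inter> closure (bop_apply (munit i j) ` cball 0 1))"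
    by (intro compact_Int_closed C) simp
  then show ?thesis using \<open>closure _ \<subseteq> ?C\<close> by (simp add: compact_operators_def Int_absorb1)
qed

context
  fixes M :: "complex ell2 bop set"
  assumes M: "closed_csubspace M" and mu: "\<And>i j. munit i j \<in> M"
begin

text \<open>Multiplying by \<open>pr n\<close> only truncates the fixed vector \<open>x\<close>. The
  error is \<open>norm (trunc n x - x)\<close> uniformly on the unit ball, so a finite combination
  of matrix units approximates \<open>t\<close> in norm.\<close>

lemma rank_one_in_closed_subspace:
  assumes "\<And>\<xi>. bop_apply t \<xi> = f \<xi> *\<^sub>C x" "\<And>\<xi>. f \<xi> = ell2_nth \<xi> j"
  shows "t \<in> M"
proof -
  have "pr n * t \<in> M" for n
  proof -
    have "pr n * t = (\<Sum>i<n. ell2_nth x i *\<^sub>C munit i j)"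
    proof (rule bop_eqI_nth)
      fix \<xi> k
      have "(\<Sum>i<n. if k = i then ell2_nth x i * ell2_nth \<xi> j else 0) = (if k < n then ell2_nth x k * ell2_nth \<xi> j else 0)"
        by (simp add: sum.delta')
      then show "ell2_nth (bop_apply (pr n * t) \<xi>) k = ell2_nth (bop_apply (\<Sum>i<n. ell2_nth x i *\<^sub>C munit i j) \<xi>) k"
        using assms(2)[of \<xi>]
        by (simp add: pr_apply assms bop_apply_sum ell2_nth_sum mult.commute if_distrib cong: if_cong)
    qed
    then show ?thesis using mu closed_csubspaceD[OF M] by (auto intro: csubspace_sum csubspaceD)
  qed
  moreover have "(\<lambda>n. pr n * t) \<longlonglongrightarrow> t"
  proof (rule LIM_zero_cancel, rule Lim_null_comparison)
    show "\<forall>\<^sub>F n in sequentially. norm (pr n * t - t) \<le> norm (trunc n x - x)"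
    proof (intro always_eventually allI norm_bop_leI)
      fix n \<xi>
      have "bop_apply (pr n * t - t) \<xi> = f \<xi> *\<^sub>C (trunc n x - x)"
        by (rule ell2_eqI) (auto simp: pr_apply assms(1) algebra_simps)
      then show "norm (bop_apply (pr n * t - t) \<xi>) \<le> norm (trunc n x - x) * norm \<xi>"
        using norm_ell2_nth_le[of \<xi> j] by (simp add: norm_scaleC assms(2) mult.commute[of _ "norm \<xi>"] mult_right_mono)
    qed simp
    show "(\<lambda>n. norm (trunc n x - x)) \<longlonglongrightarrow> 0"
      using LIM_zero[OF trunc_tendsto[of x]] by (rule tendsto_norm_zero)
  qed
  ultimately show ?thesis by (rule closed_csubspace_limit[OF M])
qed

lemma mult_munit_in_closed_subspace: "t * munit i j \<in> M"
  by (rule rank_one_in_closed_subspace[where f = "\<lambda>\<xi>. ell2_nth \<xi> j" and x = "bop_apply t (ket i)"])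
    (simp_all add: munit_apply bop_apply_scaleC)

end

lemma munit_mult_in_closed_subspace:
  assumes "closed_csubspace M" "\<And>i j. munit i j \<in> M"
  shows "munit i j * t \<in> M"
proof -
  have "closed_csubspace {x. star x \<in> M}"
    using closed_csubspaceD[OF assms(1)] closed_csubspace_limit[OF assms(1) _ tendsto_star]
    by (intro closed_csubspaceI) (auto simp: star_add star_scaleC csubspaceD)
  from mult_munit_in_closed_subspace[OF this, of "star t" j i] show ?thesis
    using assms(2) by (simp add: star_mult star_star)
qed

text \<open>The contractions \<open>trunc n\<close> converge pointwise to the identity, hence
  uniformly on the totally bounded image of the unit ball. So \<open>pr n * k\<close> converges to
  \<open>k\<close> in norm, not only strongly.\<close>

lemma compact_in_closed_subspace:
  assumes M: "closed_csubspace M" "\<And>i j. munit i j \<in> M" and k: "k \<in> compact_operators"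
  shows "k \<in> M"
proof (rule closed_csubspace_limit[OF M(1)])
  show "pr n * k \<in> M" for n
    unfolding pr_def sum_distrib_right
    by (intro csubspace_sum closed_csubspaceD[OF M(1)] munit_mult_in_closed_subspace M)
  show "(\<lambda>n. pr n * k) \<longlonglongrightarrow> k"
  proof (rule metric_LIMSEQ_I)
    fix d :: real assume d: "d > 0"
    define C where "C = closure (bop_apply k ` cball 0 1)"
    have "compact C" using k by (simp add: C_def compact_operators_def)
    \<comment> \<open>Three errors of \<open>d / 6\<close> give \<open>d / 2\<close> on the unit
      ball; the slack keeps the inequality strict after the supremum.\<close>
    moreover have "d / 6 > 0" using d by simp
    ultimately obtain F where F: "finite F" "C \<subseteq> (\<Union>y\<in>F. ball y (d / 6))"
      unfolding compact_eq_totally_bounded by blast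
    have "\<forall>y\<in>F. \<forall>\<^sub>F n in sequentially. dist (trunc n y) y < d / 6"
      by (intro ballI tendstoD[OF trunc_tendsto] \<open>d / 6 > 0\<close>)
    then have "\<forall>\<^sub>F n in sequentially. \<forall>y\<in>F. dist (trunc n y) y < d / 6"
      using F(1) by (simp add: eventually_ball_finite)
    then obtain N where N: "\<And>n y. n \<ge> N \<Longrightarrow> y \<in> F \<Longrightarrow> dist (trunc n y) y < d / 6"
      unfolding eventually_sequentially by blast
    have "dist (pr n * k) k < d" if n: "n \<ge> N" for n
    proof -
      have unit: "norm (bop_apply (pr n * k - k) \<xi>) \<le> d / 2" if \<xi>: "norm \<xi> \<le> 1" for \<xi>
      proof -
        have "bop_apply k \<xi> \<in> C" unfolding C_def using \<xi> by (intro subsetD[OF closure_subset]) auto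
        then obtain y where y: "y \<in> F" "dist y (bop_apply k \<xi>) < d / 6" using F(2) by auto
        have "trunc n (bop_apply k \<xi>) - bop_apply k \<xi>
            = trunc n (bop_apply k \<xi> - y) + (trunc n y - y) + (y - bop_apply k \<xi>)"
          by (rule ell2_eqI) simp
        then have "norm (bop_apply (pr n * k - k) \<xi>) \<le> norm (trunc n (bop_apply k \<xi> - y)) + norm (trunc n y - y) + norm (y - bop_apply k \<xi>)"
          using norm_triangle_ineq[of "trunc n (bop_apply k \<xi> - y) + (trunc n y - y)" "y - bop_apply k \<xi>"]
            norm_triangle_ineq[of "trunc n (bop_apply k \<xi> - y)" "trunc n y - y"]
          by (simp add: pr_apply)
        then show ?thesis
          using norm_trunc_le[of n "bop_apply k \<xi> - y"] y N[OF n y(1)]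
          by (simp add: dist_norm norm_minus_commute)
      qed
      have "norm (pr n * k - k) \<le> d / 2"
      proof (rule norm_bop_leI)
        fix \<xi>
        interpret bounded_linear "bop_apply (pr n * k - k)" by (rule bounded_linear_bop_apply)
        show "norm (bop_apply (pr n * k - k) \<xi>) \<le> d / 2 * norm \<xi>"
        proof (cases "\<xi> = 0")
          case False
          have "norm (bop_apply (pr n * k - k) ((1 / norm \<xi>) *\<^sub>R \<xi>)) \<le> d / 2"
            using False by (intro unit) simp
          then show ?thesis using False by (simp only: scaleR) (simp add: divide_simps mult.commute)
        next
          case True
          then show ?thesis by (simp only: zero) simp
        qed
      qed (use d in simp)
      then show ?thesis using d by (simp add: dist_norm)
    qed
    then show "\<exists>N. \<forall>n\<ge>N. dist (pr n * k) k < d" by blast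
  qed
qed

lemma compact_in_toeplitz: "k \<in> compact_operators \<Longrightarrow> k \<in> toeplitz"
  by (rule compact_in_closed_subspace[OF cstar_subalgebraD(3)[OF toeplitz_subalgebra] munit_in_toeplitz])

section \<open>The tensor product with the Toeplitz algebra\<close>

lemma star_one [simp]: "star (1 :: 'a::unital_cstar_algebra) = 1"
  by (metis mult.right_neutral star_mult star_star mult_1)

locale toeplitz_tensor =
  fixes \<tau> :: "'a::unital_cstar_algebra \<Rightarrow> complex ell2 bop \<Rightarrow> 'b::cstar_algebra"
  assumes tensor: "is_cstar_tensor UNIV toeplitz UNIV \<tau>"
begin

lemma tau_add_left: "t \<in> toeplitz \<Longrightarrow> \<tau> (a + b) t = \<tau> a t + \<tau> b t"
  and tau_scaleC_left: "t \<in> toeplitz \<Longrightarrow> \<tau> (c *\<^sub>C a) t = c *\<^sub>C \<tau> a t"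
  and tau_add_right: "s \<in> toeplitz \<Longrightarrow> t \<in> toeplitz \<Longrightarrow> \<tau> a (s + t) = \<tau> a s + \<tau> a t"
  and tau_scaleC_right: "t \<in> toeplitz \<Longrightarrow> \<tau> a (c *\<^sub>C t) = c *\<^sub>C \<tau> a t"
  and tau_mult: "s \<in> toeplitz \<Longrightarrow> t \<in> toeplitz \<Longrightarrow> \<tau> a s * \<tau> b t = \<tau> (a * b) (s * t)"
  and tau_star: "t \<in> toeplitz \<Longrightarrow> star (\<tau> a t) = \<tau> (star a) (star t)"
  using tensor by (simp_all add: is_cstar_tensor_def)

lemma tau_zero_right [simp]: "\<tau> a 0 = 0"
  using tau_scaleC_right[OF toeplitz_closed(1), of a 0] by simp

lemma tau_diff_right: "s \<in> toeplitz \<Longrightarrow> t \<in> toeplitz \<Longrightarrow> \<tau> a (s - t) = \<tau> a s - \<tau> a t"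
  using tau_add_right[of "s - t" t a] by (simp add: toeplitz_closed)

text \<open>The case \<open>n = 1\<close> of the injectivity clause: a single nonzero
  \<open>t\<close> forms a linearly independent family.\<close>

lemma tau_injective:
  assumes "t \<in> toeplitz" "t \<noteq> 0" "\<tau> a t = 0" shows "a = 0"
proof -
  have "\<forall>n (a :: nat \<Rightarrow> 'a) t. (\<forall>i<n. a i \<in> UNIV \<and> t i \<in> toeplitz) \<and>
        (\<forall>c :: nat \<Rightarrow> complex. (\<Sum>i<n. c i *\<^sub>C t i) = 0 \<longrightarrow> (\<forall>i<n. c i = 0)) \<and>
        (\<Sum>i<n. \<tau> (a i) (t i)) = 0 \<longrightarrow> (\<forall>i<n. a i = 0)"
    using tensor unfolding is_cstar_tensor_def by (elim conjE)
  from this[rule_format, of 1 "\<lambda>_. a" "\<lambda>_. t" 0] show ?thesis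
  proof
    have "c = 0" if "c *\<^sub>C t = 0" for c
      using that assms(2) norm_scaleC[of c t] by simp
    then show "(\<forall>i<1. a \<in> UNIV \<and> t \<in> toeplitz) \<and>
        (\<forall>c :: nat \<Rightarrow> complex. (\<Sum>i<1. c i *\<^sub>C t) = 0 \<longrightarrow> (\<forall>i<1. c i = 0)) \<and> (\<Sum>i<(1::nat). \<tau> a t) = 0"
      using assms by simp
  qed simp_all
qed

lemma tau_dense:
  assumes "closed_csubspace M" "\<And>a t. t \<in> toeplitz \<Longrightarrow> \<tau> a t \<in> M"
  shows "x \<in> M"
proof -
  have "UNIV = closure (csubspace hull {\<tau> a t | a t. a \<in> UNIV \<and> t \<in> toeplitz})"
    using tensor unfolding is_cstar_tensor_def by (elim conjE)
  also have "\<dots> \<subseteq> M"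
  proof (intro closure_minimal hull_minimal)
    show "{\<tau> a t | a t. a \<in> UNIV \<and> t \<in> toeplitz} \<subseteq> M" using assms(2) by blast
  qed (rule closed_csubspaceD[OF assms(1)])+
  finally show ?thesis by blast
qed

definition unit :: 'b where "unit = \<tau> 1 1"

text \<open>\<open>unit\<close> fixes elementary tensors from both sides, and its corner is a closed
  subspace, so density settles the rest.\<close>

lemma unit_mult: "unit * x = x" "x * unit = x"
proof -
  have "projection unit"
    by (simp add: projection_def unit_def tau_star tau_mult one_in_toeplitz)
  from cstar_subalgebraD(3)[OF cstar_subalgebra_corner[OF this]]
  have "x \<in> corner unit"
  proof (rule tau_dense)
    fix a t assume "t \<in> toeplitz"
    then show "\<tau> a t \<in> corner unit" by (simp add: corner_def unit_def tau_mult one_in_toeplitz)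
  qed
  then show "unit * x = x" "x * unit = x" by (simp_all only: cornerD)
qed

lemma star_unit [simp]: "star unit = unit"
  by (simp add: unit_def tau_star one_in_toeplitz)

lemma projection_unit: "projection unit" "x \<in> corner unit"
  by (simp_all add: projection_def corner_def unit_mult)

lemma norm_tau_one_le: "t \<in> toeplitz \<Longrightarrow> norm (\<tau> 1 t) \<le> norm t"
  by (rule star_hom_contractive[OF toeplitz_subalgebra, of "\<tau> 1" 1])
    (auto simp: star_hom_def tau_add_right tau_scaleC_right tau_mult tau_star one_in_toeplitz)

text \<open>Continuity in \<open>t\<close> for fixed \<open>a\<close> is what matters later, so
  \<open>norm (\<tau> a 1)\<close> may stay as a constant. The factorization through
  \<open>\<tau> 1 t\<close> reduces the claim to a unital star homomorphism on
  \<open>toeplitz\<close>.\<close>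

lemma norm_tau_le: "t \<in> toeplitz \<Longrightarrow> norm (\<tau> a t) \<le> norm (\<tau> a 1) * norm t"
proof -
  assume t: "t \<in> toeplitz"
  then have "\<tau> a t = \<tau> a 1 * \<tau> 1 t" by (simp add: tau_mult one_in_toeplitz)
  then have "norm (\<tau> a t) \<le> norm (\<tau> a 1) * norm (\<tau> 1 t)" by (simp add: norm_mult_ineq)
  also have "\<dots> \<le> norm (\<tau> a 1) * norm t" by (intro mult_left_mono norm_tau_one_le t) simp
  finally show ?thesis .
qed

lemma tau_tendsto:
  assumes X: "\<And>n. X n \<in> toeplitz" "X \<longlonglongrightarrow> t"
  shows "(\<lambda>n. \<tau> a (X n)) \<longlonglongrightarrow> \<tau> a t"
proof (rule LIM_zero_cancel, rule Lim_null_comparison)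
  have t: "t \<in> toeplitz"
    by (rule closed_csubspace_limit[OF cstar_subalgebraD(3)[OF toeplitz_subalgebra] X])
  show "\<forall>\<^sub>F n in sequentially. norm (\<tau> a (X n) - \<tau> a t) \<le> norm (\<tau> a 1) * norm (X n - t)"
    using X t by (intro always_eventually allI)
      (simp add: norm_tau_le toeplitz_closed flip: tau_diff_right)
  have "(\<lambda>n. norm (\<tau> a 1) * norm (X n - t)) \<longlonglongrightarrow> norm (\<tau> a 1) * norm (t - t)"
    by (intro tendsto_intros X)
  then show "(\<lambda>n. norm (\<tau> a 1) * norm (X n - t)) \<longlonglongrightarrow> 0" by simp
qed

definition eps :: "nat \<Rightarrow> nat \<Rightarrow> 'b" where "eps i j = \<tau> 1 (munit i j)"

lemma eps_mult: "eps i j * eps k l = (if j = k then eps i l else 0)"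
  by (simp add: eps_def tau_mult munit_in_toeplitz munit_mult)

lemma star_eps [simp]: "star (eps i j) = eps j i"
  by (simp add: eps_def tau_star munit_in_toeplitz)

lemma norm_munit_le: "norm (munit i j) \<le> 1"
  using norm_ell2_nth_le by (intro norm_bop_leI) (simp_all add: munit_apply norm_scaleC)

lemma norm_eps_le: "norm (eps i j) \<le> 1"
  unfolding eps_def using norm_tau_one_le[OF munit_in_toeplitz] norm_munit_le order_trans by blast

definition proj :: "nat \<Rightarrow> 'b" where "proj n = (\<Sum>i<n. eps i i)"

lemma proj_eps: "proj n * eps i j = (if i < n then eps i j else 0)"
  by (simp add: proj_def sum_distrib_right eps_mult sum.delta')

lemma star_proj [simp]: "star (proj n) = proj n"
  by (simp add: proj_def star_sum)

lemma pr_in_toeplitz: "pr n \<in> toeplitz"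
  unfolding pr_def by (intro csubspace_sum cstar_subalgebraD[OF toeplitz_subalgebra] munit_in_toeplitz)

lemma proj_eq_tau: "proj n = \<tau> 1 (pr n)"
proof (induction n)
  case (Suc n)
  then show ?case
    using tau_add_right[OF pr_in_toeplitz[of n] munit_in_toeplitz[of n n], of 1]
    by (simp add: proj_def pr_def eps_def)
qed (simp add: proj_def pr_def)

lemma norm_proj_le: "norm (proj n) \<le> 1"
proof -
  have "norm (pr n) \<le> 1" by (rule norm_bop_leI) (simp_all add: pr_apply norm_trunc_le)
  then show ?thesis using norm_tau_one_le[OF pr_in_toeplitz, of n] by (simp add: proj_eq_tau)
qed

section \<open>The corner at the first matrix unit, and matrix entries\<close>

definition phi :: "'a \<Rightarrow> 'b" where "phi a = \<tau> a (munit 0 0)"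

lemma star_hom_phi: "star_hom UNIV phi"
  by (simp add: star_hom_def phi_def tau_add_left tau_scaleC_left tau_mult tau_star munit_in_toeplitz munit_mult)

lemma munit_nonzero: "munit i j \<noteq> 0"
proof
  assume "munit i j = 0"
  then have "ell2_nth (bop_apply (munit i j) (ket j)) i = 0" by simp
  then show False by simp
qed

lemma norm_phi [simp]: "norm (phi a) = norm a"
  by (rule injective_star_hom_isometric[OF star_hom_phi])
    (auto simp: phi_def intro: tau_injective[OF munit_in_toeplitz munit_nonzero])

lemma phi_add: "phi (a + b) = phi a + phi b" and phi_mult: "phi (a * b) = phi a * phi b"
  and phi_scaleC: "phi (c *\<^sub>C a) = c *\<^sub>C phi a" and phi_star: "phi (star a) = star (phi a)"
  using star_homD[OF star_hom_phi] by simp_all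

lemma phi_diff: "phi (a - b) = phi a - phi b"
  using phi_add[of "a - b" b] by simp

lemma phi_zero [simp]: "phi 0 = 0"
  using phi_diff[of 0 0] by simp

lemma phi_one: "phi 1 = eps 0 0"
  by (simp add: phi_def eps_def)

lemma phi_inject: "phi a = phi b \<longleftrightarrow> a = b"
  using norm_phi[of "a - b"] by (auto simp: phi_diff)

lemma phi_sum: "phi (sum f A) = (\<Sum>i\<in>A. phi (f i))"
  by (induction A rule: infinite_finite_induct) (simp_all add: phi_add)

text \<open>An isometric image of a complete space is complete. Closedness lets the compression of a
  limit of tensors be recognized as an element of \<open>'a\<close>.\<close>

lemma closed_range_phi: "closed_csubspace (range phi)"
proof (rule closed_csubspaceI)
  fix X x assume X: "\<And>n. X n \<in> range phi" "X \<longlonglongrightarrow> x"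
  then obtain f where f: "\<And>n. X n = phi (f n)" unfolding image_def by auto metis
  have "Cauchy X" using X(2) by (auto intro: LIMSEQ_imp_Cauchy)
  then have "Cauchy f"
    by (simp add: Cauchy_def f dist_norm flip: phi_diff)
  then obtain a where a: "f \<longlonglongrightarrow> a" using Cauchy_convergent_iff convergent_def by blast
  have "X \<longlonglongrightarrow> phi a"
    unfolding f by (rule bounded_linear.tendsto[OF bounded_linear_star_hom[OF star_hom_phi] a]) simp
  then show "x \<in> range phi" using X(2) LIMSEQ_unique by blast
qed (auto simp: phi_add[symmetric] phi_scaleC[symmetric] intro: range_eqI[of _ _ 0])

text \<open>The compression lies in the corner of \<open>eps 0 0\<close>, which is the range of \<open>phi\<close>, so the inverse
  is meaningful.\<close>

definition entry :: "'b \<Rightarrow> nat \<Rightarrow> nat \<Rightarrow> 'a" where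
  "entry b i j = inv phi (eps 0 i * b * eps j 0)"

text \<open>For an elementary tensor the compression is \<open>phi\<close> of a scalar multiple of
  \<open>a\<close>; density and the closed range of \<open>phi\<close> extend this to every
  \<open>b\<close>.\<close>

lemma phi_entry: "phi (entry b i j) = eps 0 i * b * eps j 0"
proof -
  have "b \<in> {b \<in> UNIV. eps 0 i * b * eps j 0 \<in> range phi}"
  proof (rule tau_dense[OF closed_csubspace_preimage[OF bounded_clinear_on_mult(3) closed_range_phi]])
    fix a t assume t: "t \<in> toeplitz"
    then have "eps 0 i * \<tau> a t * eps j 0 = phi (bop_entry t i j *\<^sub>C a)"
      by (simp add: eps_def tau_mult toeplitz_closed munit_in_toeplitz munit_compress
          tau_scaleC_right phi_def tau_scaleC_left)
    then show "\<tau> a t \<in> {b \<in> UNIV. eps 0 i * b * eps j 0 \<in> range phi}" by simp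
  qed
  then show ?thesis by (simp add: entry_def f_inv_into_f)
qed

lemma entryI: "eps 0 i * b * eps j 0 = phi a \<Longrightarrow> entry b i j = a"
  using phi_entry[of b i j] by (simp add: phi_inject)

lemma entry_add: "entry (b + d) i j = entry b i j + entry d i j"
  by (rule entryI) (simp add: phi_add phi_entry distrib_left distrib_right)

lemma entry_scaleC: "entry (c *\<^sub>C b) i j = c *\<^sub>C entry b i j"
  by (rule entryI) (simp add: phi_scaleC phi_entry mult_scaleC_left mult_scaleC_right)

lemma entry_tau: "t \<in> toeplitz \<Longrightarrow> entry (\<tau> a t) i j = bop_entry t i j *\<^sub>C a"
  by (rule entryI) (simp add: eps_def tau_mult toeplitz_closed munit_in_toeplitz munit_compress
          tau_scaleC_right phi_def tau_scaleC_left)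

lemma entry_unit: "entry unit i j = (if i = j then 1 else 0)"
  by (simp add: unit_def entry_tau one_in_toeplitz bop_entry_def)

lemma norm_mult_eps_le: "norm (b * eps i j) \<le> norm b" "norm (eps i j * b) \<le> norm b"
  using norm_mult_ineq[of b "eps i j"] norm_mult_ineq[of "eps i j" b]
    mult_left_mono[OF norm_eps_le[of i j] norm_ge_zero[of b]]
  by (simp_all add: mult.commute)

lemma norm_entry_le: "norm (entry b i j) \<le> norm b"
  using norm_mult_eps_le order_trans by (metis norm_phi phi_entry)

section \<open>The ideal of compact matrices over the coefficient algebra\<close>

definition ideal :: "'b set" where "ideal = closed_csubspace hull {\<tau> a (munit i j) | a i j. True}"

lemma closed_ideal: "closed_csubspace ideal"
  unfolding ideal_def by (rule closed_csubspace_hull)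

lemmas ideal_closed = csubspaceD[OF closed_csubspaceD(1)[OF closed_ideal]]

lemma tau_munit_in_ideal: "\<tau> a (munit i j) \<in> ideal"
  unfolding ideal_def by (rule hull_inc) blast

lemma ideal_subset:
  assumes "closed_csubspace M" "\<And>a i j. \<tau> a (munit i j) \<in> M"
  shows "ideal \<subseteq> M"
  unfolding ideal_def using assms by (intro hull_minimal) auto

lemma closed_tau_preimage_ideal: "closed_csubspace {t \<in> toeplitz. \<tau> a t \<in> ideal}"
proof (rule closed_csubspaceI)
  fix X t assume X: "\<And>n. X n \<in> {t \<in> toeplitz. \<tau> a t \<in> ideal}" "X \<longlonglongrightarrow> t"
  then have "t \<in> toeplitz"
    by (intro closed_csubspace_limit[OF cstar_subalgebraD(3)[OF toeplitz_subalgebra] _ X(2)]) auto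
  moreover have "\<tau> a t \<in> ideal"
    using X by (intro closed_csubspace_limit[OF closed_ideal _ tau_tendsto[OF _ X(2)]]) auto
  ultimately show "t \<in> {t \<in> toeplitz. \<tau> a t \<in> ideal}" by simp
qed (auto simp: toeplitz_closed tau_add_right tau_scaleC_right ideal_closed)

text \<open>\<open>ideal\<close> is spanned by matrix units alone, which leaves few generators to
  check. This lemma identifies it with the full A \<otimes> K, as compact operators are norm limits
  of combinations of matrix units and \<open>\<tau> a\<close> is continuous.\<close>

lemma tau_compact_in_ideal: "k \<in> compact_operators \<Longrightarrow> \<tau> a k \<in> ideal"
  using compact_in_closed_subspace[OF closed_tau_preimage_ideal, of a k]
  by (simp add: munit_in_toeplitz tau_munit_in_ideal)

text \<open>Two density arguments, first in the factor from the ideal and then in \<open>b\<close>.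
  On generators \<open>t * munit i j\<close> has rank one but possibly infinitely many nonzero
  entries, so it is reached only in the closure.\<close>

lemma ideal_mult_left: "x \<in> ideal \<Longrightarrow> b * x \<in> ideal"
proof -
  assume x: "x \<in> ideal"
  have tau: "ideal \<subseteq> {y \<in> UNIV. \<tau> a t * y \<in> ideal}" if t: "t \<in> toeplitz" for a t
  proof (rule ideal_subset[OF closed_csubspace_preimage[OF bounded_clinear_on_mult(1) closed_ideal]])
    fix b i j
    have "t * munit i j \<in> {t \<in> toeplitz. \<tau> (a * b) t \<in> ideal}"
      by (rule mult_munit_in_closed_subspace[OF closed_tau_preimage_ideal])
        (simp add: munit_in_toeplitz tau_munit_in_ideal)
    then show "\<tau> b (munit i j) \<in> {y \<in> UNIV. \<tau> a t * y \<in> ideal}"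
      by (simp add: tau_mult t munit_in_toeplitz)
  qed
  have "b \<in> {b \<in> UNIV. b * x \<in> ideal}"
    by (rule tau_dense[OF closed_csubspace_preimage[OF bounded_clinear_on_mult(2) closed_ideal]]) (use tau x in blast)
  then show ?thesis by simp
qed

lemma eps_in_ideal: "eps i j \<in> ideal"
  unfolding eps_def by (rule tau_munit_in_ideal)

lemma proj_in_ideal: "proj n \<in> ideal"
  unfolding proj_def by (intro csubspace_sum closed_csubspaceD[OF closed_ideal] eps_in_ideal)

lemma norm_proj_mult_le: "norm (proj n * x) \<le> norm x"
  using norm_mult_ineq[of "proj n" x] mult_right_mono[OF norm_proj_le norm_ge_zero, of n x] by simp

lemma proj_approximates: "x \<in> ideal \<Longrightarrow> (\<lambda>n. proj n * x) \<longlonglongrightarrow> x"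
proof -
  have "ideal \<subseteq> {x \<in> UNIV. (\<lambda>n. proj n * x) \<longlonglongrightarrow> x}"
  proof (rule ideal_subset[OF bounded_clinear_on_approximation[OF bounded_clinear_on_mult(1) norm_proj_mult_le]])
    fix a i j
    have eq: "\<tau> a (munit i j) = eps i i * \<tau> a (munit i j)"
      by (simp add: eps_def tau_mult munit_in_toeplitz munit_mult)
    have "proj n * \<tau> a (munit i j) = \<tau> a (munit i j)" if "n > i" for n
    proof -
      have "proj n * \<tau> a (munit i j) = proj n * eps i i * \<tau> a (munit i j)"
        by (subst eq) (simp add: mult.assoc)
      then show ?thesis using that by (simp add: proj_eps flip: eq)
    qed
    then have "\<forall>\<^sub>F n in sequentially. proj n * \<tau> a (munit i j) = \<tau> a (munit i j)"
      by (rule eventually_mono[OF eventually_gt_at_top[of i]])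
    then show "\<tau> a (munit i j) \<in> {x \<in> UNIV. (\<lambda>n. proj n * x) \<longlonglongrightarrow> x}" by (simp add: tendsto_eventually)
  qed
  then show "x \<in> ideal \<Longrightarrow> (\<lambda>n. proj n * x) \<longlonglongrightarrow> x" by blast
qed

text \<open>Matrix multiplication. The approximate unit \<open>proj n\<close> is inserted between
  the factors; as \<open>d * eps k 0\<close> lies in the ideal, the insertion converges in norm, and
  the isometry \<open>phi\<close> brings this to \<open>'a\<close>. With \<open>b = d\<close> and
  \<open>j = k\<close> it makes columns square-summable.\<close>

lemma entry_star_mult_sums: "(\<lambda>i. star (entry b i j) * entry d i k) sums entry (star b * d) j k"
proof -
  have "(\<lambda>n. eps 0 j * star b * (proj n * (d * eps k 0))) \<longlonglongrightarrow> eps 0 j * star b * (d * eps k 0)"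
    by (intro tendsto_intros proj_approximates ideal_mult_left eps_in_ideal)
  moreover have "eps 0 j * star b * (proj n * (d * eps k 0)) = phi (\<Sum>i<n. star (entry b i j) * entry d i k)" for n
  proof -
    have "phi (star (entry b i j) * entry d i k) = eps 0 j * star b * (eps i i * (d * eps k 0))" for i
    proof -
      have "eps 0 j * star b * (eps i i * (d * eps k 0)) = eps 0 j * star b * (eps i 0 * eps 0 i * (d * eps k 0))"
        by (simp add: eps_mult)
      then show ?thesis by (simp add: phi_mult phi_star phi_entry star_mult mult.assoc)
    qed
    then show ?thesis by (simp add: phi_sum proj_def sum_distrib_left sum_distrib_right)
  qed
  ultimately have "(\<lambda>n. phi (\<Sum>i<n. star (entry b i j) * entry d i k)) \<longlonglongrightarrow> phi (entry (star b * d) j k)"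
    by (simp add: phi_entry mult.assoc)
  from LIM_zero[OF this] have "(\<lambda>n. norm (phi ((\<Sum>i<n. star (entry b i j) * entry d i k) - entry (star b * d) j k))) \<longlonglongrightarrow> 0"
    by (intro tendsto_norm_zero) (simp add: phi_diff)
  then show ?thesis
    unfolding sums_def norm_phi by (rule LIM_zero_cancel[OF tendsto_norm_zero_cancel])
qed

end

section \<open>Generators of the suspension\<close>

locale torsioned_suspension = toeplitz_tensor \<tau>
  for \<tau> :: "'a::unital_cstar_algebra \<Rightarrow> complex ell2 bop \<Rightarrow> 'b::cstar_algebra" +
  fixes m :: nat
  assumes m_pos: "m > 0"
begin

abbreviation "Q \<equiv> qds \<tau> m"

definition shift :: 'b where "shift = \<tau> 1 (star left_shift ^ m)"

lemma shift_power_in_toeplitz: "star left_shift ^ m \<in> toeplitz" "left_shift ^ m \<in> toeplitz"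
  by (intro power_in_toeplitz toeplitz_closed left_shift_in_toeplitz)+

lemma star_shift: "star shift = \<tau> 1 (left_shift ^ m)"
  by (simp add: shift_def tau_star shift_power_in_toeplitz star_power_bop star_star)

lemma shift_isometry: "star shift * shift = unit"
  unfolding star_shift
  by (simp add: shift_def unit_def tau_mult shift_power_in_toeplitz left_right_shift_power)

lemma shift_range: "shift * star shift = unit - proj m"
  unfolding star_shift
  by (simp add: shift_def unit_def tau_mult shift_power_in_toeplitz right_left_shift_power
      tau_diff_right one_in_toeplitz pr_in_toeplitz proj_eq_tau)

lemma shift_eps: "shift * eps i j = eps (i + m) j"
  by (simp add: shift_def eps_def tau_mult shift_power_in_toeplitz munit_in_toeplitz right_shift_munit)

lemma Q_subalgebra: "cstar_subalgebra Q"
  unfolding qds_def by (rule cstar_subalgebra_hull)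

lemmas Q_closed = cstar_subalgebra_csubspaceD[OF Q_subalgebra] cstar_subalgebraD(4,5)[OF Q_subalgebra]

lemma tau_compact_in_Q: "k \<in> compact_operators \<Longrightarrow> \<tau> a k \<in> Q"
  unfolding qds_def by (rule hull_inc) blast

lemma shift_in_Q: "shift \<in> Q"
  unfolding qds_def shift_def by (rule hull_inc) blast

lemma ideal_subset_Q: "ideal \<subseteq> Q"
  by (intro ideal_subset cstar_subalgebraD(3) Q_subalgebra tau_compact_in_Q munit_compact)

lemma unit_in_Q: "unit \<in> Q"
  using Q_closed(7)[OF Q_closed(8)[OF shift_in_Q] shift_in_Q] by (simp add: shift_isometry)

text \<open>The induction principle for \<open>Q\<close>: matrix units take the place of arbitrary
  compact operators.\<close>

lemma Q_subset:
  assumes "cstar_subalgebra D" "\<And>a i j. \<tau> a (munit i j) \<in> D" "shift \<in> D"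
  shows "Q \<subseteq> D"
proof -
  have "ideal \<subseteq> D" by (intro ideal_subset cstar_subalgebraD(3) assms)
  then show ?thesis
    unfolding qds_def using assms tau_compact_in_ideal by (intro hull_minimal) (auto simp: shift_def)
qed

end

section \<open>The suspended representation\<close>

lemma bounded_bilinear_cinner: "bounded_bilinear (cinner :: 'h::complex_inner \<Rightarrow> _)"
proof
  fix a a' b b' :: 'h and r :: real
  show "cinner a (r *\<^sub>R b) = r *\<^sub>R cinner a b"
    by (rule linear_cmul[OF bounded_linear.linear[OF bounded_linear_cinner_right]])
  show "cinner (r *\<^sub>R a) b = r *\<^sub>R cinner a b"
    by (simp add: cinner_scaleR_left scaleR_conv_of_real)
  show "\<exists>K. \<forall>a b :: 'h. norm (cinner a b) \<le> norm a * norm b * K"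
    by (intro exI[of _ 1]) (simp add: cauchy_schwarz)
qed (simp_all add: cinner_add_left cinner_add_right)

lemmas tendsto_cinner = bounded_bilinear.tendsto[OF bounded_bilinear_cinner]

lemma cinner_sum_right: "cinner x (sum f A) = (\<Sum>i\<in>A. cinner x (f i))"
  by (induction A rule: infinite_finite_induct) (simp_all add: cinner_add_right)

lemma cinner_sum_left: "cinner (sum f A) x = (\<Sum>i\<in>A. cinner (f i) x)"
  by (induction A rule: infinite_finite_induct) (simp_all add: cinner_add_left)

lemma cinner_trunc: "cinner (trunc n u) w = (\<Sum>j<n. cinner (ell2_nth u j) (ell2_nth w j))"
  unfolding cinner_ell2_def by (subst suminf_finite[of "{..<n}"]) auto

lemma tendsto_ell2_nth: "X \<longlonglongrightarrow> x \<Longrightarrow> (\<lambda>n. ell2_nth (X n) i) \<longlonglongrightarrow> ell2_nth x i"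
proof -
  have "bounded_linear (\<lambda>x :: 'a ell2. ell2_nth x i)"
    by (rule bounded_linear_intro[where K = 1]) (simp_all add: norm_ell2_nth_le)
  then show "X \<longlonglongrightarrow> x \<Longrightarrow> (\<lambda>n. ell2_nth (X n) i) \<longlonglongrightarrow> ell2_nth x i"
    by (rule bounded_linear.tendsto)
qed

lemma closed_ell2_over:
  assumes H: "closed_csubspace H" shows "closed_csubspace (ell2_over H)"
proof (rule closed_csubspaceI)
  fix X x assume X: "\<And>n. X n \<in> ell2_over H" "X \<longlonglongrightarrow> x"
  show "x \<in> ell2_over H"
    using closed_csubspace_limit[OF H _ tendsto_ell2_nth[OF X(2)]] X(1) by (simp add: ell2_over_def)
qed (simp_all add: ell2_over_def csubspaceD[OF closed_csubspaceD(1)[OF H]])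

lemma vtensor_in_ell2_over: "csubspace H \<Longrightarrow> x \<in> H \<Longrightarrow> vtensor x \<xi> \<in> ell2_over H"
  by (simp add: ell2_over_def csubspaceD)

lemma trunc_in_ell2_over: "csubspace H \<Longrightarrow> v \<in> ell2_over H \<Longrightarrow> trunc n v \<in> ell2_over H"
  by (simp add: ell2_over_def csubspaceD)

lemma ell2_over_subset:
  assumes "closed_csubspace M" "\<And>x j. x \<in> H \<Longrightarrow> vtensor x (ket j) \<in> M"
  shows "ell2_over H \<subseteq> M"
proof
  fix v assume v: "v \<in> ell2_over H"
  have "trunc n v \<in> M" for n
    unfolding trunc_eq_sum using v
    by (intro csubspace_sum closed_csubspaceD[OF assms(1)] assms(2)) (auto simp: ell2_over_def)
  then show "v \<in> M" by (rule closed_csubspace_limit[OF assms(1) _ trunc_tendsto])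
qed

lemma representation_zero:
  assumes "representation D H \<pi>" "csubspace D"
  shows "x \<in> H \<Longrightarrow> \<pi> 0 x = 0" "a \<in> D \<Longrightarrow> \<pi> a 0 = 0"
  using representationD(6)[OF assms(1) csubspaceD(1)[OF assms(2)], of x 0]
    representationD(4)[OF assms(1) _ csubspaceD(1)[OF closed_csubspaceD(1)[OF representationD(1)[OF assms(1)]]], of a 0]
  by simp_all

lemma representation_sum:
  assumes "representation D H \<pi>" "csubspace D" "x \<in> H" "\<And>i. i \<in> A \<Longrightarrow> f i \<in> D"
  shows "\<pi> (sum f A) x = (\<Sum>i\<in>A. \<pi> (f i) x)"
  using assms(4)
  by (induction A rule: infinite_finite_induct)
    (simp_all add: representation_zero[OF assms(1,2)] representationD(5)[OF assms(1)] assms csubspace_sum)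

text \<open>The uniqueness principle behind both definite descriptions. Contractivity makes
  agreement a closed condition, and the adjoint relation extends it to
  \<open>star x\<close>.\<close>

lemma representation_agreement:
  assumes D: "cstar_subalgebra D" and R: "representation D K R" and R': "representation D K R'"
  shows "cstar_subalgebra {b \<in> D. \<forall>v\<in>K. R b v = R' b v}" (is "cstar_subalgebra ?S")
proof (rule cstar_subalgebraI)
  note DD = cstar_subalgebra_csubspaceD[OF D] cstar_subalgebraD(4,5)[OF D]
  note K = csubspaceD[OF closed_csubspaceD(1)[OF representationD(1)[OF R]]]
  note z = representation_zero(1)[OF _ cstar_subalgebraD(1)[OF D]]
  note r = representationD[OF R] and r' = representationD[OF R']
  show "0 \<in> ?S" using DD z[OF R] z[OF R'] by simp
  fix x assume x: "x \<in> ?S"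
  have "R (star x) v = R' (star x) v" if v: "v \<in> K" for v
  proof -
    have xD: "x \<in> D" "star x \<in> D" using x DD by auto
    \<comment> \<open>The adjoint relation controls inner products with vectors of \<open>K\<close>,
      and the difference \<open>d\<close> is itself such a vector, so it can be tested against
      itself.\<close>
    define d where "d = R (star x) v - R' (star x) v"
    have dK: "d \<in> K" unfolding d_def using r(2)[OF xD(2) v] r'(2)[OF xD(2) v] K by simp
    have "cinner (R (star x) v) d = cinner (R' (star x) v) d"
      using x r(8)[OF xD(1) v dK] r'(8)[OF xD(1) v dK] dK by simp
    then have "cinner (R (star x) v - R' (star x) v) d = 0" by (simp add: cinner_diff_left)
    then show ?thesis by (simp add: cinner_self flip: d_def) (simp add: d_def)
  qed
  then show "star x \<in> ?S" using x DD by simp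
  show "c *\<^sub>C x \<in> ?S" for c using x by (simp add: DD r(6) r'(6))
  fix y assume y: "y \<in> ?S"
  show "x + y \<in> ?S" using x y by (simp add: DD r(5) r'(5))
  show "x * y \<in> ?S" using x y by (simp add: DD r(7) r'(7) r'(2))
next
  fix X x assume X: "\<And>n. X n \<in> ?S" "X \<longlonglongrightarrow> x"
  then have XD: "\<And>n. X n \<in> D" by simp
  have "x \<in> D" by (rule closed_csubspace_limit[OF cstar_subalgebraD(3)[OF D] XD X(2)])
  moreover have "R x v = R' x v" if v: "v \<in> K" for v
  proof (rule LIMSEQ_unique)
    show "(\<lambda>n. R (X n) v) \<longlonglongrightarrow> R x v" by (rule representation_tendsto_left[OF D R v XD X(2)])
    show "(\<lambda>n. R (X n) v) \<longlonglongrightarrow> R' x v"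
      using representation_tendsto_left[OF D R' v XD X(2)] X(1) v by simp
  qed
  ultimately show "x \<in> ?S" by simp
qed

lemma representation_subset: "representation D H \<pi> \<Longrightarrow> D' \<subseteq> D \<Longrightarrow> representation D' H \<pi>"
  unfolding representation_def by blast

text \<open>A crude bound \<open>C * norm y\<close> improves to \<open>t * norm y\<close>: iterating
  \<open>y \<mapsto> star y * y\<close> squares the norms, while the constant \<open>C\<close> is taken to the power \<open>2 ^ (- k)\<close>.\<close>

lemma bound_by_squaring:
  fixes g :: "'b::cstar_algebra \<Rightarrow> real"
  assumes g: "\<And>y. 0 \<le> g y" "\<And>y. (g y)\<^sup>2 \<le> t * g (star y * y)" "\<And>y. g y \<le> C * norm y"
    and t: "0 \<le> t" and C: "0 \<le> C"
  shows "g y \<le> t * norm y"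
proof (cases "t = 0")
  case True
  then show ?thesis using g(1,2)[of y] by simp
next
  case False
  then have t0: "t > 0" using t by simp
  define Y where "Y k = ((\<lambda>y. star y * y) ^^ k) y" for k
  have Y: "Y 0 = y" "Y (Suc k) = star (Y k) * Y k" for k by (simp_all add: Y_def)
  have nY: "norm (Y k) = norm y ^ (2 ^ k)" for k
    by (induction k) (simp_all add: Y cstar_identity mult.commute flip: power_mult)
  have gY: "g y ^ (2 ^ k) * t \<le> t ^ (2 ^ k) * g (Y k)" for k
  proof (induction k)
    case (Suc k)
    have "(g y ^ (2 ^ k) * t)\<^sup>2 \<le> (t ^ (2 ^ k) * g (Y k))\<^sup>2"
      using Suc g(1) t by (intro power_mono) auto
    also have "\<dots> = (t ^ (2 ^ k))\<^sup>2 * (g (Y k))\<^sup>2" by (simp add: power_mult_distrib)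
    also have "\<dots> \<le> (t ^ (2 ^ k))\<^sup>2 * (t * g (Y (Suc k)))"
      unfolding Y by (intro mult_left_mono g) simp
    finally have "t * (g y ^ (2 ^ Suc k) * t) \<le> t * (t ^ (2 ^ Suc k) * g (Y (Suc k)))"
      by (simp add: power_mult_distrib power2_eq_square mult_2 power_add mult_ac)
    then show ?case using t0 by (rule mult_left_le_imp_le)
  qed (simp add: Y)
  \<comment> \<open>The constant \<open>C / t\<close> is at most \<open>2 ^ k * d + 1\<close>, the
    form in which \<open>exp_dominates_linear\<close> absorbs it.\<close>
  obtain d where d: "C / t \<le> real d" using real_arch_simple by blast
  show ?thesis
  proof (rule exp_dominates_linear[where d = d])
    fix k
    have "g y ^ (2 ^ k) * t \<le> t ^ (2 ^ k) * (C * norm y ^ (2 ^ k))"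
      using gY[of k] mult_left_mono[OF g(3)[of "Y k"], of "t ^ (2 ^ k)"] t by (simp add: nY)
    then have "g y ^ (2 ^ k) \<le> C / t * (t * norm y) ^ (2 ^ k)"
      using t0 by (simp add: field_simps power_mult_distrib)
    also have "\<dots> \<le> real (2 ^ k * d + 1) * (t * norm y) ^ (2 ^ k)"
    proof (intro mult_right_mono)
      have "real d * 1 \<le> real d * 2 ^ k" by (intro mult_left_mono) auto
      then show "C / t \<le> real (2 ^ k * d + 1)" using d by (simp add: mult.commute)
    qed (use t in simp)
    finally show "g y ^ (2 ^ k) \<le> real (2 ^ k * d + 1) * (t * norm y) ^ (2 ^ k)" .
  qed (use t in simp)
qed

section \<open>Infinite matrices acting on sequences\<close>

locale suspended_representation = torsioned_suspension \<tau> m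
  for \<tau> :: "'a::unital_cstar_algebra \<Rightarrow> complex ell2 bop \<Rightarrow> 'b::cstar_algebra" and m +
  fixes H :: "'h::chilbert_space set" and \<rho> :: "'a \<Rightarrow> 'h \<Rightarrow> 'h"
  assumes rep: "representation UNIV H \<rho>" and rho_one: "x \<in> H \<Longrightarrow> \<rho> 1 x = x"
begin

lemmas rho = representationD[OF rep, simplified]
lemmas H_closed = csubspaceD[OF closed_csubspaceD(1)[OF rho(1)]]

lemma csubspace_H: "csubspace H"
  by (rule closed_csubspaceD(1)[OF rho(1)])

lemma norm_rho_le: "x \<in> H \<Longrightarrow> norm (\<rho> a x) \<le> norm a * norm x"
  by (rule representation_contractive[OF cstar_subalgebra_UNIV rep]) simp_all

lemma cinner_rho: "x \<in> H \<Longrightarrow> y \<in> H \<Longrightarrow> cinner (\<rho> a x) (\<rho> b y) = cinner x (\<rho> (star a * b) y)"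
  using rho(8)[of x "\<rho> b y" "star a"] by (simp add: star_star rho)

lemma entry_cinner_sums:
  assumes x: "x \<in> H" and y: "y \<in> H"
  shows "(\<lambda>i. cinner (\<rho> (entry b i j) x) (\<rho> (entry d i k) y)) sums cinner x (\<rho> (entry (star b * d) j k) y)"
proof -
  have "bounded_linear (\<lambda>a. cinner x (\<rho> a y))"
  proof (rule bounded_linear_intro[where K = "norm x * norm y"])
    show "norm (cinner x (\<rho> a y)) \<le> norm a * (norm x * norm y)" for a
      using cauchy_schwarz[of x "\<rho> a y"] mult_left_mono[OF norm_rho_le[OF y, of a], of "norm x"]
      by (simp add: mult_ac)
  qed (simp_all add: rho y cinner_add_right scaleR_scaleC_def cinner_scaleC_right)
  from bounded_linear.sums[OF this entry_star_mult_sums] show ?thesis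
    by (simp add: cinner_rho x y)
qed

text \<open>This will be the image of \<open>vtensor x (ket j)\<close>. For \<open>x\<close> in
  \<open>H\<close> the sequence is square-summable, as \<open>col_nth\<close> shows, so
  \<open>Abs_ell2\<close> is meaningful.\<close>

definition col :: "'b \<Rightarrow> nat \<Rightarrow> 'h \<Rightarrow> 'h ell2" where
  "col b j x = Abs_ell2 (\<lambda>i. \<rho> (entry b i j) x)"

lemma col_nth: "x \<in> H \<Longrightarrow> ell2_nth (col b j x) i = \<rho> (entry b i j) x"
proof -
  assume x: "x \<in> H"
  have "summable (\<lambda>i. Re (cinner (\<rho> (entry b i j) x) (\<rho> (entry b i j) x)))"
    using sums_Re[OF entry_cinner_sums[OF x x, of b j b j]] by (rule sums_summable)
  then have "summable (\<lambda>i. (norm (\<rho> (entry b i j) x))\<^sup>2)"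
    by (simp add: norm_sq_cinner)
  then show ?thesis by (simp add: col_def Abs_ell2_inverse)
qed

lemma col_in: "x \<in> H \<Longrightarrow> col b j x \<in> ell2_over H"
  by (simp add: ell2_over_def col_nth rho)

lemma cinner_col:
  "x \<in> H \<Longrightarrow> y \<in> H \<Longrightarrow> cinner (col b j x) (col d k y) = cinner x (\<rho> (entry (star b * d) j k) y)"
  unfolding cinner_ell2_def using sums_unique[OF entry_cinner_sums] by (simp add: col_nth)

lemma norm_col_le: "x \<in> H \<Longrightarrow> norm (col b j x) \<le> norm b * norm x"
proof -
  assume x: "x \<in> H"
  have "(norm (col b j x))\<^sup>2 \<le> norm x * norm (\<rho> (entry (star b * b) j j) x)"
    using cauchy_schwarz[of x "\<rho> (entry (star b * b) j j) x"]
    by (simp add: cinner_col x flip: cmod_cinner_self)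
  also have "\<dots> \<le> norm x * (norm (star b * b) * norm x)"
    by (intro mult_left_mono order_trans[OF norm_rho_le[OF x]] mult_right_mono norm_entry_le) simp_all
  finally have "(norm (col b j x))\<^sup>2 \<le> (norm b * norm x)\<^sup>2"
    by (simp add: cstar_identity power_mult_distrib power2_eq_square mult_ac)
  then show ?thesis by (rule power2_le_imp_le) simp
qed

definition part :: "'b \<Rightarrow> nat \<Rightarrow> 'h ell2 \<Rightarrow> 'h ell2" where
  "part b n v = (\<Sum>j<n. col b j (ell2_nth v j))"

lemma ell2_overD: "v \<in> ell2_over H \<Longrightarrow> ell2_nth v j \<in> H"
  by (simp add: ell2_over_def)

lemma part_nth:
  "v \<in> ell2_over H \<Longrightarrow> ell2_nth (part b n v) i = (\<Sum>j<n. \<rho> (entry b i j) (ell2_nth v j))"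
  by (simp add: part_def ell2_nth_sum col_nth ell2_overD)

lemma part_in: "v \<in> ell2_over H \<Longrightarrow> part b n v \<in> ell2_over H"
  unfolding part_def
  by (intro csubspace_sum closed_csubspaceD[OF closed_ell2_over] rho(1) col_in ell2_overD)

text \<open>Finite stages already satisfy the adjoint and product relations in this weak form. The
  norm bound and all algebraic properties of \<open>susp\<close> are drawn from this
  identity.\<close>

lemma cinner_part:
  assumes "u \<in> ell2_over H" "v \<in> ell2_over H"
  shows "cinner (part b n u) (part d k v) = cinner (trunc n u) (part (star b * d) k v)"
  using assms
  by (simp add: cinner_trunc part_nth cinner_sum_right)
    (simp add: part_def cinner_sum_left cinner_sum_right cinner_col ell2_overD, rule sum.swap)

text \<open>The triangle inequality yields a constant that grows with \<open>n\<close>. By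
  \<open>cinner_part\<close> the bound satisfies the self-improving inequality of
  \<open>bound_by_squaring\<close>, and this gives the constant \<open>norm (trunc n v)\<close>,
  uniform in \<open>n\<close> by \<open>norm_trunc_le\<close>.\<close>

lemma norm_part_le: "v \<in> ell2_over H \<Longrightarrow> norm (part b n v) \<le> norm (trunc n v) * norm b"
proof (rule bound_by_squaring)
  assume v: "v \<in> ell2_over H"
  fix y
  have "(norm (part y n v))\<^sup>2 = cmod (cinner (trunc n v) (part (star y * y) n v))"
    by (simp add: v flip: cmod_cinner_self cinner_part)
  then show "(norm (part y n v))\<^sup>2 \<le> norm (trunc n v) * norm (part (star y * y) n v)"
    by (simp add: cauchy_schwarz)
  have "norm (part y n v) \<le> (\<Sum>j<n. norm (col y j (ell2_nth v j)))"
    unfolding part_def by (rule norm_sum)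
  also have "\<dots> \<le> (\<Sum>j<n. norm y * norm (ell2_nth v j))"
    by (intro sum_mono norm_col_le ell2_overD v)
  finally show "norm (part y n v) \<le> (\<Sum>j<n. norm (ell2_nth v j)) * norm y"
    by (simp add: sum_distrib_left mult.commute)
qed (simp_all add: sum_nonneg)

definition susp :: "'b \<Rightarrow> 'h ell2 \<Rightarrow> 'h ell2" where
  "susp b v = lim (\<lambda>n. part b n v)"

text \<open>A difference of two partial sums is a partial sum for the tail
  \<open>v - trunc n v\<close>, and the uniform bound makes it small.\<close>

lemma part_tendsto:
  assumes v: "v \<in> ell2_over H"
  shows "(\<lambda>n. part b n v) \<longlonglongrightarrow> susp b v"
proof -
  have le: "norm (part b k v - part b n v) \<le> norm (v - trunc n v) * norm b" if "n \<le> k" for n k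
  proof -
    have w: "v - trunc n v \<in> ell2_over H"
      using v trunc_in_ell2_over[OF csubspace_H v] csubspaceD[OF closed_csubspaceD(1)[OF closed_ell2_over[OF rho(1)]]]
      by simp
    have "part b k v - part b n v = part b k (v - trunc n v)"
    proof (rule ell2_eqI)
      fix i
      have "(\<Sum>j<k. \<rho> (entry b i j) (ell2_nth (v - trunc n v) j))
          = (\<Sum>j\<in>{..<k} - {..<n}. \<rho> (entry b i j) (ell2_nth v j))"
        by (rule sum.mono_neutral_cong_right) (auto simp: representation_zero[OF rep closed_csubspaceD(1)[OF closed_csubspace_UNIV]])
      also have "\<dots> = (\<Sum>j<k. \<rho> (entry b i j) (ell2_nth v j)) - (\<Sum>j<n. \<rho> (entry b i j) (ell2_nth v j))"
        using that by (intro sum_diff) auto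
      finally show "ell2_nth (part b k v - part b n v) i = ell2_nth (part b k (v - trunc n v)) i"
        using v w by (simp add: part_nth)
    qed
    then have "norm (part b k v - part b n v) \<le> norm (trunc k (v - trunc n v)) * norm b"
      using norm_part_le[OF w] by simp
    also have "\<dots> \<le> norm (v - trunc n v) * norm b"
      by (intro mult_right_mono norm_trunc_le) simp
    finally show ?thesis .
  qed
  have "Cauchy (\<lambda>n. part b n v)"
  proof (rule metric_CauchyI)
    fix e :: real assume "e > 0"
    have "(\<lambda>n. norm (v - trunc n v) * norm b) \<longlonglongrightarrow> norm (v - v) * norm b"
      by (intro tendsto_intros trunc_tendsto)
    then have "(\<lambda>n. norm (v - trunc n v) * norm b) \<longlonglongrightarrow> 0" by simp
    moreover have "e / 2 > 0" using \<open>e > 0\<close> by simp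
    ultimately obtain N where "norm (norm (v - trunc N v) * norm b - 0) < e / 2"
      using LIMSEQ_D by blast
    then have N: "norm (v - trunc N v) * norm b < e / 2" by simp
    have "dist (part b k v) (part b l v) < e" if "k \<ge> N" "l \<ge> N" for k l
      using le[OF that(1)] le[OF that(2)] N dist_triangle2[of "part b k v" "part b l v" "part b N v"]
      unfolding dist_norm by linarith
    then show "\<exists>N. \<forall>k\<ge>N. \<forall>l\<ge>N. dist (part b k v) (part b l v) < e" by blast
  qed
  then show ?thesis unfolding susp_def by (simp add: Cauchy_convergent_iff convergent_LIMSEQ_iff)
qed

lemma susp_nth_sums:
  assumes v: "v \<in> ell2_over H"
  shows "(\<lambda>j. \<rho> (entry b i j) (ell2_nth v j)) sums ell2_nth (susp b v) i"
  unfolding sums_def using tendsto_ell2_nth[OF part_tendsto[OF v], of b i] by (simp add: part_nth v)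

lemma susp_in: "v \<in> ell2_over H \<Longrightarrow> susp b v \<in> ell2_over H"
  by (rule closed_csubspace_limit[OF closed_ell2_over[OF rho(1)] part_in part_tendsto])

lemma susp_eqI:
  assumes "v \<in> ell2_over H" "\<And>i. (\<lambda>j. \<rho> (entry b i j) (ell2_nth v j)) sums ell2_nth w i"
  shows "susp b v = w"
  by (rule ell2_eqI) (rule sums_unique2[OF susp_nth_sums[OF assms(1)] assms(2)])

lemma ell2_over_closed:
  "u \<in> ell2_over H \<Longrightarrow> v \<in> ell2_over H \<Longrightarrow> u + v \<in> ell2_over H" "u \<in> ell2_over H \<Longrightarrow> c *\<^sub>C u \<in> ell2_over H"
  "u \<in> ell2_over H \<Longrightarrow> v \<in> ell2_over H \<Longrightarrow> u - v \<in> ell2_over H"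
  using csubspaceD[OF closed_csubspaceD(1)[OF closed_ell2_over[OF rho(1)]]] by blast+

text \<open>The limits in \<open>k\<close> and in \<open>n\<close> are taken one after the other.
  Setting \<open>d = unit\<close> gives the adjoint relation, from which multiplicativity
  follows.\<close>

lemma cinner_susp:
  assumes u: "u \<in> ell2_over H" and v: "v \<in> ell2_over H"
  shows "cinner (susp b u) (susp d v) = cinner u (susp (star b * d) v)"
proof (rule LIMSEQ_unique)
  show "(\<lambda>n. cinner (part b n u) (susp d v)) \<longlonglongrightarrow> cinner (susp b u) (susp d v)"
    by (intro tendsto_cinner part_tendsto u tendsto_const)
  have "cinner (part b n u) (susp d v) = cinner (trunc n u) (susp (star b * d) v)" for n
  proof (rule LIMSEQ_unique)
    show "(\<lambda>k. cinner (part b n u) (part d k v)) \<longlonglongrightarrow> cinner (part b n u) (susp d v)"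
      by (intro tendsto_cinner part_tendsto v tendsto_const)
    show "(\<lambda>k. cinner (part b n u) (part d k v)) \<longlonglongrightarrow> cinner (trunc n u) (susp (star b * d) v)"
      unfolding cinner_part[OF u v] by (intro tendsto_cinner part_tendsto v tendsto_const)
  qed
  then show "(\<lambda>n. cinner (part b n u) (susp d v)) \<longlonglongrightarrow> cinner u (susp (star b * d) v)"
    by (simp add: tendsto_cinner trunc_tendsto tendsto_const)
qed

lemma susp_unit: "v \<in> ell2_over H \<Longrightarrow> susp unit v = v"
proof (rule susp_eqI)
  assume v: "v \<in> ell2_over H"
  fix i
  have "(\<lambda>j. if j = i then ell2_nth v i else 0) sums ell2_nth v i"
    by (rule sums_single)
  moreover have "\<rho> (entry unit i j) (ell2_nth v j) = (if j = i then ell2_nth v i else 0)" for j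
    using ell2_overD[OF v]
    by (simp add: entry_unit rho_one representation_zero[OF rep closed_csubspaceD(1)[OF closed_csubspace_UNIV]])
  ultimately show "(\<lambda>j. \<rho> (entry unit i j) (ell2_nth v j)) sums ell2_nth v i" by simp
qed

lemma susp_star: "u \<in> ell2_over H \<Longrightarrow> v \<in> ell2_over H \<Longrightarrow> cinner (susp b u) v = cinner u (susp (star b) v)"
  using cinner_susp[of u v b unit] by (simp add: susp_unit unit_mult)

text \<open>A double sum over matrix entries is avoided: the difference of both sides is tested
  against itself, and adjoints move every factor to the other side.\<close>

lemma susp_mult:
  assumes u: "u \<in> ell2_over H" shows "susp (b * d) u = susp b (susp d u)"
proof -
  define w where "w = susp (b * d) u - susp b (susp d u)"
  have w: "w \<in> ell2_over H" unfolding w_def by (intro ell2_over_closed susp_in u)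
  have "cinner (susp (b * d) u) w = cinner u (susp (star d * star b) w)"
    using susp_star[OF u w, of "b * d"] by (simp add: star_mult)
  also have "\<dots> = cinner (susp d u) (susp (star b) w)"
    by (simp add: cinner_susp u w)
  also have "\<dots> = cinner (susp b (susp d u)) w"
    by (simp add: susp_star susp_in u w)
  finally have "cinner w w = 0" by (simp add: w_def cinner_diff_left)
  then show ?thesis by (simp add: cinner_self w_def)
qed

lemma norm_susp_le: "v \<in> ell2_over H \<Longrightarrow> norm (susp b v) \<le> norm b * norm v"
proof -
  assume v: "v \<in> ell2_over H"
  have "norm (part b n v) \<le> norm b * norm v" for n
    using order_trans[OF norm_part_le[OF v] mult_right_mono[OF norm_trunc_le norm_ge_zero]]
    by (simp add: mult.commute)
  then show ?thesis
    by (intro LIMSEQ_le_const2[OF tendsto_norm[OF part_tendsto[OF v]]]) blast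
qed

lemma representation_susp: "representation UNIV (ell2_over H) susp"
proof -
  have add: "susp a (u + v) = susp a u + susp a v" if u: "u \<in> ell2_over H" and v: "v \<in> ell2_over H" for a u v
    using sums_add[OF susp_nth_sums[OF u] susp_nth_sums[OF v]]
    by (intro susp_eqI ell2_over_closed u v) (simp add: rho ell2_overD u v)
  have scale: "susp a (c *\<^sub>C u) = c *\<^sub>C susp a u" if u: "u \<in> ell2_over H" for a c u
    using bounded_linear.sums[OF bounded_linear_scaleC susp_nth_sums[OF u]]
    by (intro susp_eqI ell2_over_closed u) (simp add: rho ell2_overD u)
  have add_left: "susp (a + b) u = susp a u + susp b u" if u: "u \<in> ell2_over H" for a b u
    using sums_add[OF susp_nth_sums[OF u] susp_nth_sums[OF u]]
    by (intro susp_eqI u) (simp add: entry_add rho ell2_overD u)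
  have scale_left: "susp (c *\<^sub>C a) u = c *\<^sub>C susp a u" if u: "u \<in> ell2_over H" for a c u
    using bounded_linear.sums[OF bounded_linear_scaleC susp_nth_sums[OF u]]
    by (intro susp_eqI u) (simp add: entry_scaleC rho ell2_overD u)
  have adj: "cinner (susp (star a) u) v = cinner u (susp a v)"
    if u: "u \<in> ell2_over H" and v: "v \<in> ell2_over H" for a u v
    using susp_star[OF u v, of "star a"] by (simp add: star_star)
  have bnd: "\<exists>K. \<forall>x\<in>ell2_over H. norm (susp a x) \<le> K * norm x" for a using norm_susp_le by blast
  show ?thesis
    unfolding representation_def bounded_operator_on_def
    using closed_ell2_over[OF rho(1)]
    by (intro conjI ballI allI susp_in add scale add_left scale_left adj bnd susp_mult)
qed

lemma susp_tau:
  assumes t: "t \<in> toeplitz" and x: "x \<in> H"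
  shows "susp (\<tau> a t) (vtensor x \<xi>) = vtensor (\<rho> a x) (bop_apply t \<xi>)"
proof (rule susp_eqI)
  show "vtensor x \<xi> \<in> ell2_over H" by (rule vtensor_in_ell2_over[OF csubspace_H x])
  fix i
  have "(\<lambda>j. (bop_entry t i j * ell2_nth \<xi> j) *\<^sub>C \<rho> a x) sums (ell2_nth (bop_apply t \<xi>) i *\<^sub>C \<rho> a x)"
    by (rule bounded_linear.sums[OF bounded_linear_scaleC_left bop_apply_sums])
  then show "(\<lambda>j. \<rho> (entry (\<tau> a t) i j) (ell2_nth (vtensor x \<xi>) j)) sums ell2_nth (vtensor (\<rho> a x) (bop_apply t \<xi>)) i"
    using x by (simp add: entry_tau t rho H_closed scaleC_scaleC mult.commute)
qed

lemma representation_unique: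
  assumes R: "representation Q (ell2_over H) R" and R': "representation Q (ell2_over H) R'"
    and k: "\<And>a i j x \<xi>. x \<in> H \<Longrightarrow> R (\<tau> a (munit i j)) (vtensor x \<xi>) = R' (\<tau> a (munit i j)) (vtensor x \<xi>)"
    and s: "\<And>x \<xi>. x \<in> H \<Longrightarrow> R shift (vtensor x \<xi>) = R' shift (vtensor x \<xi>)"
    and b: "b \<in> Q" and v: "v \<in> ell2_over H"
  shows "R b v = R' b v"
proof -
  have gen: "R g v = R' g v"
    if g: "g \<in> Q" "\<And>x \<xi>. x \<in> H \<Longrightarrow> R g (vtensor x \<xi>) = R' g (vtensor x \<xi>)" and v: "v \<in> ell2_over H" for g v
  proof -
    have "closed_csubspace {v \<in> ell2_over H. R g v = R' g v}"
      by (intro closed_csubspace_equalizer bounded_clinear_on_representation[OF R] bounded_clinear_on_representation[OF R'] g)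
    then have "ell2_over H \<subseteq> {v \<in> ell2_over H. R g v = R' g v}"
      by (rule ell2_over_subset) (simp add: g vtensor_in_ell2_over[OF csubspace_H])
    then show ?thesis using v by blast
  qed
  have "Q \<subseteq> {b \<in> Q. \<forall>v\<in>ell2_over H. R b v = R' b v}"
    using gen k s shift_in_Q tau_compact_in_Q[OF munit_compact]
    by (intro Q_subset representation_agreement[OF Q_subalgebra R R']) auto
  then show ?thesis using b v by blast
qed

text \<open>This eliminates the definite description. \<open>susp\<close> acts for the whole ambient
  algebra; cutting it off outside the domain makes it unique as a total function.\<close>

lemma qds_representation_eq:
  "qds_representation \<tau> m H \<rho> = (\<lambda>b v. if b \<in> Q \<and> v \<in> ell2_over H then susp b v else 0)"
  unfolding qds_representation_def
proof (rule the_equality)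
  let ?R = "\<lambda>b v. if b \<in> Q \<and> v \<in> ell2_over H then susp b v else 0"
  have R: "representation Q (ell2_over H) ?R"
    using representation_subset[OF representation_susp, of Q]
    unfolding representation_def bounded_operator_on_def
    by (simp add: Q_closed ell2_over_closed susp_in)
  note vt = vtensor_in_ell2_over[OF csubspace_H]
  have gen: "\<forall>a. \<forall>k\<in>compact_operators. \<forall>x\<in>H. \<forall>\<xi>. ?R (\<tau> a k) (vtensor x \<xi>) = vtensor (\<rho> a x) (bop_apply k \<xi>)"
    "\<forall>x\<in>H. \<forall>\<xi>. ?R (\<tau> 1 (star left_shift ^ m)) (vtensor x \<xi>) = vtensor x (bop_apply (star left_shift ^ m) \<xi>)"
    using shift_in_Q
    by (simp_all add: vt tau_compact_in_Q compact_in_toeplitz susp_tau shift_power_in_toeplitz rho_one shift_def)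
  show "representation Q (ell2_over H) ?R \<and>
     (\<forall>a. \<forall>k\<in>compact_operators. \<forall>x\<in>H. \<forall>\<xi>. ?R (\<tau> a k) (vtensor x \<xi>) = vtensor (\<rho> a x) (bop_apply k \<xi>)) \<and>
     (\<forall>x\<in>H. \<forall>\<xi>. ?R (\<tau> 1 (star left_shift ^ m)) (vtensor x \<xi>) = vtensor x (bop_apply (star left_shift ^ m) \<xi>)) \<and>
     (\<forall>b v. b \<notin> Q \<or> v \<notin> ell2_over H \<longrightarrow> ?R b v = 0)"
    by (intro conjI R gen) auto
  fix R' assume R': "representation Q (ell2_over H) R' \<and>
     (\<forall>a. \<forall>k\<in>compact_operators. \<forall>x\<in>H. \<forall>\<xi>. R' (\<tau> a k) (vtensor x \<xi>) = vtensor (\<rho> a x) (bop_apply k \<xi>)) \<and>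
     (\<forall>x\<in>H. \<forall>\<xi>. R' (\<tau> 1 (star left_shift ^ m)) (vtensor x \<xi>) = vtensor x (bop_apply (star left_shift ^ m) \<xi>)) \<and>
     (\<forall>b v. b \<notin> Q \<or> v \<notin> ell2_over H \<longrightarrow> R' b v = 0)"
  show "R' = ?R"
  proof (intro ext)
    fix b v
    show "R' b v = ?R b v"
    proof (cases "b \<in> Q \<and> v \<in> ell2_over H")
      case True
      note R'_gen = R'[THEN conjunct2, THEN conjunct1, rule_format]
        R'[THEN conjunct2, THEN conjunct2, THEN conjunct1, rule_format]
      have "R' b v = ?R b v"
      proof (rule representation_unique[OF R'[THEN conjunct1] R])
        fix a i j x \<xi> assume x: "x \<in> H"
        show "R' (\<tau> a (munit i j)) (vtensor x \<xi>) = ?R (\<tau> a (munit i j)) (vtensor x \<xi>)"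
          using R'_gen(1)[OF munit_compact x] gen(1)[rule_format, OF munit_compact x] by simp
        show "R' shift (vtensor x \<xi>) = ?R shift (vtensor x \<xi>)"
          unfolding shift_def using R'_gen(2)[OF x] gen(2)[rule_format, OF x] by simp
      qed (use True in auto)
      then show ?thesis .
    qed (use R' in auto)
  qed
qed

end

section \<open>Irreducibility and inequivalence\<close>

lemma irreducibleD:
  assumes "irreducible_representation D H \<pi>"
  shows "representation D H \<pi>" "\<exists>a\<in>D. \<exists>x\<in>H. \<pi> a x \<noteq> 0"
    "closed_csubspace M \<Longrightarrow> M \<subseteq> H \<Longrightarrow> (\<And>a x. a \<in> D \<Longrightarrow> x \<in> M \<Longrightarrow> \<pi> a x \<in> M) \<Longrightarrow> y \<in> M \<Longrightarrow> y \<noteq> 0 \<Longrightarrow> M = H"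
  using assms unfolding irreducible_representation_def by blast+

text \<open>The vectors fixed by \<open>e\<close> form a closed invariant subspace that contains
  every value \<open>\<pi> b y\<close>, one of which is nonzero.\<close>

lemma irreducible_unit:
  assumes irr: "irreducible_representation D H \<pi>" and D: "cstar_subalgebra D"
    and e: "e \<in> D" "\<And>b. b \<in> D \<Longrightarrow> e * b = b" "\<And>b. b \<in> D \<Longrightarrow> b * e = b" and x: "x \<in> H"
  shows "\<pi> e x = x"
proof -
  note R = representationD[OF irreducibleD(1)[OF irr]]
  obtain a y where ay: "a \<in> D" "y \<in> H" "\<pi> a y \<noteq> 0" using irreducibleD(2)[OF irr] by blast
  have "{x \<in> H. \<pi> e x = x} = H"
  proof (rule irreducibleD(3)[OF irr _ _ _ _ ay(3)])
    show "closed_csubspace {x \<in> H. \<pi> e x = x}"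
      by (intro closed_csubspace_equalizer bounded_clinear_on_representation[OF irreducibleD(1)[OF irr]] e(1)
          bounded_clinear_on_id R(1))
    show "\<pi> b z \<in> {x \<in> H. \<pi> e x = x}" if "b \<in> D" "z \<in> {x \<in> H. \<pi> e x = x}" for b z
      using that R(7)[OF e(1) that(1), of z] by (simp add: R(2) e(2))
    show "\<pi> a y \<in> {x \<in> H. \<pi> e x = x}"
      using R(7)[OF e(1) ay(1,2)] ay by (simp add: R(2) e(2))
  qed auto
  then show ?thesis using x by blast
qed

lemma cinner_vtensor_same_ket: "cinner (vtensor x (ket i)) (vtensor y (ket i)) = cinner x y"
  by (simp add: cinner_vtensor_ket)

text \<open>The equivalence without its existential quantifier, so that the unitary can be named,
  composed and restricted.\<close>

definition intertwining_unitary ::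
  "'b::cstar_algebra set \<Rightarrow> 'h::chilbert_space set \<Rightarrow> ('b \<Rightarrow> 'h \<Rightarrow> 'h) \<Rightarrow>
    'k::chilbert_space set \<Rightarrow> ('b \<Rightarrow> 'k \<Rightarrow> 'k) \<Rightarrow> ('h \<Rightarrow> 'k) \<Rightarrow> bool" where
  "intertwining_unitary D H \<pi> K \<sigma> U \<longleftrightarrow>
     (\<forall>x\<in>H. \<forall>y\<in>H. U (x + y) = U x + U y) \<and> (\<forall>c. \<forall>x\<in>H. U (c *\<^sub>C x) = c *\<^sub>C U x) \<and>
     (\<forall>x\<in>H. \<forall>y\<in>H. cinner (U x) (U y) = cinner x y) \<and> U ` H = K \<and>
     (\<forall>a\<in>D. \<forall>x\<in>H. U (\<pi> a x) = \<sigma> a (U x))"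

lemma unitarily_equivalent_iff:
  "unitarily_equivalent D H \<pi> K \<sigma> \<longleftrightarrow> (\<exists>U. intertwining_unitary D H \<pi> K \<sigma> U)"
  by (simp add: unitarily_equivalent_def intertwining_unitary_def)

lemma intertwining_unitaryD:
  assumes "intertwining_unitary D H \<pi> K \<sigma> U"
  shows "x \<in> H \<Longrightarrow> y \<in> H \<Longrightarrow> U (x + y) = U x + U y" "x \<in> H \<Longrightarrow> U (c *\<^sub>C x) = c *\<^sub>C U x"
    "x \<in> H \<Longrightarrow> y \<in> H \<Longrightarrow> cinner (U x) (U y) = cinner x y" "U ` H = K"
    "a \<in> D \<Longrightarrow> x \<in> H \<Longrightarrow> U (\<pi> a x) = \<sigma> a (U x)" "x \<in> H \<Longrightarrow> U x \<in> K"
  using assms by (auto simp: intertwining_unitary_def)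

context suspended_representation
begin

lemma susp_tau_munit:
  assumes v: "v \<in> ell2_over H"
  shows "susp (\<tau> a (munit i j)) v = vtensor (\<rho> a (ell2_nth v j)) (ket i)"
proof (rule susp_eqI[OF v])
  fix k
  have "(\<lambda>l. if l = j then ell2_nth (vtensor (\<rho> a (ell2_nth v j)) (ket i)) k else 0) sums
      ell2_nth (vtensor (\<rho> a (ell2_nth v j)) (ket i)) k"
    by (rule sums_single)
  moreover have "\<rho> (entry (\<tau> a (munit i j)) k l) (ell2_nth v l) =
      (if l = j then ell2_nth (vtensor (\<rho> a (ell2_nth v j)) (ket i)) k else 0)" for l
    using ell2_overD[OF v] representation_zero[OF rep closed_csubspaceD(1)[OF closed_csubspace_UNIV]]
    by (simp add: entry_tau munit_in_toeplitz)
  ultimately show "(\<lambda>l. \<rho> (entry (\<tau> a (munit i j)) k l) (ell2_nth v l)) sums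
      ell2_nth (vtensor (\<rho> a (ell2_nth v j)) (ket i)) k" by simp
qed

lemma bounded_clinear_on_vtensor: "bounded_clinear_on H (\<lambda>x. vtensor x \<xi>)"
  unfolding bounded_clinear_on_def using rho(1)
  by (auto simp: vtensor_add_left vtensor_scaleC_left norm_vtensor mult.commute intro!: exI[of _ "norm \<xi>"])

lemma tau_munit_in_Q: "\<tau> a (munit i j) \<in> Q"
  by (rule tau_compact_in_Q[OF munit_compact])

lemma qds_representation_susp:
  "b \<in> Q \<Longrightarrow> v \<in> ell2_over H \<Longrightarrow> qds_representation \<tau> m H \<rho> b v = susp b v"
  by (simp add: qds_representation_eq)

lemma representation_qds: "representation Q (ell2_over H) (qds_representation \<tau> m H \<rho>)"
  using representation_subset[OF representation_susp, of Q]
  unfolding representation_def bounded_operator_on_def qds_representation_eq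
  by (simp add: Q_closed ell2_over_closed susp_in)

text \<open>A matrix unit moves a nonzero coordinate of a vector in \<open>M\<close> to position 0.
  So the vectors \<open>x\<close> with \<open>vtensor x (ket 0)\<close> in \<open>M\<close> form a
  nonzero subspace invariant under \<open>\<rho>\<close>, hence all of \<open>H\<close>; other
  matrix units spread them to every position.\<close>

lemma irreducible_qds_representation:
  assumes irr: "irreducible_representation UNIV H \<rho>"
  shows "irreducible_representation Q (ell2_over H) (qds_representation \<tau> m H \<rho>)"
  unfolding irreducible_representation_def
proof (intro conjI allI impI representation_qds)
  obtain a x where ax: "x \<in> H" "\<rho> a x \<noteq> 0" using irreducibleD(2)[OF irr] by blast
  have vt: "vtensor x (ket 0) \<in> ell2_over H" by (rule vtensor_in_ell2_over[OF csubspace_H ax(1)])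
  have "norm (susp (\<tau> a (munit 0 0)) (vtensor x (ket 0))) = norm (\<rho> a x)"
    by (simp add: susp_tau_munit vt norm_vtensor)
  then show "\<exists>b\<in>Q. \<exists>v\<in>ell2_over H. qds_representation \<tau> m H \<rho> b v \<noteq> 0"
    using ax vt tau_munit_in_Q
    by (intro bexI[of _ "\<tau> a (munit 0 0)"] bexI[of _ "vtensor x (ket 0)"]) (auto simp: qds_representation_susp)
  fix M assume M: "closed_csubspace M \<and> M \<subseteq> ell2_over H \<and> (\<forall>b\<in>Q. \<forall>v\<in>M. qds_representation \<tau> m H \<rho> b v \<in> M)"
  then have inv: "susp b v \<in> M" if "b \<in> Q" "v \<in> M" for b v
    using that qds_representation_susp[of b v] by force
  show "M = {0} \<or> M = ell2_over H"
  proof (cases "M = {0}")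
    case False
    moreover have "0 \<in> M" using csubspaceD(1)[OF closed_csubspaceD(1)] M by blast
    ultimately obtain v where v: "v \<in> M" "v \<noteq> 0" by blast
    then obtain j where j: "ell2_nth v j \<noteq> 0" using ell2_eqI[of v 0] by auto
    have vH: "v \<in> ell2_over H" using v M by blast
    define L where "L = {x \<in> H. vtensor x (ket 0) \<in> M}"
    have "L = H"
    proof (rule irreducibleD(3)[OF irr _ _ _ _ j])
      show "closed_csubspace L"
        unfolding L_def using M by (intro closed_csubspace_preimage bounded_clinear_on_vtensor) blast
      show "\<rho> a x \<in> L" if "x \<in> L" for a x
        using that inv[OF tau_munit_in_Q[of a 0 0], of "vtensor x (ket 0)"]
          vtensor_in_ell2_over[OF csubspace_H, of x "ket 0"]
        by (simp add: L_def susp_tau_munit rho)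
      show "ell2_nth v j \<in> L"
        using inv[OF tau_munit_in_Q[of 1 0 j] v(1)] vH by (simp add: L_def susp_tau_munit ell2_overD rho_one)
    qed (auto simp: L_def)
    have "ell2_over H \<subseteq> M"
    proof (rule ell2_over_subset)
      fix x j assume x: "x \<in> H"
      then have "vtensor x (ket 0) \<in> M" using \<open>L = H\<close> by (auto simp: L_def)
      from inv[OF tau_munit_in_Q[of 1 j 0] this] show "vtensor x (ket j) \<in> M"
        using x vtensor_in_ell2_over[OF csubspace_H x, of "ket 0"] by (simp add: susp_tau_munit rho_one)
    qed (rule M[THEN conjunct1])
    then show ?thesis using M by blast
  qed simp
qed

end

text \<open>An intertwiner commutes with the action of \<open>eps 0 0\<close>, so it maps the copy
  of \<open>H\<close> at position 0 onto that of \<open>H'\<close>. This restriction is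
  \<open>V\<close>.\<close>

lemma unitarily_equivalent_of_suspended:
  assumes A: "suspended_representation \<tau> m H \<rho>" and B: "suspended_representation \<tau> m H' \<rho>'"
    and eq: "unitarily_equivalent (qds \<tau> m) (ell2_over H) (qds_representation \<tau> m H \<rho>)
      (ell2_over H') (qds_representation \<tau> m H' \<rho>')"
  shows "unitarily_equivalent UNIV H \<rho> H' \<rho>'"
proof -
  interpret A: suspended_representation \<tau> m H \<rho> by (rule A)
  interpret B: suspended_representation \<tau> m H' \<rho>' by (rule B)
  obtain U where U: "intertwining_unitary A.Q (ell2_over H) (qds_representation \<tau> m H \<rho>)
      (ell2_over H') (qds_representation \<tau> m H' \<rho>') U"
    using eq unfolding unitarily_equivalent_iff by blast
  note add = intertwining_unitaryD(1)[OF U] and sc = intertwining_unitaryD(2)[OF U]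
    and iso = intertwining_unitaryD(3)[OF U] and surj = intertwining_unitaryD(4)[OF U]
    and inter = intertwining_unitaryD(5)[OF U] and UH = intertwining_unitaryD(6)[OF U]
  define V where "V x = ell2_nth (U (vtensor x (ket 0))) 0" for x
  have vt: "vtensor x (ket 0) \<in> ell2_over H" if "x \<in> H" for x
    by (rule vtensor_in_ell2_over[OF A.csubspace_H that])
  have vt': "vtensor x (ket 0) \<in> ell2_over H'" if "x \<in> H'" for x
    by (rule vtensor_in_ell2_over[OF B.csubspace_H that])
  have tau: "U (vtensor (\<rho> a (ell2_nth x 0)) (ket 0)) = vtensor (\<rho>' a (ell2_nth (U x) 0)) (ket 0)"
    if x: "x \<in> ell2_over H" for a x
    using inter[OF A.tau_munit_in_Q[of a 0 0] x] x UH[OF x] A.tau_munit_in_Q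
    by (simp add: A.qds_representation_susp B.qds_representation_susp A.susp_tau_munit B.susp_tau_munit)
  have VH: "V x \<in> H'" if "x \<in> H" for x unfolding V_def by (rule B.ell2_overD[OF UH[OF vt[OF that]]])
  have UV: "U (vtensor x (ket 0)) = vtensor (V x) (ket 0)" if "x \<in> H" for x
  proof -
    have "U (vtensor (\<rho> 1 x) (ket 0)) = vtensor (\<rho>' 1 (V x)) (ket 0)"
      using tau[OF vt[OF that], of 1] by (simp add: V_def)
    then show ?thesis by (simp only: A.rho_one[OF that] B.rho_one[OF VH[OF that]])
  qed
  have "V ` H = H'"
  proof (intro equalityI subsetI)
    fix y assume y: "y \<in> H'"
    have "vtensor y (ket 0) \<in> U ` ell2_over H" unfolding surj by (rule vt'[OF y])
    then obtain w where w: "w \<in> ell2_over H" "vtensor y (ket 0) = U w" by (rule imageE)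
    have "U (vtensor (ell2_nth w 0) (ket 0)) = vtensor y (ket 0)"
      using tau[OF w(1), of 1] unfolding w(2)[symmetric] A.rho_one[OF A.ell2_overD[OF w(1)]]
      by (simp add: B.rho_one y)
    then have "V (ell2_nth w 0) = y" by (simp add: V_def)
    then show "y \<in> V ` H" using A.ell2_overD[OF w(1)] by blast
  qed (use VH in auto)
  moreover have "V (x + y) = V x + V y" if "x \<in> H" "y \<in> H" for x y
    by (simp add: V_def vtensor_add_left add vt that)
  moreover have "V (c *\<^sub>C x) = c *\<^sub>C V x" if "x \<in> H" for x c
    by (simp add: V_def vtensor_scaleC_left sc vt that)
  moreover have "cinner (V x) (V y) = cinner x y" if "x \<in> H" "y \<in> H" for x y
    using iso[OF vt[OF that(1)] vt[OF that(2)]]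
    by (simp only: UV[OF that(1)] UV[OF that(2)] cinner_vtensor_same_ket)
  moreover have "V (\<rho> a x) = \<rho>' a (V x)" if "x \<in> H" for a x
    using tau[OF vt[OF that], of a] by (simp add: V_def)
  ultimately show ?thesis unfolding unitarily_equivalent_def by (intro exI[of _ V] conjI ballI allI)
qed

section \<open>The characters\<close>

text \<open>The predicate under the definite description in \<open>qds_character\<close>, named so
  that existence and uniqueness can be treated separately.\<close>

definition is_qds_character ::
  "('a::unital_cstar_algebra \<Rightarrow> complex ell2 bop \<Rightarrow> 'b::cstar_algebra) \<Rightarrow> nat \<Rightarrow> complex \<Rightarrow> ('b \<Rightarrow> complex) \<Rightarrow> bool" where
  "is_qds_character \<tau> m t \<theta> \<longleftrightarrow>
     (\<forall>b\<in>qds \<tau> m. \<forall>d\<in>qds \<tau> m. \<theta> (b + d) = \<theta> b + \<theta> d \<and> \<theta> (b * d) = \<theta> b * \<theta> d) \<and>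
     (\<forall>c. \<forall>b\<in>qds \<tau> m. \<theta> (c *\<^sub>C b) = c * \<theta> b) \<and>
     (\<forall>b\<in>qds \<tau> m. \<theta> (star b) = cnj (\<theta> b)) \<and>
     (\<forall>a. \<forall>k\<in>compact_operators. \<theta> (\<tau> a k) = 0) \<and>
     \<theta> (\<tau> 1 (star left_shift ^ m)) = t \<and>
     (\<forall>b. b \<notin> qds \<tau> m \<longrightarrow> \<theta> b = 0)"

lemma is_qds_characterD:
  assumes "is_qds_character \<tau> m t \<theta>"
  shows "b \<in> qds \<tau> m \<Longrightarrow> d \<in> qds \<tau> m \<Longrightarrow> \<theta> (b + d) = \<theta> b + \<theta> d"
    "b \<in> qds \<tau> m \<Longrightarrow> d \<in> qds \<tau> m \<Longrightarrow> \<theta> (b * d) = \<theta> b * \<theta> d"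
    "b \<in> qds \<tau> m \<Longrightarrow> \<theta> (c *\<^sub>C b) = c * \<theta> b" "b \<in> qds \<tau> m \<Longrightarrow> \<theta> (star b) = cnj (\<theta> b)"
    "k \<in> compact_operators \<Longrightarrow> \<theta> (\<tau> a k) = 0" "\<theta> (\<tau> 1 (star left_shift ^ m)) = t"
    "b \<notin> qds \<tau> m \<Longrightarrow> \<theta> b = 0"
  using assms unfolding is_qds_character_def by blast+

lemma representation_character:
  assumes "is_qds_character \<tau> m t \<theta>"
  shows "representation (qds \<tau> m) UNIV (character_representation \<theta>)"
proof -
  have "\<exists>K. \<forall>x. cmod (\<theta> a) * cmod x \<le> K * cmod x" for a by (rule exI[of _ "cmod (\<theta> a)"]) simp
  then show ?thesis
    unfolding representation_def bounded_operator_on_def character_representation_def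
    by (simp add: closed_csubspace_UNIV is_qds_characterD[OF assms] algebra_simps norm_mult cinner_complex_def)
qed

context torsioned_suspension
begin

lemma is_qds_character_unique:
  assumes "is_qds_character \<tau> m t \<theta>" "is_qds_character \<tau> m t \<theta>'"
  shows "\<theta> = \<theta>'"
proof
  fix b
  have "Q \<subseteq> {b \<in> Q. \<forall>v\<in>UNIV. character_representation \<theta> b v = character_representation \<theta>' b v}"
    using shift_in_Q tau_compact_in_Q[OF munit_compact]
    by (intro Q_subset representation_agreement[OF Q_subalgebra] representation_character[OF assms(1)]
        representation_character[OF assms(2)])
      (simp_all add: character_representation_def shift_def munit_compact
        is_qds_characterD(5,6)[OF assms(1)] is_qds_characterD(5,6)[OF assms(2)])
  then have "\<theta> b = \<theta>' b" if "b \<in> Q" using that by (force simp: character_representation_def)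
  then show "\<theta> b = \<theta>' b"
    using is_qds_characterD(7)[OF assms(1), of b] is_qds_characterD(7)[OF assms(2), of b] by (cases "b \<in> Q") auto
qed

lemma qds_character_eqI: "is_qds_character \<tau> m t \<theta> \<Longrightarrow> qds_character \<tau> m t = \<theta>"
  unfolding qds_character_def
  by (rule the_equality) (auto simp only: is_qds_character_def[symmetric] intro: is_qds_character_unique)

text \<open>Approximate eigenvectors of the shift for the eigenvalue \<open>t\<close>. As they move to infinity, they
  are asymptotically annihilated by the ideal of compact matrices.\<close>

definition eigvec :: "complex \<Rightarrow> nat \<Rightarrow> 'b" where
  "eigvec t N = (1 / sqrt (real N)) *\<^sub>R (\<Sum>n=N..<2 * N. cnj t ^ n *\<^sub>C eps (m * n) 0)"

lemma norm_eps_zero_zero: "norm (eps 0 0) = 1"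
  by (simp flip: phi_one)

context
  fixes t :: complex
  assumes t: "cmod t = 1"
begin

lemma t_cnj: "t * cnj t = 1"
  using complex_norm_square[of t] t by simp

text \<open>For \<open>m > 0\<close> the positions \<open>m * n\<close> are distinct, so the cross
  terms vanish and each of the \<open>N\<close> summands contributes \<open>eps 0 0\<close>.\<close>

lemma norm_eigvec: "N > 0 \<Longrightarrow> norm (eigvec t N) = 1"
proof -
  assume N: "N > 0"
  let ?S = "\<Sum>n=N..<2 * N. cnj t ^ n *\<^sub>C eps (m * n) 0"
  have tn: "cnj t ^ n * t ^ n = 1" for n by (simp add: t_cnj mult.commute flip: power_mult_distrib)
  have "star ?S * ?S = (\<Sum>k=N..<2 * N. eps 0 0)"
    using m_pos by (simp add: star_sum sum_distrib_left sum_distrib_right star_scaleC mult_scaleC_left mult_scaleC_right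
        scaleC_scaleC eps_mult tn if_distrib[of "\<lambda>x. _ *\<^sub>C x"] cong: if_cong)
  also have "\<dots> = real N *\<^sub>R eps 0 0" by (simp add: sum_constant_scaleR)
  finally have "(norm ?S)\<^sup>2 = norm (real N *\<^sub>R eps 0 0)" by (simp only: cstar_identity[symmetric])
  then have "(norm ?S)\<^sup>2 = real N" by (simp only: norm_scaleR norm_eps_zero_zero abs_of_nat mult_1_right)
  then have S: "norm ?S = sqrt (real N)" by (rule real_sqrt_unique[OF _ norm_ge_zero, symmetric])
  show ?thesis unfolding eigvec_def norm_scaleR S using N by simp
qed

lemma norm_eigvec_le: "norm (eigvec t N) \<le> 1"
  using norm_eigvec[of N] by (cases "N = 0") (simp_all add: eigvec_def)

lemma scaleC_sum_right: "c *\<^sub>C (sum f A) = (\<Sum>i\<in>A. c *\<^sub>C f i)"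
  by (induction A rule: infinite_finite_induct) (simp_all add: scaleC_add_right)

text \<open>The shift takes position \<open>m * n\<close> to \<open>m * (n + 1)\<close>, and
  \<open>cnj t\<close> is the inverse of \<open>t\<close>. The difference telescopes to two boundary
  terms of norm at most 1, divided by \<open>sqrt (real N)\<close>.\<close>

lemma shift_eigvec: "(\<lambda>N. shift * eigvec t N - t *\<^sub>C eigvec t N) \<longlonglongrightarrow> 0"
proof (rule Lim_null_comparison)
  define f where "f n = (t * cnj t ^ n) *\<^sub>C eps (m * n) 0" for n
  have ff: "cnj t ^ n *\<^sub>C eps (m * n + m) 0 = f (Suc n)" for n
    using t_cnj by (simp add: f_def add.commute flip: mult.assoc)
  have eq: "shift * eigvec t N - t *\<^sub>C eigvec t N = (1 / sqrt (real N)) *\<^sub>R (f (2 * N) - f N)" for N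
  proof -
    have "shift * eigvec t N = (1 / sqrt (real N)) *\<^sub>R (\<Sum>n=N..<2 * N. f (Suc n))"
      by (simp add: eigvec_def sum_distrib_left mult_scaleC_right shift_eps ff)
    moreover have "t *\<^sub>C eigvec t N = (1 / sqrt (real N)) *\<^sub>R (\<Sum>n=N..<2 * N. f n)"
      by (simp add: eigvec_def scaleC_scaleR scaleC_sum_right scaleC_scaleC f_def)
    moreover have "(\<Sum>n=N..<2 * N. f (Suc n)) - (\<Sum>n=N..<2 * N. f n) = f (2 * N) - f N"
      unfolding sum_subtractf[symmetric] by (rule sum_Suc_diff') simp
    ultimately show ?thesis by (simp flip: scaleR_diff_right)
  qed
  have nf: "norm (f n) \<le> 1" for n using norm_eps_le by (simp add: f_def norm_scaleC norm_mult norm_power t)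
  have "norm (shift * eigvec t N - t *\<^sub>C eigvec t N) \<le> 1 / sqrt (real N) * 2" for N
    unfolding eq norm_scaleR using norm_triangle_ineq4[of "f (2 * N)" "f N"] nf[of N] nf[of "2 * N"]
    by (intro mult_mono) auto
  then show "\<forall>\<^sub>F N in sequentially. norm (shift * eigvec t N - t *\<^sub>C eigvec t N) \<le> 1 / sqrt (real N) * 2"
    by (intro always_eventually allI)
  have "filterlim (\<lambda>N. sqrt (real N)) at_top sequentially"
    by (rule filterlim_compose[OF sqrt_at_top filterlim_real_sequentially])
  from tendsto_mult[OF tendsto_inverse_0_at_top[OF this] tendsto_const[of 2]]
  show "(\<lambda>N. 1 / sqrt (real N) * 2) \<longlonglongrightarrow> 0" by (simp add: inverse_eq_divide)
qed

lemma star_shift_eigvec: "(\<lambda>N. star shift * eigvec t N - cnj t *\<^sub>C eigvec t N) \<longlonglongrightarrow> 0"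
proof -
  \<comment> \<open>Since \<open>shift\<close> is an isometry, applying \<open>star shift\<close> to
    its approximate eigenvalue relation and dividing by \<open>- t\<close> gives the relation for
    the adjoint.\<close>
  have "(\<lambda>N. (- cnj t) *\<^sub>C (star shift * (shift * eigvec t N - t *\<^sub>C eigvec t N))) \<longlonglongrightarrow> (- cnj t) *\<^sub>C (star shift * 0)"
    by (intro tendsto_scaleC tendsto_mult tendsto_const shift_eigvec)
  moreover have "(- cnj t) *\<^sub>C (star shift * (shift * x - t *\<^sub>C x)) = star shift * x - cnj t *\<^sub>C x" for x
  proof -
    have "star shift * (shift * x) = x" by (simp add: shift_isometry unit_mult flip: mult.assoc)
    then show ?thesis using t_cnj
      by (simp add: right_diff_distrib mult_scaleC_right scaleC_diff_right scaleC_scaleC scaleC_minus_left mult.commute)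
  qed
  ultimately show ?thesis by simp
qed

lemma ideal_eigvec: "(\<lambda>N. \<tau> a (munit i j) * eigvec t N) \<longlonglongrightarrow> 0"
proof (rule tendsto_eventually)
  have "\<tau> a (munit i j) * eigvec t N = 0" if N: "N > j" for N
  proof -
    have "munit i j * munit (m * n) 0 = 0" if "n \<ge> N" for n
    proof -
      have "n \<le> m * n" using m_pos by simp
      then have "j \<noteq> m * n" using that N by linarith
      then show ?thesis by (simp add: munit_mult)
    qed
    then have "\<tau> a (munit i j) * eps (m * n) 0 = 0" if "n \<ge> N" for n
      using that by (simp add: eps_def tau_mult munit_in_toeplitz)
    then show ?thesis by (simp add: eigvec_def sum_distrib_left mult_scaleC_right)
  qed
  then show "\<forall>\<^sub>F N in sequentially. \<tau> a (munit i j) * eigvec t N = 0"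
    by (rule eventually_mono[OF eventually_gt_at_top[of j]])
qed

definition eigval :: "'b \<Rightarrow> complex \<Rightarrow> bool" where
  "eigval b c \<longleftrightarrow> (\<lambda>N. b * eigvec t N - c *\<^sub>C eigvec t N) \<longlonglongrightarrow> 0"

text \<open>For \<open>N \<ge> 1\<close> the approximate eigenvectors have norm 1. Applied to
  differences, the bound makes the eigenvalue unique and Lipschitz in \<open>b\<close>.\<close>

lemma eigval_le: "eigval b c \<Longrightarrow> cmod c \<le> norm b"
proof -
  assume "eigval b c"
  then have "(\<lambda>N. norm b + norm (b * eigvec t N - c *\<^sub>C eigvec t N)) \<longlonglongrightarrow> norm b + 0"
    unfolding eigval_def by (intro tendsto_intros tendsto_norm_zero)
  moreover have "cmod c \<le> norm b + norm (b * eigvec t N - c *\<^sub>C eigvec t N)" if "N \<ge> 1" for N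
  proof -
    have "cmod c = norm (c *\<^sub>C eigvec t N)" using that norm_eigvec[of N] by (simp add: norm_scaleC)
    also have "\<dots> \<le> norm (b * eigvec t N) + norm (b * eigvec t N - c *\<^sub>C eigvec t N)"
      using norm_triangle_sub[of "c *\<^sub>C eigvec t N" "b * eigvec t N"] by (simp add: norm_minus_commute)
    also have "norm (b * eigvec t N) \<le> norm b * 1"
      using norm_mult_ineq order_trans mult_left_mono[OF norm_eigvec_le norm_ge_zero] by blast
    finally show ?thesis by simp
  qed
  ultimately show ?thesis by (intro LIMSEQ_le_const[where X = "\<lambda>N. norm b + norm (b * eigvec t N - c *\<^sub>C eigvec t N)"]) auto
qed

lemma eigval_add: "eigval b c \<Longrightarrow> eigval b' c' \<Longrightarrow> eigval (b + b') (c + c')"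
  unfolding eigval_def by (drule (1) tendsto_add) (simp add: algebra_simps scaleC_add_left)

lemma eigval_scaleC: "eigval b c \<Longrightarrow> eigval (d *\<^sub>C b) (d * c)"
  unfolding eigval_def by (drule tendsto_scaleC[of _ _ _ d]) (simp add: mult_scaleC_left scaleC_diff_right scaleC_scaleC)

lemma eigval_mult:
  assumes b: "eigval b c" and b': "eigval b' c'"
  shows "eigval (b * b') (c * c')"
proof -
  have "(\<lambda>N. b * (b' * eigvec t N - c' *\<^sub>C eigvec t N) + c' *\<^sub>C (b * eigvec t N - c *\<^sub>C eigvec t N)) \<longlonglongrightarrow> b * 0 + c' *\<^sub>C 0"
    using b b' unfolding eigval_def by (intro tendsto_add tendsto_mult tendsto_const tendsto_scaleC)
  then show ?thesis
    unfolding eigval_def by (simp add: right_diff_distrib mult_scaleC_right scaleC_diff_right scaleC_scaleC mult_ac)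
qed

lemma eigval_unique: "eigval b c \<Longrightarrow> eigval b c' \<Longrightarrow> c = c'"
  using eigval_le[OF eigval_add[OF _ eigval_scaleC[of b c' "- 1"]], of b c] by (simp add: scaleC_minus_one)

lemma eigval_diff: "eigval b c \<Longrightarrow> eigval b' c' \<Longrightarrow> eigval (b - b') (c - c')"
  using eigval_add[OF _ eigval_scaleC[of b' c' "- 1"], of b c] by (simp add: scaleC_minus_one)

text \<open>Both \<open>b\<close> and \<open>star b\<close> are required: an approximate eigenvector
  of \<open>b\<close> need not be one of \<open>star b\<close>.\<close>

definition eigval_algebra where "eigval_algebra = {b. \<exists>c. eigval b c \<and> eigval (star b) (cnj c)}"

lemma eigval_subalgebra: "cstar_subalgebra eigval_algebra"
proof (rule cstar_subalgebraI)
  show "0 \<in> eigval_algebra"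
    by (auto simp: eigval_algebra_def eigval_def intro!: exI[of _ 0])
  fix x assume x: "x \<in> eigval_algebra"
  then obtain c where c: "eigval x c" "eigval (star x) (cnj c)" unfolding eigval_algebra_def by blast
  show "star x \<in> eigval_algebra"
    using c by (auto simp: eigval_algebra_def star_star intro!: exI[of _ "cnj c"])
  show "d *\<^sub>C x \<in> eigval_algebra" for d
    using eigval_scaleC[OF c(1), of d] eigval_scaleC[OF c(2), of "cnj d"]
    by (auto simp: eigval_algebra_def star_scaleC intro!: exI[of _ "d * c"])
  fix y assume "y \<in> eigval_algebra"
  then obtain d where d: "eigval y d" "eigval (star y) (cnj d)" unfolding eigval_algebra_def by blast
  show "x + y \<in> eigval_algebra"
    using eigval_add[OF c(1) d(1)] eigval_add[OF c(2) d(2)]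
    by (auto simp: eigval_algebra_def star_add intro!: exI[of _ "c + d"])
  show "x * y \<in> eigval_algebra"
    using eigval_mult[OF c(1) d(1)] eigval_mult[OF d(2) c(2)]
    by (auto simp: eigval_algebra_def star_mult mult.commute intro!: exI[of _ "c * d"])
next
  fix X x assume X: "\<And>n. X n \<in> eigval_algebra" "X \<longlonglongrightarrow> x"
  then obtain c where c: "\<And>n. eigval (X n) (c n)" "\<And>n. eigval (star (X n)) (cnj (c n))"
    unfolding eigval_algebra_def mem_Collect_eq by metis
  have "Cauchy c"
  proof (rule metric_CauchyI)
    fix r :: real assume "r > 0"
    moreover have "Cauchy X" using X(2) by (rule LIMSEQ_imp_Cauchy)
    ultimately obtain N where N: "\<And>k l. k \<ge> N \<Longrightarrow> l \<ge> N \<Longrightarrow> dist (X k) (X l) < r"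
      using metric_CauchyD by blast
    have "dist (c k) (c l) \<le> dist (X k) (X l)" for k l
      using eigval_le[OF eigval_diff[OF c(1)[of k] c(1)[of l]]] by (simp add: dist_norm)
    then show "\<exists>N. \<forall>k\<ge>N. \<forall>l\<ge>N. dist (c k) (c l) < r" using N le_less_trans by blast
  qed
  then obtain d where d: "c \<longlonglongrightarrow> d" using Cauchy_convergent_iff convergent_def by blast
  have lim: "eigval y d'" if Y: "\<And>n. eigval (Y n) (e n)" "Y \<longlonglongrightarrow> y" "e \<longlonglongrightarrow> d'" for Y y e d'
  proof -
    define F where "F N p = fst p * eigvec t N - snd p *\<^sub>C eigvec t N" for N and p :: "'b \<times> complex"
    have "(\<lambda>N. F N (y, d')) \<longlonglongrightarrow> 0"
    \<comment> \<open>Element and eigenvalue vary together, so the sequence runs through pairs; each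
      component contributes at most the norm of the pair, whence 2.\<close>
    proof (rule tendsto_zero_closed[where C = 2])
      show "(\<lambda>N. F N (Y k, e k)) \<longlonglongrightarrow> 0" for k using Y(1)[of k] by (simp add: F_def eigval_def)
      show "(\<lambda>n. (Y n, e n)) \<longlonglongrightarrow> (y, d')" by (intro tendsto_Pair Y)
      fix N k
      have "F N (y, d') - F N (Y k, e k) = (y - Y k) * eigvec t N - (d' - e k) *\<^sub>C eigvec t N"
        by (simp add: F_def left_diff_distrib scaleC_left_diff)
      also have "norm \<dots> \<le> norm (y - Y k) * norm (eigvec t N) + cmod (d' - e k) * norm (eigvec t N)"
        using norm_triangle_ineq4 norm_mult_ineq[of "y - Y k" "eigvec t N"]
        by (smt (verit) norm_scaleC)
      also have "\<dots> \<le> norm (y - Y k) * 1 + cmod (d' - e k) * 1"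
        by (intro add_mono mult_left_mono norm_eigvec_le) simp_all
      also have "\<dots> \<le> 2 * norm ((y, d') - (Y k, e k))"
        using norm_fst_le[of "y - Y k" "d' - e k"] norm_snd_le[of "d' - e k" "y - Y k"] by simp
      finally show "norm (F N (y, d') - F N (Y k, e k)) \<le> 2 * norm ((y, d') - (Y k, e k))" .
    qed
    then show ?thesis by (simp add: F_def eigval_def)
  qed
  show "x \<in> eigval_algebra"
    using lim[OF c(1) X(2) d] lim[OF c(2) tendsto_star[OF X(2)] tendsto_cnj[OF d]] unfolding eigval_algebra_def by blast
qed

lemma Q_subset_eigval: "Q \<subseteq> eigval_algebra"
proof (rule Q_subset[OF eigval_subalgebra])
  show "\<tau> a (munit i j) \<in> eigval_algebra" for a i j
    using ideal_eigvec by (auto simp: eigval_algebra_def eigval_def tau_star munit_in_toeplitz intro!: exI[of _ 0])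
  show "shift \<in> eigval_algebra"
    using shift_eigvec star_shift_eigvec unfolding eigval_algebra_def eigval_def by blast
qed

lemma is_qds_character_exists: "\<exists>\<theta>. is_qds_character \<tau> m t \<theta>"
proof -
  define \<theta> where "\<theta> b = (if b \<in> Q then THE c. eigval b c else 0)" for b
  have eqI: "\<theta> b = c" if "b \<in> Q" "eigval b c" for b c
    using that eigval_unique by (auto simp: \<theta>_def)
  have ev: "eigval b (\<theta> b) \<and> eigval (star b) (cnj (\<theta> b))" if b: "b \<in> Q" for b
  proof -
    obtain c where "eigval b c" "eigval (star b) (cnj c)" using Q_subset_eigval b unfolding eigval_algebra_def by blast
    then show ?thesis using eqI[OF b] by simp
  qed
  have "is_qds_character \<tau> m t \<theta>"
    unfolding is_qds_character_def
  proof (intro conjI ballI allI impI)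
    fix b d assume "b \<in> Q" "d \<in> Q"
    then show "\<theta> (b + d) = \<theta> b + \<theta> d" "\<theta> (b * d) = \<theta> b * \<theta> d"
      using ev by (simp_all add: eqI eigval_add eigval_mult Q_closed)
  next
    show "\<theta> (c *\<^sub>C b) = c * \<theta> b" if "b \<in> Q" for b c using ev that by (simp add: eqI eigval_scaleC Q_closed)
    show "\<theta> (star b) = cnj (\<theta> b)" if "b \<in> Q" for b using ev that by (simp add: eqI Q_closed)
    \<comment> \<open>Matrix units have eigenvalue 0, and \<open>\<theta>\<close> is contractive by
      \<open>eigval_le\<close>, so it vanishes on their closed span.\<close>
    have "ideal \<subseteq> {x \<in> Q. \<theta> x = 0}"
    proof (rule ideal_subset)
      have "bounded_clinear_on Q \<theta>"
        unfolding bounded_clinear_on_def using cstar_subalgebraD(3)[OF Q_subalgebra] ev eigval_le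
        by (auto simp: eqI eigval_add eigval_scaleC Q_closed intro!: exI[of _ 1])
      from closed_csubspace_preimage[OF this closed_csubspace_zero]
      show "closed_csubspace {x \<in> Q. \<theta> x = 0}" by simp
      show "\<tau> a (munit i j) \<in> {x \<in> Q. \<theta> x = 0}" for a i j
        using ideal_eigvec tau_compact_in_Q[OF munit_compact] by (simp add: eqI eigval_def)
    qed
    then show "\<theta> (\<tau> a k) = 0" if "k \<in> compact_operators" for a k
      using tau_compact_in_ideal[OF that, of a] by blast
    show "\<theta> (\<tau> 1 (star left_shift ^ m)) = t"
      using shift_in_Q shift_eigvec by (simp add: eqI eigval_def flip: shift_def)
    show "\<theta> b = 0" if "b \<notin> Q" for b using that by (simp add: \<theta>_def)
  qed
  then show ?thesis by blast
qed

lemma is_qds_character: "is_qds_character \<tau> m t (qds_character \<tau> m t)"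
  using is_qds_character_exists qds_character_eqI by metis

lemma qds_character_shift: "qds_character \<tau> m t shift = t"
  unfolding shift_def by (rule is_qds_characterD(6)[OF is_qds_character])

lemma irreducible_character:
  "irreducible_representation Q UNIV (character_representation (qds_character \<tau> m t))"
  unfolding irreducible_representation_def
proof (intro conjI allI impI)
  show "representation Q UNIV (character_representation (qds_character \<tau> m t))"
    by (rule representation_character[OF is_qds_character])
  show "\<exists>a\<in>Q. \<exists>x\<in>UNIV. character_representation (qds_character \<tau> m t) a x \<noteq> 0"
    using t by (intro bexI[of _ shift] bexI[of _ 1] shift_in_Q)
      (auto simp: character_representation_def qds_character_shift)
  fix M :: "complex set"
  assume M: "closed_csubspace M \<and> M \<subseteq> UNIV \<and> (\<forall>a\<in>Q. \<forall>x\<in>M. character_representation (qds_character \<tau> m t) a x \<in> M)"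
  note MM = csubspaceD[OF closed_csubspaceD(1)[OF M[THEN conjunct1]]]
  show "M = {0} \<or> M = UNIV"
  proof (cases "M = {0}")
    case False
    then obtain z where z: "z \<in> M" "z \<noteq> 0" using MM(1) by blast
    have "w \<in> M" for w using MM(3)[OF z(1), of "w / z"] z(2) by simp
    then show ?thesis by blast
  qed simp
qed

end

lemma characters_inequivalent:
  assumes "cmod s = 1" "cmod t = 1"
    and "unitarily_equivalent Q UNIV (character_representation (qds_character \<tau> m s))
         UNIV (character_representation (qds_character \<tau> m t))"
  shows "s = t"
proof -
  obtain U where U: "intertwining_unitary Q UNIV (character_representation (qds_character \<tau> m s))
         UNIV (character_representation (qds_character \<tau> m t)) U"
    using assms(3) unfolding unitarily_equivalent_iff by blast
  note sc = intertwining_unitaryD(2)[OF U] and iso = intertwining_unitaryD(3)[OF U]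
    and inter = intertwining_unitaryD(5)[OF U]
  have "U 1 \<noteq> 0" using iso[of 1 1] by (auto simp: cinner_complex_def)
  moreover have "U s = t * U 1"
    using inter[OF shift_in_Q, of 1] assms(1,2) by (simp add: character_representation_def qds_character_shift)
  moreover have "U s = s * U 1" using sc[of 1 s] by simp
  ultimately show ?thesis by simp
qed

end

text \<open>The character kills every \<open>\<tau> a (munit 0 0)\<close>, whereas some such element
  acts as a nonzero operator under the suspension.\<close>

lemma (in suspended_representation) not_equivalent_character:
  assumes irr: "irreducible_representation UNIV H \<rho>" and t: "cmod t = 1"
  shows "\<not> unitarily_equivalent Q (ell2_over H) (qds_representation \<tau> m H \<rho>)
      UNIV (character_representation (qds_character \<tau> m t))"
proof
  assume "unitarily_equivalent Q (ell2_over H) (qds_representation \<tau> m H \<rho>)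
      UNIV (character_representation (qds_character \<tau> m t))"
  then obtain U where U: "intertwining_unitary Q (ell2_over H) (qds_representation \<tau> m H \<rho>)
      UNIV (character_representation (qds_character \<tau> m t)) U"
    unfolding unitarily_equivalent_iff by blast
  note iso = intertwining_unitaryD(3)[OF U] and inter = intertwining_unitaryD(5)[OF U]
  obtain a x where ax: "x \<in> H" "\<rho> a x \<noteq> 0" using irreducibleD(2)[OF irr] by blast
  have vt: "vtensor x (ket 0) \<in> ell2_over H" by (rule vtensor_in_ell2_over[OF csubspace_H ax(1)])
  have "U (vtensor (\<rho> a x) (ket 0)) = 0"
    using inter[OF tau_munit_in_Q[of a 0 0] vt] is_qds_characterD(5)[OF is_qds_character[OF t] munit_compact]
    by (simp add: qds_representation_susp tau_munit_in_Q vt susp_tau_munit character_representation_def)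
  then have "cinner (\<rho> a x) (\<rho> a x) = 0"
    using iso[of "vtensor (\<rho> a x) (ket 0)" "vtensor (\<rho> a x) (ket 0)"] rho(2)[OF ax(1), of a]
      vtensor_in_ell2_over[OF csubspace_H, of "\<rho> a x" "ket 0"]
    by (simp add: cinner_vtensor_same_ket)
  then show False using ax(2) by (simp add: cinner_self)
qed

section \<open>Separable Hilbert spaces\<close>

text \<open>Polarization: the norm of \<open>x + y\<close> determines the real part, and replacing
  \<open>y\<close> by \<open>\<i> *\<^sub>C y\<close> yields the imaginary part.\<close>

lemma cinner_eq_of_norm_preserving:
  assumes H: "csubspace H" and add: "\<And>x y. x \<in> H \<Longrightarrow> y \<in> H \<Longrightarrow> U (x + y) = U x + U y"
    and sc: "\<And>c x. x \<in> H \<Longrightarrow> U (c *\<^sub>C x) = c *\<^sub>C U x" and n: "\<And>x. x \<in> H \<Longrightarrow> norm (U x) = norm x"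
    and x: "x \<in> H" and y: "y \<in> H"
  shows "cinner (U x) (U y) = cinner x y"
proof -
  have re: "Re (cinner (U x) (U y)) = Re (cinner x y)" if "y \<in> H" for y
    using norm_sq_add[of "U x" "U y"] norm_sq_add[of x y] n[OF csubspaceD(2)[OF H x that]] n[OF x] n[OF that] add[OF x that]
    by simp
  have "Re (cinner (U x) (\<i> *\<^sub>C U y)) = Re (cinner x (\<i> *\<^sub>C y))"
    using re[OF csubspaceD(3)[OF H y]] sc[OF y] by simp
  then have "Im (cinner (U x) (U y)) = Im (cinner x y)"
    by (simp add: cinner_scaleC_right)
  then show ?thesis using re[OF y] by (simp add: complex_eq_iff)
qed

lemma norm_eq_of_cinner: "cinner u u = cinner x x \<Longrightarrow> norm u = norm x"
  by (simp add: cinner_self flip: of_real_power)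

lemma closed_isometric_image:
  fixes U :: "'h::chilbert_space \<Rightarrow> 'k::chilbert_space"
  assumes H: "closed_csubspace H" and add: "\<And>x y. x \<in> H \<Longrightarrow> y \<in> H \<Longrightarrow> U (x + y) = U x + U y"
    and sc: "\<And>c x. x \<in> H \<Longrightarrow> U (c *\<^sub>C x) = c *\<^sub>C U x"
    and iso: "\<And>x y. x \<in> H \<Longrightarrow> y \<in> H \<Longrightarrow> cinner (U x) (U y) = cinner x y"
  shows "bounded_clinear_on H U" "closed_csubspace (U ` H)"
proof -
  note HH = csubspaceD[OF closed_csubspaceD(1)[OF H]]
  have n: "norm (U x) = norm x" if "x \<in> H" for x using iso[OF that that] by (rule norm_eq_of_cinner)
  show b: "bounded_clinear_on H U"
    unfolding bounded_clinear_on_def using H add sc n by (auto intro!: exI[of _ 1])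
  show "closed_csubspace (U ` H)"
  proof (rule closed_csubspaceI)
    show "0 \<in> U ` H" using bounded_clinear_onD(5)[OF b] HH(1) by (metis imageI)
    show "x + y \<in> U ` H" if "x \<in> U ` H" "y \<in> U ` H" for x y
      using that add HH(2) by (auto simp: image_iff) metis
    show "c *\<^sub>C x \<in> U ` H" if "x \<in> U ` H" for c x
      using that sc HH(3) by (auto simp: image_iff) metis
    fix X x assume X: "\<And>n. X n \<in> U ` H" "X \<longlonglongrightarrow> x"
    then have "\<forall>n. \<exists>z\<in>H. X n = U z" by blast
    then obtain Z where Z: "\<And>n. Z n \<in> H" "\<And>n. X n = U (Z n)" by metis
    have deq: "dist (Z k) (Z l) = dist (X k) (X l)" for k l
      using n[OF HH(5)[OF Z(1)[of k] Z(1)[of l]]] bounded_clinear_onD(4)[OF b Z(1)[of k] Z(1)[of l]]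
      by (simp add: dist_norm Z(2))
    have "Cauchy Z" using LIMSEQ_imp_Cauchy[OF X(2)] unfolding Cauchy_def deq .
    then have "convergent Z" by (rule Cauchy_convergent)
    then obtain z where z: "Z \<longlonglongrightarrow> z" unfolding convergent_def ..
    have XZ: "X = (\<lambda>n. U (Z n))" by (rule ext) (rule Z(2))
    have "X \<longlonglongrightarrow> U z" unfolding XZ by (rule bounded_clinear_on_tendsto(2)[OF b Z(1) z])
    then have "x = U z" by (rule LIMSEQ_unique[OF X(2)])
    then show "x \<in> U ` H" using bounded_clinear_on_tendsto(1)[OF b Z(1) z] by blast
  qed
qed

text \<open>Vectors that depend linearly on their predecessors are sent to \<open>0\<close>, since \<open>1 / 0 = 0\<close>.\<close>

fun gram_schmidt :: "(nat \<Rightarrow> 'h::chilbert_space) \<Rightarrow> nat \<Rightarrow> 'h" where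
  "gram_schmidt d n =
     (let r = d n - (\<Sum>k<n. cinner (gram_schmidt d k) (d n) *\<^sub>C gram_schmidt d k) in (1 / norm r) *\<^sub>R r)"

declare gram_schmidt.simps [simp del]

context
  fixes d :: "nat \<Rightarrow> 'h::chilbert_space"
begin

abbreviation "gs \<equiv> gram_schmidt d"

definition residue where "residue n = d n - (\<Sum>k<n. cinner (gs k) (d n) *\<^sub>C gs k)"

lemma gs_residue: "gs n = (1 / norm (residue n)) *\<^sub>R residue n"
  by (subst gram_schmidt.simps) (simp add: Let_def residue_def)

lemma norm_gs: "gs n = 0 \<or> norm (gs n) = 1"
  by (simp add: gs_residue)

lemma gs_orthogonal_less: "j < n \<Longrightarrow> cinner (gs j) (gs n) = 0"
proof (induction n arbitrary: j rule: less_induct)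
  case (less n)
  have orth: "cinner (gs j) (gs k) = 0" if "k < n" "k \<noteq> j" for k
  proof (cases "j < k")
    case False
    then have "cinner (gs k) (gs j) = 0" using less that by simp
    then show ?thesis using cinner_commute[of "gs j" "gs k"] by simp
  qed (use less that in simp)
  have "(\<Sum>k<n. cinner (gs k) (d n) * cinner (gs j) (gs k)) = (\<Sum>k\<in>{j}. cinner (gs k) (d n) * cinner (gs j) (gs k))"
    using less.prems orth by (intro sum.mono_neutral_right) auto
  then have "cinner (gs j) (residue n) = cinner (gs j) (d n) - cinner (gs j) (d n) * cinner (gs j) (gs j)"
    by (simp add: residue_def cinner_diff_right cinner_sum_right cinner_scaleC_right)
  also have "\<dots> = 0" using norm_gs[of j] by (auto simp: cinner_self)
  finally show ?case by (subst (2) gs_residue) (simp add: scaleR_scaleC_def cinner_scaleC_right)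
qed

lemma gs_orthogonal: "j \<noteq> k \<Longrightarrow> cinner (gs j) (gs k) = 0"
  using gs_orthogonal_less[of j k] gs_orthogonal_less[of k j] cinner_commute[of "gs j" "gs k"]
  by (cases "j < k") auto

definition gs_part where "gs_part n x = (\<Sum>k<n. cinner (gs k) x *\<^sub>C gs k)"

lemma cinner_gs_part: "j < n \<Longrightarrow> cinner (gs j) (gs_part n x) = cinner (gs j) x"
proof -
  assume "j < n"
  have "(\<Sum>k<n. cinner (gs k) x * cinner (gs j) (gs k)) = (\<Sum>k\<in>{j}. cinner (gs k) x * cinner (gs j) (gs k))"
    using \<open>j < n\<close> by (intro sum.mono_neutral_right) (auto simp: gs_orthogonal)
  then show ?thesis using norm_gs[of j]
    by (auto simp: gs_part_def cinner_sum_right cinner_scaleC_right cinner_self)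
qed

lemma norm_sq_gs_part: "(norm (gs_part n x))\<^sup>2 = (\<Sum>k<n. (cmod (cinner (gs k) x))\<^sup>2)"
proof -
  have "cinner (gs_part n x) (gs_part n x) = (\<Sum>k<n. cnj (cinner (gs k) x) * cinner (gs k) (gs_part n x))"
    by (subst (1) gs_part_def) (simp add: cinner_sum_left cinner_scaleC_left)
  also have "\<dots> = (\<Sum>k<n. complex_of_real ((cmod (cinner (gs k) x))\<^sup>2))"
    by (intro sum.cong refl) (simp add: cinner_gs_part complex_norm_square mult.commute del: of_real_power)
  finally show ?thesis
    unfolding cinner_self of_real_sum[symmetric] of_real_eq_iff .
qed

lemma bessel: "(\<Sum>k<n. (cmod (cinner (gs k) x))\<^sup>2) \<le> (norm x)\<^sup>2"
proof -
  have "cinner (gs_part n x) (x - gs_part n x) = 0"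
    by (subst (1) gs_part_def) (simp add: cinner_sum_left cinner_scaleC_left cinner_diff_right cinner_gs_part)
  then have "(norm x)\<^sup>2 = (norm (gs_part n x))\<^sup>2 + (norm (x - gs_part n x))\<^sup>2"
    using norm_sq_add[of "gs_part n x" "x - gs_part n x"] by simp
  then show ?thesis unfolding norm_sq_gs_part using zero_le_power2[of "norm (x - gs_part n x)"] by linarith
qed

text \<open>\<open>d n\<close> lies in the span of the first \<open>Suc n\<close> vectors, so
  Bessel's inequality becomes an equality at the generators.\<close>

lemma gs_part_generator: "gs_part (Suc n) (d n) = d n"
proof -
  have d: "d n = gs_part n (d n) + residue n" by (simp add: residue_def gs_part_def)
  have "cinner (gs n) (gs_part n (d n)) = 0"
    unfolding gs_part_def cinner_sum_right by (intro sum.neutral) (simp add: cinner_scaleC_right gs_orthogonal)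
  then have "cinner (gs n) (d n) = cinner (gs n) (residue n)"
    by (subst d) (simp add: cinner_add_right)
  also have "\<dots> = complex_of_real (norm (residue n))"
    by (simp add: gs_residue cinner_scaleR_left cinner_self power2_eq_square)
  finally have "cinner (gs n) (d n) *\<^sub>C gs n = residue n"
    by (simp add: gs_residue scaleC_of_real)
  then show ?thesis using d by (simp add: gs_part_def)
qed

text \<open>\<open>W\<close> takes Fourier coefficients. Bessel makes it contractive everywhere; it
  preserves the norm of each \<open>d n\<close>, hence by continuity of every vector in the closure
  of \<open>range d\<close>. The \<open>d n\<close> may lie outside \<open>L\<close>.\<close>

lemma separable_embedding:
  assumes L: "closed_csubspace L" and d: "L \<subseteq> closure (range d)"
  shows "\<exists>W :: 'h \<Rightarrow> complex ell2. (\<forall>x\<in>L. \<forall>y\<in>L. W (x + y) = W x + W y) \<and>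
    (\<forall>c. \<forall>x\<in>L. W (c *\<^sub>C x) = c *\<^sub>C W x) \<and> (\<forall>x\<in>L. \<forall>y\<in>L. cinner (W x) (W y) = cinner x y)"
proof -
  define W where "W x = Abs_ell2 (\<lambda>k. cinner (gs k) x)" for x
  have sm: "summable (\<lambda>k. (cmod (cinner (gs k) x))\<^sup>2)" for x
    by (rule summableI_nonneg_bounded[OF _ bessel]) simp
  have nth: "ell2_nth (W x) k = cinner (gs k) x" for x k
    using sm by (simp add: W_def Abs_ell2_inverse)
  have add: "W (x + y) = W x + W y" for x y by (rule ell2_eqI) (simp add: nth cinner_add_right)
  have sc: "W (c *\<^sub>C x) = c *\<^sub>C W x" for c x by (rule ell2_eqI) (simp add: nth cinner_scaleC_right)
  have le: "norm (W x) \<le> norm x" for x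
  proof (rule power2_le_imp_le)
    show "(norm (W x))\<^sup>2 \<le> (norm x)\<^sup>2"
      unfolding norm_sq_ell2 nth by (rule suminf_le_const[OF sm bessel])
  qed simp
  have W: "bounded_clinear_on UNIV W"
    unfolding bounded_clinear_on_def using le
    by (auto simp: add sc closed_csubspace_UNIV intro!: exI[of _ 1])
  have gen: "norm (W (d n)) = norm (d n)" for n
  proof (rule antisym[OF le power2_le_imp_le])
    have "(norm (d n))\<^sup>2 = (\<Sum>k<Suc n. (cmod (cinner (gs k) (d n)))\<^sup>2)"
      unfolding norm_sq_gs_part[symmetric] gs_part_generator ..
    also have "\<dots> \<le> (norm (W (d n)))\<^sup>2"
      unfolding norm_sq_ell2 nth by (rule sum_le_suminf[OF sm]) auto
    finally show "(norm (d n))\<^sup>2 \<le> (norm (W (d n)))\<^sup>2" .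
  qed simp
  have n: "norm (W x) = norm x" if x: "x \<in> L" for x
  proof -
    obtain X where X: "\<forall>n. X n \<in> range d" "X \<longlonglongrightarrow> x"
      using x d unfolding closure_sequential[symmetric] by (metis closure_sequential subsetD)
    have "(\<lambda>n. norm (W (X n))) \<longlonglongrightarrow> norm (W x)"
      by (intro tendsto_norm bounded_clinear_on_tendsto(2)[OF W _ X(2)]) simp
    moreover have "norm (W (X n)) = norm (X n)" for n using X(1) gen by (metis rangeE)
    moreover have "(\<lambda>n. norm (X n)) \<longlonglongrightarrow> norm x" by (intro tendsto_norm X)
    ultimately show ?thesis using LIMSEQ_unique by simp
  qed
  show ?thesis
    using cinner_eq_of_norm_preserving[OF closed_csubspaceD(1)[OF L], of W, OF add sc n]
    by (intro exI[of _ W]) (simp add: add sc)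
qed

end

section \<open>Unitary equivalence\<close>

lemma intertwining_unitary_clinear:
  assumes "intertwining_unitary D H \<pi> K \<sigma> U" "closed_csubspace H"
  shows "bounded_clinear_on H U" "closed_csubspace K"
  using closed_isometric_image[OF assms(2), of U] intertwining_unitaryD[OF assms(1)] by auto

lemma intertwining_unitary_trans:
  assumes "intertwining_unitary D H \<pi> K \<sigma> U" "intertwining_unitary D K \<sigma> L \<rho> V"
  shows "intertwining_unitary D H \<pi> L \<rho> (\<lambda>x. V (U x))"
proof -
  note U = intertwining_unitaryD[OF assms(1)] and V = intertwining_unitaryD[OF assms(2)]
  have "(\<lambda>x. V (U x)) ` H = L" using U(4) V(4) by (simp flip: image_image)
  then show ?thesis unfolding intertwining_unitary_def by (simp add: U(1-3,5,6) V(1-3,5))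
qed

text \<open>Carries the compressed representation into \<open>complex ell2\<close>. An isometry on
  \<open>L\<close> is injective with closed range, so conjugation by it preserves closed invariant
  subspaces.\<close>

lemma irreducible_transport:
  assumes irr: "irreducible_representation D L \<sigma>" and D: "\<And>a. a \<in> D \<Longrightarrow> star a \<in> D"
    and W: "\<And>x y. x \<in> L \<Longrightarrow> y \<in> L \<Longrightarrow> W (x + y) = W x + W y" "\<And>c x. x \<in> L \<Longrightarrow> W (c *\<^sub>C x) = c *\<^sub>C W x"
    "\<And>x y. x \<in> L \<Longrightarrow> y \<in> L \<Longrightarrow> cinner (W x) (W y) = cinner x y"
  shows "\<exists>\<sigma>'. irreducible_representation D (W ` L) \<sigma>' \<and> intertwining_unitary D L \<sigma> (W ` L) \<sigma>' W"
proof -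
  note R = representationD[OF irreducibleD(1)[OF irr]]
  note LL = csubspaceD[OF closed_csubspaceD(1)[OF R(1)]]
  note C = closed_isometric_image[OF R(1), of W, OF W]
  have n: "norm (W x) = norm x" if "x \<in> L" for x using W(3)[OF that that] by (rule norm_eq_of_cinner)
  have inj: "x = y" if "x \<in> L" "y \<in> L" "W x = W y" for x y
    using n[OF LL(5)[OF that(1,2)]] bounded_clinear_onD(4)[OF C(1) that(1,2)] that(3) by simp
  define \<sigma>' where "\<sigma>' a y = W (\<sigma> a (inv_into L W y))" for a y
  have inv: "inv_into L W (W x) = x" if "x \<in> L" for x
    using that inj by (simp add: inj_on_def inv_into_f_f)
  have \<sigma>': "\<sigma>' a (W x) = W (\<sigma> a x)" if "x \<in> L" for a x by (simp add: \<sigma>'_def inv that)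
  have iu: "intertwining_unitary D L \<sigma> (W ` L) \<sigma>' W"
    unfolding intertwining_unitary_def using W \<sigma>' by auto
  have bnd: "\<exists>k. \<forall>x\<in>L. norm (\<sigma> a x) \<le> k * norm x" if "a \<in> D" for a
    by (rule bounded_clinear_onD(6)[OF bounded_clinear_on_representation[OF irreducibleD(1)[OF irr] that]])
  have "representation D (W ` L) \<sigma>'"
    unfolding representation_def bounded_operator_on_def ball_simps(9)
    using C(2) bnd by (auto simp: \<sigma>' R n W LL D simp flip: W(1,2))
  moreover have "\<exists>a\<in>D. \<exists>y\<in>W ` L. \<sigma>' a y \<noteq> 0"
  proof -
    obtain a x where ax: "a \<in> D" "x \<in> L" "\<sigma> a x \<noteq> 0" using irreducibleD(2)[OF irr] by blast
    have "norm (\<sigma>' a (W x)) = norm (\<sigma> a x)" using n[OF R(2)[OF ax(1,2)]] by (simp add: \<sigma>' ax)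
    then have "\<sigma>' a (W x) \<noteq> 0" using ax(3) by auto
    then show ?thesis using ax by blast
  qed
  moreover have "M = {0} \<or> M = W ` L"
    if M: "closed_csubspace M" "M \<subseteq> W ` L" "\<forall>a\<in>D. \<forall>x\<in>M. \<sigma>' a x \<in> M" for M
  proof (cases "M = {0}")
    case False
    then obtain y where y: "y \<in> M" "y \<noteq> 0" using csubspaceD(1)[OF closed_csubspaceD(1)[OF M(1)]] by blast
    then obtain x where x: "x \<in> L" "y = W x" using M(2) by blast
    have "x \<noteq> 0" using y(2) x bounded_clinear_onD(5)[OF C(1)] by auto
    have "{x \<in> L. W x \<in> M} = L"
    proof (rule irreducibleD(3)[OF irr _ _ _ _ \<open>x \<noteq> 0\<close>])
      show "closed_csubspace {x \<in> L. W x \<in> M}" by (rule closed_csubspace_preimage[OF C(1) M(1)])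
      show "\<sigma> a z \<in> {x \<in> L. W x \<in> M}" if "a \<in> D" "z \<in> {x \<in> L. W x \<in> M}" for a z
        using that M(3)[rule_format, of a "W z"] \<sigma>'[of z a] R(2) by auto
    qed (use x y in auto)
    then show ?thesis using M(2) by blast
  qed simp
  ultimately show ?thesis unfolding irreducible_representation_def using iu by blast
qed

section \<open>Completeness\<close>

locale irreducible_suspension_representation = torsioned_suspension \<tau> m
  for \<tau> :: "'a::unital_cstar_algebra \<Rightarrow> complex ell2 bop \<Rightarrow> 'b::cstar_algebra" and m +
  fixes K :: "'k::chilbert_space set" and \<pi> :: "'b \<Rightarrow> 'k \<Rightarrow> 'k"
  assumes irr: "irreducible_representation (qds \<tau> m) K \<pi>"
begin

lemmas pi_rep = irreducibleD(1)[OF irr]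
lemmas pi = representationD[OF pi_rep]
lemmas K_closed = csubspaceD[OF closed_csubspaceD(1)[OF pi(1)]]
lemmas pi_clinear = bounded_clinear_on_representation[OF pi_rep]
lemmas pi_zero = representation_zero[OF pi_rep cstar_subalgebraD(1)[OF Q_subalgebra]]
lemmas pi_clinear_left = bounded_clinear_on_representation_left[OF Q_subalgebra pi_rep]
lemmas pi_diff_left = bounded_clinear_onD(4)[OF pi_clinear_left]
lemmas pi_tendsto_left = bounded_clinear_on_tendsto(2)[OF pi_clinear_left]

lemma in_Q: "\<tau> a (munit i j) \<in> Q" "eps i j \<in> Q" "proj n \<in> Q" "phi a \<in> Q"
  using tau_munit_in_ideal eps_in_ideal proj_in_ideal ideal_subset_Q by (auto simp: phi_def)

lemma pi_unit: "x \<in> K \<Longrightarrow> \<pi> unit x = x"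
  by (rule irreducible_unit[OF irr Q_subalgebra unit_in_Q]) (simp_all add: unit_mult)

lemma cinner_ext_K:
  assumes "u \<in> K" "v \<in> K" "\<And>y. y \<in> K \<Longrightarrow> cinner u y = cinner v y"
  shows "u = v"
proof -
  have "cinner (u - v) (u - v) = 0"
    using assms(3)[OF K_closed(5)[OF assms(1,2)]] by (simp add: cinner_diff_left)
  then show ?thesis by (simp add: cinner_self)
qed

text \<open>\<open>G\<close> is closed under \<open>star\<close> because commutation of
  \<open>star b\<close> with \<open>g\<close> is verified by moving both operators across the inner
  product, which involves \<open>star g\<close>.\<close>

lemma commutant_subalgebra:
  assumes G: "G \<subseteq> Q" "\<And>g. g \<in> G \<Longrightarrow> star g \<in> G"
  shows "cstar_subalgebra {b \<in> Q. \<forall>g\<in>G. \<forall>x\<in>K. \<pi> b (\<pi> g x) = \<pi> g (\<pi> b x)}" (is "cstar_subalgebra ?C")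
proof (rule cstar_subalgebraI)
  have GQ: "g \<in> Q" if "g \<in> G" for g using G that by blast
  show "0 \<in> ?C" using GQ by (simp add: Q_closed pi_zero pi)
  fix b assume b: "b \<in> ?C"
  then have bQ: "b \<in> Q" by simp
  show "c *\<^sub>C b \<in> ?C" for c using b GQ by (simp add: Q_closed pi)
  have "\<pi> (star b) (\<pi> g x) = \<pi> g (\<pi> (star b) x)" if g: "g \<in> G" and x: "x \<in> K" for g x
  proof (rule cinner_ext_K)
    fix y assume y: "y \<in> K"
    have sg: "star g \<in> G" "star g \<in> Q" using G g by auto
    have "cinner (\<pi> (star b) (\<pi> g x)) y = cinner (\<pi> g x) (\<pi> b y)" using GQ[OF g] bQ x y by (simp add: pi)
    also have "\<dots> = cinner x (\<pi> (star g) (\<pi> b y))"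
      using pi(8)[OF sg(2) x pi(2)[OF bQ y]] by (simp add: star_star)
    also have "\<pi> (star g) (\<pi> b y) = \<pi> b (\<pi> (star g) y)" using b sg y by simp
    also have "cinner x \<dots> = cinner (\<pi> (star b) x) (\<pi> (star g) y)"
      using pi(8)[OF bQ x pi(2)[OF sg(2) y]] by simp
    also have "\<dots> = cinner (\<pi> g (\<pi> (star b) x)) y"
      using pi(8)[OF sg(2) pi(2)[OF Q_closed(8)[OF bQ] x] y] by (simp add: star_star)
    finally show "cinner (\<pi> (star b) (\<pi> g x)) y = cinner (\<pi> g (\<pi> (star b) x)) y" .
  qed (use GQ[OF g] bQ x in \<open>simp_all add: pi Q_closed\<close>)
  then show "star b \<in> ?C" using bQ by (simp add: Q_closed)
  fix d assume d: "d \<in> ?C"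
  show "b + d \<in> ?C" using b d GQ by (simp add: Q_closed pi)
  show "b * d \<in> ?C" using b d GQ by (simp add: Q_closed pi)
next
  fix X x assume X: "\<And>n. X n \<in> ?C" "X \<longlonglongrightarrow> x"
  then have XQ: "\<And>n. X n \<in> Q" by simp
  have xQ: "x \<in> Q" by (rule closed_csubspace_limit[OF cstar_subalgebraD(3)[OF Q_subalgebra] XQ X(2)])
  have "\<pi> x (\<pi> g v) = \<pi> g (\<pi> x v)" if g: "g \<in> G" and v: "v \<in> K" for g v
  proof (rule LIMSEQ_unique)
    have gQ: "g \<in> Q" using G g by blast
    show "(\<lambda>n. \<pi> (X n) (\<pi> g v)) \<longlonglongrightarrow> \<pi> x (\<pi> g v)"
      by (rule pi_tendsto_left[OF pi(2)[OF gQ v] XQ X(2)])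
    have "(\<lambda>n. \<pi> g (\<pi> (X n) v)) \<longlonglongrightarrow> \<pi> g (\<pi> x v)"
      by (rule bounded_clinear_on_tendsto(2)[OF pi_clinear[OF gQ] pi(2)[OF XQ v] pi_tendsto_left[OF v XQ X(2)]])
    then show "(\<lambda>n. \<pi> (X n) (\<pi> g v)) \<longlonglongrightarrow> \<pi> g (\<pi> x v)" using X(1) g v by simp
  qed
  then show "x \<in> ?C" using xQ by simp
qed

subsection \<open>Representations that vanish on the ideal\<close>

context
  assumes killed: "\<And>a i j x. x \<in> K \<Longrightarrow> \<pi> (\<tau> a (munit i j)) x = 0"
begin

lemma ideal_killed: "b \<in> ideal \<Longrightarrow> x \<in> K \<Longrightarrow> \<pi> b x = 0"
proof -
  assume b: "b \<in> ideal" and x: "x \<in> K"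
  have "ideal \<subseteq> {b \<in> Q. \<pi> b x \<in> {0}}"
    by (rule ideal_subset[OF closed_csubspace_preimage[OF pi_clinear_left[OF x] closed_csubspace_zero]])
      (simp add: killed x in_Q)
  then show ?thesis using b by blast
qed

text \<open>Two rounds of induction over generators. Matrix units act as zero and
  \<open>shift\<close> as a unitary, so first all of \<open>Q\<close> commutes with
  \<open>shift\<close> and its adjoint. Read the other way, \<open>shift\<close> commutes with all
  of \<open>Q\<close>, and so do the matrix units.\<close>

lemma commutative:
  assumes b: "b \<in> Q" and d: "d \<in> Q" and x: "x \<in> K"
  shows "\<pi> b (\<pi> d x) = \<pi> d (\<pi> b x)"
proof -
  have sQ: "star shift \<in> Q" using shift_in_Q by (simp add: Q_closed)
  have s: "\<pi> shift (\<pi> (star shift) x) = x" "\<pi> (star shift) (\<pi> shift x) = x" if x: "x \<in> K" for x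
  proof -
    have "\<pi> shift (\<pi> (star shift) x) = \<pi> (unit - proj m) x"
      using pi(7)[OF shift_in_Q sQ x] by (simp add: shift_range)
    also have "\<dots> = x"
      using x by (simp add: pi_diff_left unit_in_Q in_Q pi_unit ideal_killed proj_in_ideal)
    finally show "\<pi> shift (\<pi> (star shift) x) = x" .
    show "\<pi> (star shift) (\<pi> shift x) = x"
      using pi(7)[OF sQ shift_in_Q x] by (simp add: shift_isometry pi_unit x)
  qed
  have z: "\<pi> (\<tau> a (munit i j)) (\<pi> g x) = \<pi> g (\<pi> (\<tau> a (munit i j)) x)" if "g \<in> Q" "x \<in> K" for a i j g x
    using that by (simp add: killed pi pi_zero)
  have 1: "Q \<subseteq> {b \<in> Q. \<forall>g\<in>{shift, star shift}. \<forall>x\<in>K. \<pi> b (\<pi> g x) = \<pi> g (\<pi> b x)}"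
    using shift_in_Q sQ by (intro Q_subset[OF commutant_subalgebra]) (auto simp: star_star z in_Q s)
  have "Q \<subseteq> {b \<in> Q. \<forall>g\<in>Q. \<forall>x\<in>K. \<pi> b (\<pi> g x) = \<pi> g (\<pi> b x)}"
  proof (rule Q_subset[OF commutant_subalgebra])
    have "\<pi> shift (\<pi> g x) = \<pi> g (\<pi> shift x)" if "g \<in> Q" "x \<in> K" for g x
      using subsetD[OF 1 that(1)] that(2) by simp
    then show "shift \<in> {b \<in> Q. \<forall>g\<in>Q. \<forall>x\<in>K. \<pi> b (\<pi> g x) = \<pi> g (\<pi> b x)}" using shift_in_Q by simp
  qed (simp_all add: Q_closed z in_Q)
  then show ?thesis using b d x by blast
qed

text \<open>The closed sets of \<open>c\<close> for which the positive and the negative part of \<open>h - c\<close> act as zero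
  cover the line by irreducibility, so they meet.\<close>

lemma selfadjoint_scalar:
  assumes hQ: "h \<in> Q" and h: "star h = h"
  shows "\<exists>c. \<forall>x\<in>K. \<pi> h x = complex_of_real c *\<^sub>C x"
proof -
  define r where "r = norm h + 1"
  have hr: "norm h < r" by (simp add: r_def)
  note fc = projection_unit(1) projection_unit(2)[of h] h hr
  define f where "f c s = max (s - c) 0" for c s :: real
  define g where "g c s = max (c - s) 0" for c s :: real
  have ex: "\<exists>F\<in>Q. is_fc unit h r (\<lambda>s. complex_of_real (k s)) F" if "continuous_on {- r..r} k" for k
    by (rule is_fc_exists[OF fc that Q_subalgebra unit_in_Q hQ])
  have cf: "continuous_on {- r..r} (f c)" and cg: "continuous_on {- r..r} (g c)" for c
    unfolding f_def g_def by (intro continuous_intros)+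
  obtain F where F: "\<And>c. F c \<in> Q" "\<And>c. is_fc unit h r (\<lambda>s. complex_of_real (f c s)) (F c)"
    using ex[OF cf] by metis
  obtain G where G: "\<And>c. G c \<in> Q" "\<And>c. is_fc unit h r (\<lambda>s. complex_of_real (g c s)) (G c)"
    using ex[OF cg] by metis
  have bd: "bounded ((\<lambda>s. complex_of_real (k s)) ` {- r..r})" if "continuous_on {- r..r} k" for k
    using that by (intro compact_imp_bounded compact_continuous_image continuous_intros) auto
  \<comment> \<open>The functions change by at most \<open>\<bar>c - c'\<bar>\<close> uniformly in
    \<open>s\<close>, and the functional calculus is isometric enough to pass this on to
    \<open>F\<close> and \<open>G\<close>.\<close>
  have lip: "norm (Y c - Y c') \<le> \<bar>c - c'\<bar>"
    if "\<And>c. is_fc unit h r (\<lambda>s. complex_of_real (y c s)) (Y c)" "\<And>c c' s. \<bar>y c s - y c' s\<bar> \<le> \<bar>c - c'\<bar>" for y Y c c'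
    by (rule is_fc_norm_le[OF is_fc_diff[OF that(1) that(1)] fc]) (use that(2) in \<open>simp flip: of_real_diff\<close>)
  have closed: "closed {c. \<forall>x\<in>K. \<pi> (Y c) x = 0}" if Y: "\<And>c. Y c \<in> Q" "\<And>c c'. norm (Y c - Y c') \<le> \<bar>c - c'\<bar>" for Y :: "real \<Rightarrow> 'b"
  proof (unfold closed_sequential_limits, intro allI impI, elim conjE)
    fix C c assume C: "\<forall>n. C n \<in> {c. \<forall>x\<in>K. \<pi> (Y c) x = 0}" "C \<longlonglongrightarrow> c"
    have "(\<lambda>n. Y (C n)) \<longlonglongrightarrow> Y c"
    proof (rule LIM_zero_cancel, rule Lim_null_comparison)
      show "\<forall>\<^sub>F n in sequentially. norm (Y (C n) - Y c) \<le> \<bar>C n - c\<bar>" using Y(2) by simp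
      show "(\<lambda>n. \<bar>C n - c\<bar>) \<longlonglongrightarrow> 0" using LIM_zero[OF C(2)] by (rule tendsto_rabs_zero)
    qed
    then have "(\<lambda>n. \<pi> (Y (C n)) x) \<longlonglongrightarrow> \<pi> (Y c) x" if "x \<in> K" for x
      by (intro pi_tendsto_left that Y)
    then show "c \<in> {c. \<forall>x\<in>K. \<pi> (Y c) x = 0}" using C(1) by (simp add: LIMSEQ_const_iff)
  qed
  define A where "A = {c. \<forall>x\<in>K. \<pi> (F c) x = 0}"
  define B where "B = {c. \<forall>x\<in>K. \<pi> (G c) x = 0}"
  have "closed A" unfolding A_def by (rule closed[OF F(1) lip[OF F(2)]]) (auto simp: f_def)
  moreover have "closed B" unfolding B_def by (rule closed[OF G(1) lip[OF G(2)]]) (auto simp: g_def)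
  moreover have "UNIV \<subseteq> A \<union> B"
  proof
    fix c :: real
    \<comment> \<open>The two parts have product 0, so a nonzero value of \<open>\<pi> (F c)\<close>
      lies in the kernel of \<open>\<pi> (G c)\<close>. By commutativity this kernel is invariant,
      hence all of \<open>K\<close>.\<close>
    have "norm (G c * F c) \<le> 0"
      by (rule is_fc_norm_le[OF is_fc_mult[OF G(2) F(2) fc(1,2) bd[OF cg] bd[OF cf]] fc]) (auto simp: f_def g_def max_def)
    then have GF: "G c * F c = 0" by simp
    show "c \<in> A \<union> B"
    proof (cases "c \<in> A")
      case False
      then obtain x where x: "x \<in> K" "\<pi> (F c) x \<noteq> 0" by (auto simp: A_def)
      have "{x \<in> K. \<pi> (G c) x \<in> {0}} = K"
      proof (rule irreducibleD(3)[OF irr _ _ _ _ x(2)])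
        show "closed_csubspace {x \<in> K. \<pi> (G c) x \<in> {0}}"
          by (rule closed_csubspace_preimage[OF pi_clinear[OF G(1)] closed_csubspace_zero])
        show "\<pi> (F c) x \<in> {x \<in> K. \<pi> (G c) x \<in> {0}}"
          using pi(7)[OF G(1) F(1) x(1), of c c] x(1) F(1) by (simp add: GF pi pi_zero)
        show "\<pi> a y \<in> {x \<in> K. \<pi> (G c) x \<in> {0}}" if "a \<in> Q" "y \<in> {x \<in> K. \<pi> (G c) x \<in> {0}}" for a y
          using that commutative[OF G(1) that(1), of y c] by (simp add: pi pi_zero)
      qed auto
      then show ?thesis by (auto simp: B_def)
    qed simp
  qed
  \<comment> \<open>At the ends of the interval one of the two functions is 0. So neither closed set
    is empty, and connectedness of the line applies.\<close>
  moreover have "r \<in> A"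
  proof -
    have "norm (F r) \<le> 0" by (rule is_fc_norm_le[OF F(2) fc]) (simp add: f_def)
    then show ?thesis by (simp add: A_def pi_zero)
  qed
  moreover have "- r \<in> B"
  proof -
    have "norm (G (- r)) \<le> 0" by (rule is_fc_norm_le[OF G(2) fc]) (simp add: g_def)
    then show ?thesis by (simp add: B_def pi_zero)
  qed
  ultimately have "A \<inter> B \<noteq> {}"
    using connected_UNIV[where 'a = real] unfolding connected_closed by blast
  then obtain c where c: "c \<in> A" "c \<in> B" by blast
  \<comment> \<open>The identity \<open>s - c = f c s - g c s\<close>; at the common point
    \<open>c\<close> both parts act as zero.\<close>
  have "norm ((h - complex_of_real c *\<^sub>C unit) - (F c - G c)) \<le> 0"
    by (rule is_fc_norm_le[OF is_fc_diff[OF is_fc_diff[OF is_fc_id[OF fc(1,2)] is_fc_const] is_fc_diff[OF F(2) G(2)]] fc])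
      (simp add: f_def g_def max_def flip: of_real_diff)
  then have "h = complex_of_real c *\<^sub>C unit + (F c - G c)" by (simp add: algebra_simps)
  moreover have "\<pi> (complex_of_real c *\<^sub>C unit + (F c - G c)) x = complex_of_real c *\<^sub>C x" if x: "x \<in> K" for x
    using c x F(1) G(1) unit_in_Q by (simp add: pi Q_closed pi_unit pi_diff_left A_def B_def)
  ultimately show ?thesis by metis
qed

lemma scalar:
  assumes b: "b \<in> Q" shows "\<exists>c. \<forall>x\<in>K. \<pi> b x = c *\<^sub>C x"
proof -
  define h where "h = b + star b"
  define k where "k = \<i> *\<^sub>C (b - star b)"
  have Q: "h \<in> Q" "k \<in> Q" "star h = h" "star k = k"
    using b by (simp_all add: h_def k_def Q_closed star_add star_star star_scaleC star_diff
        scaleC_minus_left scaleC_diff_right add.commute)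
  obtain c d where c: "\<And>x. x \<in> K \<Longrightarrow> \<pi> h x = complex_of_real c *\<^sub>C x"
    and d: "\<And>x. x \<in> K \<Longrightarrow> \<pi> k x = complex_of_real d *\<^sub>C x"
    using selfadjoint_scalar[OF Q(1,3)] selfadjoint_scalar[OF Q(2,4)] by blast
  have "b = (1 / 2) *\<^sub>C (h + (- \<i>) *\<^sub>C k)"
  proof -
    have "(- \<i>) *\<^sub>C k = b - star b" by (simp add: k_def scaleC_scaleC)
    then have "h + (- \<i>) *\<^sub>C k = 2 *\<^sub>C b"
      using scaleC_add_left[of 1 1 b] by (simp add: h_def)
    then show ?thesis by (simp add: scaleC_scaleC)
  qed
  then have "\<pi> b x = ((1 / 2) * (complex_of_real c + (- \<i>) * complex_of_real d)) *\<^sub>C x" if "x \<in> K" for x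
    using that c[OF that] d[OF that] Q pi(6)[of "h + (- \<i>) *\<^sub>C k" x "1 / 2"] pi(5)[of h "(- \<i>) *\<^sub>C k" x] pi(6)[of k x "- \<i>"]
    by (simp add: Q_closed scaleC_scaleC scaleC_add_left flip: scaleC_add_left)
  then show ?thesis by blast
qed

text \<open>All elements act as scalars, so every line is invariant and irreducibility forces
  dimension one. The scalar of \<open>shift\<close> has modulus 1 because \<open>shift\<close> is an
  isometry and \<open>unit\<close> acts identically.\<close>

lemma equivalent_to_character:
  "\<exists>t. cmod t = 1 \<and> unitarily_equivalent Q K \<pi> UNIV (character_representation (qds_character \<tau> m t))"
proof -
  obtain a x0 where x0: "a \<in> Q" "x0 \<in> K" "\<pi> a x0 \<noteq> 0" using irreducibleD(2)[OF irr] by blast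
  then have "x0 \<noteq> 0" using pi_zero(2) by auto
  define u where "u = (1 / norm x0) *\<^sub>R x0"
  have u: "u \<in> K" "cinner u u = 1" "u \<noteq> 0" "norm u = 1"
    using x0 \<open>x0 \<noteq> 0\<close> by (simp_all add: u_def K_closed cinner_self)
  define \<theta> where "\<theta> b = (if b \<in> Q then cinner u (\<pi> b u) else 0)" for b
  have \<theta>: "\<pi> b x = \<theta> b *\<^sub>C x" if b: "b \<in> Q" and x: "x \<in> K" for b x
  proof -
    obtain c where c: "\<forall>x\<in>K. \<pi> b x = c *\<^sub>C x" using scalar[OF b] by blast
    then have "\<theta> b = c" using b u by (simp add: \<theta>_def cinner_scaleC_right)
    then show ?thesis using c x by simp
  qed
  define t where "t = \<theta> shift"
  have char: "is_qds_character \<tau> m t \<theta>"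
    unfolding is_qds_character_def
  proof (intro conjI ballI allI impI)
    fix b d assume "b \<in> Q" "d \<in> Q"
    then show "\<theta> (b + d) = \<theta> b + \<theta> d" using u(1) by (simp add: \<theta>_def Q_closed pi cinner_add_right)
    have "\<pi> (b * d) u = (\<theta> b * \<theta> d) *\<^sub>C u" using \<open>b \<in> Q\<close> \<open>d \<in> Q\<close> u(1) by (simp add: pi \<theta> scaleC_scaleC mult.commute K_closed)
    then show "\<theta> (b * d) = \<theta> b * \<theta> d"
      using \<open>b \<in> Q\<close> \<open>d \<in> Q\<close> u(2) by (simp add: \<theta>_def[of "b * d"] Q_closed cinner_scaleC_right)
  next
    show "\<theta> (c *\<^sub>C b) = c * \<theta> b" if "b \<in> Q" for c b
      using that u(1) by (simp add: \<theta>_def Q_closed pi cinner_scaleC_right)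
    show "\<theta> (star b) = cnj (\<theta> b)" if "b \<in> Q" for b
      using that u(1) pi(8)[OF that u(1) u(1)] cinner_commute[of u "\<pi> (star b) u"] by (simp add: \<theta>_def Q_closed)
    show "\<theta> (\<tau> a k) = 0" if "k \<in> compact_operators" for a k
      using ideal_killed[OF tau_compact_in_ideal[OF that] u(1)] by (simp add: \<theta>_def)
  qed (simp_all add: \<theta>_def t_def shift_def)
  have "cnj t * t = \<theta> unit"
    using is_qds_characterD(2)[OF char Q_closed(8)[OF shift_in_Q] shift_in_Q] is_qds_characterD(4)[OF char shift_in_Q]
    by (simp add: shift_isometry t_def)
  also have "\<dots> = 1" using u by (simp add: \<theta>_def unit_in_Q pi_unit)
  finally have "complex_of_real ((cmod t)\<^sup>2) = 1" using complex_norm_square[of t] by (simp add: mult.commute)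
  then have "(cmod t)\<^sup>2 = 1" by (simp only: of_real_eq_1_iff)
  then have t: "cmod t = 1" using power2_eq_imp_eq[of "cmod t" 1] by simp
  \<comment> \<open>Projection onto the line of \<open>u\<close>; its fixed space is the invariant
    subspace that must be \<open>K\<close>.\<close>
  have "bounded_clinear_on K (\<lambda>x. cinner u x *\<^sub>C u)"
    unfolding bounded_clinear_on_def using pi(1) cauchy_schwarz[of u]
    by (auto simp: cinner_add_right cinner_scaleC_right scaleC_add_left scaleC_scaleC norm_scaleC
        u(4) intro!: exI[of _ 1])
  from closed_csubspace_equalizer[OF this bounded_clinear_on_id[OF pi(1)]]
  have "{x \<in> K. cinner u x *\<^sub>C u = x} = K"
    by (rule irreducibleD(3)[OF irr _ _ _ _ u(3)]) (use u in \<open>auto simp: \<theta> K_closed cinner_scaleC_right simp flip: scaleC_scaleC\<close>)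
  then have span: "cinner u x *\<^sub>C u = x" if "x \<in> K" for x using that by blast
  have "intertwining_unitary Q K \<pi> UNIV (character_representation \<theta>) (cinner u)"
    unfolding intertwining_unitary_def
  proof (intro conjI ballI allI)
    show "cinner (cinner u x) (cinner u y) = cinner x y" if "x \<in> K" "y \<in> K" for x y
      using arg_cong2[of _ _ _ _ cinner, OF span[OF that(1)] span[OF that(2)]] u(2)
      by (simp add: cinner_scaleC_left cinner_scaleC_right cinner_complex_def mult.commute)
    have "c = cinner u (c *\<^sub>C u)" for c using u(2) by (simp add: cinner_scaleC_right)
    then show "cinner u ` K = UNIV" using K_closed(3)[OF u(1)] by blast
    show "cinner u (\<pi> b x) = character_representation \<theta> b (cinner u x)" if "b \<in> Q" "x \<in> K" for b x
      using that by (simp add: \<theta> character_representation_def cinner_scaleC_right)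
  qed (simp_all add: cinner_add_right cinner_scaleC_right)
  then show ?thesis using t qds_character_eqI[OF char] unfolding unitarily_equivalent_iff by blast
qed

end

subsection \<open>Representations that do not vanish on the ideal\<close>

definition corner_space :: "'k set" where "corner_space = {x \<in> K. \<pi> (eps 0 0) x = x}"

lemma closed_corner_space: "closed_csubspace corner_space"
  unfolding corner_space_def
  by (intro closed_csubspace_equalizer pi_clinear in_Q bounded_clinear_on_id pi(1))

lemma pi_eps_in_corner_space: "x \<in> K \<Longrightarrow> \<pi> (eps 0 i) x \<in> corner_space"
  using pi(7)[of "eps 0 0" "eps 0 i" x] by (simp add: corner_space_def pi in_Q eps_mult)

lemma phi_eps: "eps 0 0 * phi a = phi a" "phi a * eps 0 0 = phi a"
  by (simp_all flip: phi_one phi_mult)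

lemma representation_corner: "representation UNIV corner_space (\<lambda>a. \<pi> (phi a))"
proof -
  have inv: "\<pi> (phi a) x \<in> corner_space" if "x \<in> corner_space" for a x
    using that pi(7)[of "eps 0 0" "phi a" x] by (simp add: corner_space_def pi in_Q phi_eps)
  have bnd: "\<exists>k. \<forall>x\<in>corner_space. norm (\<pi> (phi a) x) \<le> k * norm x" for a
    using bounded_clinear_onD(6)[OF pi_clinear[OF in_Q(4)[of a]]] unfolding corner_space_def by blast
  show ?thesis
    unfolding representation_def bounded_operator_on_def using inv bnd closed_corner_space
    by (simp add: phi_add phi_scaleC phi_mult phi_star) (simp add: corner_space_def pi in_Q Q_closed)
qed

lemma irreducible_corner:
  assumes not_killed: "x \<in> K" "\<pi> (\<tau> a (munit i j)) x \<noteq> 0"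
  shows "irreducible_representation UNIV corner_space (\<lambda>a. \<pi> (phi a))"
  unfolding irreducible_representation_def
proof (intro conjI allI impI representation_corner)
  have LK: "corner_space \<subseteq> K" by (auto simp: corner_space_def)
  \<comment> \<open>\<open>eps 0 i\<close> brings a nonzero value of the ideal into the corner, and
    \<open>eps i 0\<close> brings it back, so \<open>z\<close> is nonzero.\<close>
  define z where "z = \<pi> (eps 0 i) (\<pi> (\<tau> a (munit i j)) x)"
  have z: "z \<in> corner_space" unfolding z_def using not_killed by (intro pi_eps_in_corner_space) (simp add: pi in_Q)
  have "\<pi> (eps i 0) z = \<pi> (\<tau> a (munit i j)) x"
  proof -
    have "eps i 0 * (eps 0 i * \<tau> a (munit i j)) = \<tau> a (munit i j)"
      by (simp add: eps_def tau_mult munit_in_toeplitz munit_mult)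
    then show ?thesis using not_killed(1) by (simp add: z_def in_Q Q_closed flip: pi(7))
  qed
  then have "z \<noteq> 0" using not_killed(2) pi_zero(2)[OF in_Q(2)] by metis
  then show "\<exists>a\<in>UNIV. \<exists>x\<in>corner_space. \<pi> (phi a) x \<noteq> 0"
    using z by (intro bexI[of _ 1] bexI[of _ z]) (auto simp: phi_one corner_space_def)
  fix M assume M: "closed_csubspace M \<and> M \<subseteq> corner_space \<and> (\<forall>a\<in>UNIV. \<forall>x\<in>M. \<pi> (phi a) x \<in> M)"
  show "M = {0} \<or> M = corner_space"
  proof (cases "M = {0}")
    case False
    moreover have "0 \<in> M" using csubspaceD(1)[OF closed_csubspaceD(1)] M by blast
    ultimately obtain y where y: "y \<in> M" "y \<noteq> 0" by blast
    \<comment> \<open>\<open>N\<close> consists of the vectors whose whole orbit compresses into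
      \<open>M\<close>. As an intersection of preimages it is closed, and replacing \<open>b\<close>
      by \<open>b * d\<close> shows invariance. It contains \<open>M\<close>, because compressing
      \<open>b\<close> on both sides gives an element of the corner algebra; \<open>b = unit\<close>
      then turns \<open>N = K\<close> into the claim.\<close>
    define N where "N = \<Inter>((\<lambda>b. {y \<in> K. \<pi> (eps 0 0 * b) y \<in> M}) ` Q)"
    have pre: "closed_csubspace {y \<in> K. \<pi> (eps 0 0 * b) y \<in> M}" if "b \<in> Q" for b
      using M that by (intro closed_csubspace_preimage pi_clinear) (auto simp: Q_closed in_Q)
    have "N = K"
    proof (rule irreducibleD(3)[OF irr _ _ _ _ y(2)])
      show "closed_csubspace N"
        using pre unfolding N_def by (auto simp: closed_csubspace_def csubspace_def)
      show "N \<subseteq> K" using unit_in_Q by (auto simp: N_def)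
      show "\<pi> d v \<in> N" if d: "d \<in> Q" and v: "v \<in> N" for d v
      proof -
        have vK: "v \<in> K" using v unit_in_Q by (auto simp: N_def)
        have "\<pi> (eps 0 0 * b) (\<pi> d v) \<in> M" if b: "b \<in> Q" for b
        proof -
          have "\<pi> (eps 0 0 * (b * d)) v \<in> M" using v b d Q_closed(7)[OF b d] by (auto simp: N_def)
          then show ?thesis using pi(7)[OF Q_closed(7)[OF in_Q(2) b] d vK] by (simp add: mult.assoc)
        qed
        then show ?thesis using pi(2)[OF d vK] by (auto simp: N_def)
      qed
      have yL: "y \<in> corner_space" using y M by blast
      have "\<pi> (eps 0 0 * b) y \<in> M" if b: "b \<in> Q" for b
      proof -
        have "\<pi> (eps 0 0 * b) y = \<pi> (eps 0 0 * b) (\<pi> (eps 0 0) y)" using yL by (simp add: corner_space_def)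
        also have "\<dots> = \<pi> (phi (entry b 0 0)) y"
          using pi(7)[OF Q_closed(7)[OF in_Q(2) b] in_Q(2), of y 0 0 0 0] yL
          by (simp add: phi_entry corner_space_def)
        finally show ?thesis using M y by simp
      qed
      then show "y \<in> N" using yL LK by (auto simp: N_def)
    qed
    have "v \<in> M" if v: "v \<in> corner_space" for v
    proof -
      have "v \<in> N" using v LK \<open>N = K\<close> by blast
      then have "\<pi> (eps 0 0 * unit) v \<in> M" using unit_in_Q by (auto simp: N_def)
      then show ?thesis using v by (simp add: unit_mult corner_space_def)
    qed
    then show ?thesis using M by blast
  qed simp
qed

text \<open>The orbit of a vector \<open>x\<close> with some
  \<open>\<pi> (phi a) x \<noteq> 0\<close> is a subspace with invariant closure, hence dense in the
  corner space. By contractivity the image of a countable dense set of \<open>'a\<close> is dense in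
  the orbit.\<close>

lemma corner_space_separable:
  assumes sep: "\<exists>S :: 'a set. countable S \<and> closure S = UNIV"
    and irrL: "irreducible_representation UNIV corner_space (\<lambda>a. \<pi> (phi a))"
  shows "\<exists>d :: nat \<Rightarrow> 'k. corner_space \<subseteq> closure (range d)"
proof -
  note R = representationD[OF irreducibleD(1)[OF irrL], simplified]
  note RT = representation_tendsto[OF irreducibleD(1)[OF irrL] UNIV_I]
    and RTL = representation_tendsto_left[OF cstar_subalgebra_UNIV irreducibleD(1)[OF irrL]]
  obtain a x where x: "x \<in> corner_space" "\<pi> (phi a) x \<noteq> 0" using irreducibleD(2)[OF irrL] by blast
  obtain S :: "'a set" where S: "countable S" "closure S = UNIV" using sep by blast
  define T where "T = range (\<lambda>a. \<pi> (phi a) x)"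
  have T: "csubspace T"
    unfolding csubspace_def T_def
  proof (intro conjI ballI allI)
    show "0 \<in> range (\<lambda>a. \<pi> (phi a) x)"
      using R(6)[OF x(1), of 0 0] by (intro range_eqI[of _ _ 0]) simp
  qed (auto simp: x(1) simp flip: R(5,6))
  have TL: "closure T \<subseteq> corner_space"
    using R(2)[OF x(1)] closed_csubspaceD(2)[OF R(1)] by (intro closure_minimal) (auto simp: T_def)
  have "closure T = corner_space"
  proof (rule irreducibleD(3)[OF irrL csubspace_closure[OF T] TL _ _ x(2)])
    show "\<pi> (phi b) y \<in> closure T" if "y \<in> closure T" for b y
    proof -
      obtain Y where Y: "\<forall>n. Y n \<in> T" "Y \<longlonglongrightarrow> y" using \<open>y \<in> closure T\<close> unfolding closure_sequential by blast
      have YL: "Y n \<in> corner_space" for n using Y(1) TL closure_subset by blast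
      have "\<pi> (phi b) (Y n) \<in> T" for n
        using Y(1)[rule_format, of n] x(1) by (auto simp: T_def simp flip: R(7))
      then show ?thesis
        unfolding closure_sequential using RT[OF YL Y(2), of b]
        by (intro exI[of _ "\<lambda>n. \<pi> (phi b) (Y n)"]) simp
    qed
    show "\<pi> (phi a) x \<in> closure T" by (rule subsetD[OF closure_subset]) (simp add: T_def)
  qed
  moreover have "T \<subseteq> closure ((\<lambda>a. \<pi> (phi a) x) ` S)"
  proof
    fix y assume "y \<in> T"
    then obtain b where b: "y = \<pi> (phi b) x" by (auto simp: T_def)
    have "b \<in> closure S" using S by simp
    then obtain B where B: "\<forall>n. B n \<in> S" "B \<longlonglongrightarrow> b" unfolding closure_sequential by blast
    show "y \<in> closure ((\<lambda>a. \<pi> (phi a) x) ` S)"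
      unfolding closure_sequential b
      using B RTL[OF x(1) UNIV_I B(2)] by (intro exI[of _ "\<lambda>n. \<pi> (phi (B n)) x"]) auto
  qed
  moreover have "S \<noteq> {}" using S(2) by auto
  then have "range (from_nat_into ((\<lambda>a. \<pi> (phi a) x) ` S)) = (\<lambda>a. \<pi> (phi a) x) ` S"
    using S(1) by (intro range_from_nat_into) auto
  ultimately show ?thesis
    by (intro exI[of _ "from_nat_into ((\<lambda>a. \<pi> (phi a) x) ` S)"]) (metis closed_closure closure_minimal)
qed

text \<open>Convergence holds on values of the ideal. The set \<open>M\<close> where it holds is
  invariant: for \<open>x\<close> in \<open>M\<close> the vector \<open>\<pi> b x\<close> is the
  limit of \<open>\<pi> (b * proj n) x\<close>, and \<open>b * proj n\<close> lies in the ideal, so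
  commutation of \<open>b\<close> with \<open>proj n\<close> is not at issue.\<close>

lemma proj_strongly:
  assumes not_killed: "x0 \<in> K" "\<pi> (\<tau> a (munit i j)) x0 \<noteq> 0" and x: "x \<in> K"
  shows "(\<lambda>n. \<pi> (proj n) x) \<longlonglongrightarrow> x"
proof -
  define M where "M = {x \<in> K. (\<lambda>n. \<pi> (proj n) x) \<longlonglongrightarrow> x}"
  have ideal: "\<pi> b y \<in> M" if b: "b \<in> ideal" and y: "y \<in> K" for b y
  proof -
    have bQ: "b \<in> Q" using b ideal_subset_Q by blast
    have "(\<lambda>n. \<pi> (proj n * b) y) \<longlonglongrightarrow> \<pi> b y"
      using bQ by (intro pi_tendsto_left[OF y] proj_approximates b) (simp add: Q_closed in_Q)
    then show ?thesis using bQ y by (simp add: M_def pi in_Q)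
  qed
  have "norm (\<pi> (proj n) x) \<le> norm x" if "x \<in> K" for n x
    using representation_contractive[OF Q_subalgebra pi_rep in_Q(3) that, of n]
      mult_right_mono[OF norm_proj_le norm_ge_zero, of n x] by simp
  then have "closed_csubspace M"
    unfolding M_def by (intro bounded_clinear_on_approximation pi_clinear in_Q(3))
  then have "M = K"
  proof (rule irreducibleD(3)[OF irr _ _ _ _ not_killed(2)])
    show "\<pi> (\<tau> a (munit i j)) x0 \<in> M" by (rule ideal[OF tau_munit_in_ideal not_killed(1)])
    show "\<pi> b x \<in> M" if b: "b \<in> Q" and x: "x \<in> M" for b x
    proof (rule closed_csubspace_limit[OF \<open>closed_csubspace M\<close>])
      have xK: "x \<in> K" using x by (simp add: M_def)
      have lim: "(\<lambda>n. \<pi> (proj n) x) \<longlonglongrightarrow> x" using x by (simp add: M_def)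
      show "\<pi> b (\<pi> (proj n) x) \<in> M" for n
        using ideal[OF ideal_mult_left[OF proj_in_ideal, of b n] xK] b xK by (simp add: pi in_Q)
      show "(\<lambda>n. \<pi> b (\<pi> (proj n) x)) \<longlonglongrightarrow> \<pi> b x"
        by (rule bounded_clinear_on_tendsto(2)[OF pi_clinear[OF b] pi(2)[OF in_Q(3) xK] lim])
    qed
  qed (auto simp: M_def)
  then show ?thesis using x by (auto simp: M_def)
qed

text \<open>Coordinate \<open>n\<close> of \<open>U x\<close> is obtained by moving the range of
  \<open>\<pi> (eps n n)\<close> to the corner with \<open>eps 0 n\<close> and applying
  \<open>V\<close>. Strong convergence of \<open>proj\<close> is the Parseval identity for
  \<open>U\<close>; its range is closed and contains all \<open>vtensor y (ket i)\<close>.\<close>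

lemma equivalent_to_suspended:
  fixes H :: "'h::chilbert_space set"
  assumes not_killed: "x0 \<in> K" "\<pi> (\<tau> a0 (munit i0 j0)) x0 \<noteq> 0"
    and susp: "suspended_representation \<tau> m H \<rho>"
    and V: "intertwining_unitary UNIV corner_space (\<lambda>a. \<pi> (phi a)) H \<rho> V"
  shows "unitarily_equivalent Q K \<pi> (ell2_over H) (qds_representation \<tau> m H \<rho>)"
proof -
  interpret S: suspended_representation \<tau> m H \<rho> by (rule susp)
  note VD = intertwining_unitaryD[OF V]
  note VC = intertwining_unitary_clinear(1)[OF V closed_corner_space]
  note strong = proj_strongly[OF not_killed]
  note L = pi_eps_in_corner_space
  have part: "\<pi> (proj N) x = (\<Sum>n<N. \<pi> (eps n n) x)" if "x \<in> K" for x N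
    unfolding proj_def
    by (rule representation_sum[OF pi_rep cstar_subalgebraD(1)[OF Q_subalgebra] that in_Q(2)])
  have sums: "(\<lambda>n. cinner (V (\<pi> (eps 0 n) x)) (V (\<pi> (eps 0 n) y))) sums cinner x y"
    if x: "x \<in> K" and y: "y \<in> K" for x y
  proof -
    have "cinner (V (\<pi> (eps 0 n) x)) (V (\<pi> (eps 0 n) y)) = cinner x (\<pi> (eps n n) y)" for n
    proof -
      have "cinner (\<pi> (eps 0 n) x) (\<pi> (eps 0 n) y) = cinner x (\<pi> (eps n 0) (\<pi> (eps 0 n) y))"
        using pi(8)[OF in_Q(2)[of n 0] x pi(2)[OF in_Q(2)[of 0 n] y]] by simp
      then show ?thesis
        using VD(3)[OF L[OF x] L[OF y]] pi(7)[OF in_Q(2)[of n 0] in_Q(2)[of 0 n] y] by (simp add: eps_mult)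
    qed
    then have "(\<Sum>n<N. cinner (V (\<pi> (eps 0 n) x)) (V (\<pi> (eps 0 n) y))) = cinner x (\<pi> (proj N) y)" for N
      by (simp add: part[OF y] cinner_sum_right)
    then show ?thesis
      unfolding sums_def by (simp add: tendsto_cinner strong y)
  qed
  define U where "U x = Abs_ell2 (\<lambda>n. V (\<pi> (eps 0 n) x))" for x
  have nth: "ell2_nth (U x) n = V (\<pi> (eps 0 n) x)" if x: "x \<in> K" for x n
  proof -
    have "summable (\<lambda>n. Re (cinner (V (\<pi> (eps 0 n) x)) (V (\<pi> (eps 0 n) x))))"
      using sums_Re[OF sums[OF x x]] by (rule sums_summable)
    then show ?thesis by (simp add: U_def Abs_ell2_inverse norm_sq_cinner)
  qed
  have UH: "U x \<in> ell2_over H" if "x \<in> K" for x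
    unfolding ell2_over_def using VD(6)[OF L[OF that]] by (simp add: nth that)
  have add: "U (x + y) = U x + U y" if "x \<in> K" "y \<in> K" for x y
    using that by (intro ell2_eqI) (simp add: nth K_closed pi in_Q VD(1) L)
  have sc: "U (c *\<^sub>C x) = c *\<^sub>C U x" if "x \<in> K" for c x
    using that by (intro ell2_eqI) (simp add: nth K_closed pi in_Q VD(2) L)
  have iso: "cinner (U x) (U y) = cinner x y" if "x \<in> K" "y \<in> K" for x y
    unfolding cinner_ell2_def using sums_unique[OF sums[OF that]] by (simp add: nth that)
  have "ell2_over H \<subseteq> U ` K"
  proof (rule ell2_over_subset)
    show "closed_csubspace (U ` K)" by (rule closed_isometric_image(2)[OF pi(1) add sc iso])
    fix y i assume "y \<in> H"
    then obtain z where z: "z \<in> corner_space" "y = V z" using VD(4) by blast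
    then have zK: "z \<in> K" "\<pi> (eps 0 0) z = z" by (auto simp: corner_space_def)
    have "U (\<pi> (eps i 0) z) = vtensor y (ket i)"
    proof (rule ell2_eqI)
      fix n
      have "\<pi> (eps 0 n) (\<pi> (eps i 0) z) = (if n = i then z else 0)"
        using zK by (simp add: eps_mult pi_zero in_Q flip: pi(7))
      then show "ell2_nth (U (\<pi> (eps i 0) z)) n = ell2_nth (vtensor y (ket i)) n"
        using zK bounded_clinear_onD(5)[OF VC] by (simp add: nth pi in_Q z(2))
    qed
    then show "vtensor y (ket i) \<in> U ` K" using pi(2)[OF in_Q(2) zK(1)] by (metis imageI)
  qed
  then have surj: "U ` K = ell2_over H" using UH by blast
  have inter: "U (\<pi> b x) = qds_representation \<tau> m H \<rho> b (U x)" if b: "b \<in> Q" and x: "x \<in> K" for b x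
  proof -
    have "S.susp b (U x) = U (\<pi> b x)"
    proof (rule S.susp_eqI[OF UH[OF x]])
      fix i
      have ib: "eps 0 i * b \<in> Q" by (simp add: Q_closed in_Q b)
      \<comment> \<open>Here \<open>eps j j\<close> is split as \<open>eps j 0 * eps 0 j\<close>:
        the first factor completes the matrix entry, the second produces coordinate \<open>j\<close>
        of \<open>U x\<close>.\<close>
      have summand: "\<rho> (entry b i j) (ell2_nth (U x) j) = V (\<pi> (eps 0 i * b) (\<pi> (eps j j) x))" for j
      proof -
        have "\<rho> (entry b i j) (ell2_nth (U x) j) = V (\<pi> (phi (entry b i j)) (\<pi> (eps 0 j) x))"
          using VD(5)[OF UNIV_I L[OF x], of "entry b i j" j] by (simp add: nth x)
        also have "\<pi> (phi (entry b i j)) (\<pi> (eps 0 j) x) = \<pi> (eps 0 i * b * (eps j 0 * eps 0 j)) x"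
          unfolding phi_entry using x by (simp add: Q_closed in_Q b mult.assoc flip: pi(7))
        finally show ?thesis using x by (simp add: eps_mult pi ib in_Q)
      qed
      have "(\<Sum>j<N. V (\<pi> (eps 0 i * b) (\<pi> (eps j j) x))) = V (\<pi> (eps 0 i * b) (\<pi> (proj N) x))" for N
      proof (induction N)
        case 0
        then show ?case using bounded_clinear_onD(5)[OF VC] by (simp add: proj_def pi_zero x ib)
      next
        case (Suc N)
        have "\<pi> (proj (Suc N)) x = \<pi> (proj N) x + \<pi> (eps N N) x"
          using x by (simp add: proj_def in_Q flip: pi(5)) (simp add: pi(5) in_Q flip: proj_def)
        moreover have cs: "\<pi> (eps 0 i * b) y \<in> corner_space" if "y \<in> K" for y
          using L[OF pi(2)[OF b that], of i] that by (simp add: pi in_Q b)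
        ultimately show ?case using Suc x
          by (simp add: pi(3)[OF ib] pi(2) in_Q VD(1) cs)
      qed
      moreover have "(\<lambda>N. V (\<pi> (eps 0 i * b) (\<pi> (proj N) x))) \<longlonglongrightarrow> V (\<pi> (eps 0 i * b) x)"
      proof (rule bounded_clinear_on_tendsto(2)[OF VC])
        show "\<pi> (eps 0 i * b) (\<pi> (proj n) x) \<in> corner_space" for n
          using L[OF pi(2)[OF b pi(2)[OF in_Q(3) x]], of i] x by (simp add: pi in_Q b)
        show "(\<lambda>N. \<pi> (eps 0 i * b) (\<pi> (proj N) x)) \<longlonglongrightarrow> \<pi> (eps 0 i * b) x"
          by (rule bounded_clinear_on_tendsto(2)[OF pi_clinear[OF ib] pi(2)[OF in_Q(3) x] strong[OF x]])
      qed
      ultimately show "(\<lambda>j. \<rho> (entry b i j) (ell2_nth (U x) j)) sums ell2_nth (U (\<pi> b x)) i"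
        unfolding sums_def summand nth[OF pi(2)[OF b x]] by (simp only: pi(7)[OF in_Q(2) b x])
    qed
    then show ?thesis by (simp add: S.qds_representation_susp b UH x)
  qed
  show ?thesis
    unfolding unitarily_equivalent_iff intertwining_unitary_def
    using add sc iso surj inter by blast
qed

end

theorem theorem5p7:
  fixes \<tau> :: "'a::unital_cstar_algebra \<Rightarrow> complex ell2 bop \<Rightarrow> 'b::cstar_algebra"
    and m :: nat
    and I :: "'i set"
    and H :: "'i \<Rightarrow> 'h::chilbert_space set"
    and \<rho> :: "'i \<Rightarrow> 'a \<Rightarrow> 'h \<Rightarrow> 'h"
  assumes separable: "\<exists>Q :: 'a set. countable Q \<and> closure Q = UNIV"
    and m_pos: "m > 0"
    and tensor: "is_cstar_tensor UNIV toeplitz UNIV \<tau>"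
    and irreducible: "\<forall>i\<in>I. irreducible_representation UNIV (H i) (\<rho> i)"
    and inequivalent:
      "\<forall>i\<in>I. \<forall>j\<in>I. i \<noteq> j \<longrightarrow> \<not> unitarily_equivalent UNIV (H i) (\<rho> i) (H j) (\<rho> j)"
    and complete:
      "\<forall>(L :: complex ell2 set) \<sigma>. irreducible_representation UNIV L \<sigma> \<longrightarrow>
         (\<exists>i\<in>I. unitarily_equivalent UNIV L \<sigma> (H i) (\<rho> i))"
  shows
    "(\<forall>i\<in>I. irreducible_representation (qds \<tau> m) (ell2_over (H i))
         (qds_representation \<tau> m (H i) (\<rho> i))) \<and>
     (\<forall>t. cmod t = 1 \<longrightarrow> irreducible_representation (qds \<tau> m) UNIV
         (character_representation (qds_character \<tau> m t))) \<and>
     (\<forall>i\<in>I. \<forall>j\<in>I. i \<noteq> j \<longrightarrow> \<not> unitarily_equivalent (qds \<tau> m)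
         (ell2_over (H i)) (qds_representation \<tau> m (H i) (\<rho> i))
         (ell2_over (H j)) (qds_representation \<tau> m (H j) (\<rho> j))) \<and>
     (\<forall>s t. cmod s = 1 \<and> cmod t = 1 \<and> s \<noteq> t \<longrightarrow> \<not> unitarily_equivalent (qds \<tau> m)
         UNIV (character_representation (qds_character \<tau> m s))
         UNIV (character_representation (qds_character \<tau> m t))) \<and>
     (\<forall>i\<in>I. \<forall>t. cmod t = 1 \<longrightarrow> \<not> unitarily_equivalent (qds \<tau> m)
         (ell2_over (H i)) (qds_representation \<tau> m (H i) (\<rho> i))
         UNIV (character_representation (qds_character \<tau> m t))) \<and>
     (\<forall>(K :: 'k::chilbert_space set) \<pi>. irreducible_representation (qds \<tau> m) K \<pi> \<longrightarrow>
         (\<exists>i\<in>I. unitarily_equivalent (qds \<tau> m) K \<pi>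
            (ell2_over (H i)) (qds_representation \<tau> m (H i) (\<rho> i))) \<or>
         (\<exists>t. cmod t = 1 \<and> unitarily_equivalent (qds \<tau> m) K \<pi>
            UNIV (character_representation (qds_character \<tau> m t))))"
proof -
  interpret torsioned_suspension \<tau> m by unfold_locales (fact tensor, fact m_pos)
  have susp: "suspended_representation \<tau> m (H i) (\<rho> i)" if "i \<in> I" for i
  proof unfold_locales
    have irr: "irreducible_representation UNIV (H i) (\<rho> i)" using irreducible that by blast
    show "representation UNIV (H i) (\<rho> i)" by (rule irreducibleD(1)[OF irr])
    show "\<rho> i 1 x = x" if "x \<in> H i" for x
      by (rule irreducible_unit[OF irr cstar_subalgebra_UNIV _ _ _ that]) simp_all
  qed
  have complete': "(\<exists>i\<in>I. unitarily_equivalent (qds \<tau> m) K \<pi> (ell2_over (H i)) (qds_representation \<tau> m (H i) (\<rho> i))) \<or>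
      (\<exists>t. cmod t = 1 \<and> unitarily_equivalent (qds \<tau> m) K \<pi> UNIV (character_representation (qds_character \<tau> m t)))"
    if irr: "irreducible_representation (qds \<tau> m) K \<pi>" for K :: "'k set" and \<pi>
  proof -
    interpret K: irreducible_suspension_representation \<tau> m K \<pi> by unfold_locales (rule irr)
    show ?thesis
    proof (cases "\<forall>a i j. \<forall>x\<in>K. \<pi> (\<tau> a (munit i j)) x = 0")
      case True
      then show ?thesis using K.equivalent_to_character by blast
    next
      case False
      then obtain a i j x where x: "x \<in> K" "\<pi> (\<tau> a (munit i j)) x \<noteq> 0" by blast
      note irrL = K.irreducible_corner[OF x]
      \<comment> \<open>The hypothesis \<open>complete\<close> applies to the isometric copy of the
        corner space in \<open>complex ell2\<close>; composing with \<open>W\<close> returns to the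
        corner space itself.\<close>
      obtain d :: "nat \<Rightarrow> 'k" where d: "K.corner_space \<subseteq> closure (range d)"
        using K.corner_space_separable[OF separable irrL] by blast
      obtain W :: "'k \<Rightarrow> complex ell2" where
        W: "\<forall>x\<in>K.corner_space. \<forall>y\<in>K.corner_space. W (x + y) = W x + W y"
          "\<forall>c. \<forall>x\<in>K.corner_space. W (c *\<^sub>C x) = c *\<^sub>C W x"
          "\<forall>x\<in>K.corner_space. \<forall>y\<in>K.corner_space. cinner (W x) (W y) = cinner x y"
        using separable_embedding[OF K.closed_corner_space d] by blast
      obtain \<sigma> where \<sigma>: "irreducible_representation UNIV (W ` K.corner_space) \<sigma>"
        "intertwining_unitary UNIV K.corner_space (\<lambda>a. \<pi> (phi a)) (W ` K.corner_space) \<sigma> W"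
        using irreducible_transport[OF irrL UNIV_I, of W] W by blast
      obtain i where i: "i \<in> I" "unitarily_equivalent UNIV (W ` K.corner_space) \<sigma> (H i) (\<rho> i)"
        using complete \<sigma>(1) by blast
      then obtain V where "intertwining_unitary UNIV (W ` K.corner_space) \<sigma> (H i) (\<rho> i) V"
        unfolding unitarily_equivalent_iff by blast
      from K.equivalent_to_suspended[OF x susp[OF i(1)] intertwining_unitary_trans[OF \<sigma>(2) this]]
      show ?thesis using i(1) by blast
    qed
  qed
  show ?thesis
  proof (intro conjI ballI allI impI)
    fix i j assume i: "i \<in> I" and j: "j \<in> I" and "i \<noteq> j"
    then show "\<not> unitarily_equivalent Q (ell2_over (H i)) (qds_representation \<tau> m (H i) (\<rho> i))
        (ell2_over (H j)) (qds_representation \<tau> m (H j) (\<rho> j))"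
      using unitarily_equivalent_of_suspended[OF susp[OF i] susp[OF j]] inequivalent by blast
  next
    fix s t assume "cmod s = 1 \<and> cmod t = 1 \<and> s \<noteq> t"
    then show "\<not> unitarily_equivalent Q UNIV (character_representation (qds_character \<tau> m s))
        UNIV (character_representation (qds_character \<tau> m t))"
      using characters_inequivalent by blast
  qed (simp_all add: suspended_representation.irreducible_qds_representation[OF susp] irreducible_character
      suspended_representation.not_equivalent_character[OF susp] irreducible complete')
qed

end
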